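(* Let $G$ be a compact Abelian group, and let $\Omega_+,\Omega_-$ be symmetric Borel subsets of $G$ with $0\in\operatorname{int}\Omega_+$ and such that the complements $\Omega_+^c$ and $\Omega_-^c$ satisfy Assumption O. Then the linear programming problem $$\mathcal{C}_G(\Omega_+,\Omega_-):=\sup\left\{\int_G\varphi\,d\lambda_G:\ \varphi\in\mathcal{F}_G(\Omega_+,\Omega_-)\right\}$$ has dual problem $$\mathcal{C}_G(\Omega_+,\Omega_-)^*:=\inf\{\alpha\in\mathbb{R}:\ \alpha\delta_0-\lambda_G\in M^*(\Omega_-)-M^*(\Omega_+)+T_0(G)\},$$ and the strong duality relation $$\mathcal{C}_G(\Omega_+,\Omega_-)=\mathcal{C}_G(\Omega_+,\Omega_-)^*$$ holds.
   Context: $G$ is a compact (Hausdorff) Abelian group, written additively with identity $0$, normalised Haar measure $\lambda_G$ ($\lambda_G(G)=1$) and dual group $\widehat G$. A set $S\subset G$ is symmetric if $-S=S$; $S^c=G\setminus S$. $C(G)$ is the space of continuous real-valued functions on $G$, $\widehat\varphi$ is the Fourier transform of $\varphi$, and $M(G)$ is the space of real-valued regular signed Borel measures on $G$. $\delta_0\in M(G)$ is the Dirac measure at $0$. Function class: $$\mathcal{F}_G(\Omega_+,\Omega_-):=\{\varphi\in C(G):\ \widehat\varphi\ge 0,\ \varphi(0)=1,\ \varphi|_{\Omega_+^c}\le 0,\ \varphi|_{\Omega_-^c}\ge 0\}.$$ Assumption O: a set $S\subset G$ satisfies Assumption O if for every $g\in S$ and every open neighbourhood $V$ of $g$ one has $\lambda_G(V\cap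 S)>0$. For $\Theta\subset G$: $M^*(\Theta):=\{\mu\in M(G):\ \mu \text{ is a non-negative measure and } \operatorname{supp}(\mu)\subseteq\overline{G\setminus\Theta}\}$. A measure $\mu\in M(G)$ is positive definite if $\int_G u\star\widetilde u\,d\mu\ge 0$ for all continuous (complex-valued) functions $u$ on $G$, where $\widetilde u(g):=\overline{u(-g)}$ and $\star$ is convolution with respect to $\lambda_G$. $T_0(G)$ is the set of all positive definite $\tau\in M(G)$ with $\tau(G)=0$. Sums and differences of sets of measures are Minkowski sums and differences. Sense of "dual problem": put $Q:=\{\varphi\in C(G):\varphi|_{\Omega_+^c}\le0,\ \varphi|_{\Omega_-^c}\ge0\}$ and $Q^*:=\{\mu\in M(G):\int_G\varphi\,d\mu\ge0\ \forall\varphi\in Q\}$. Let $\mathbf 1$ denote the trivial character. The primal problem is written as $\mathcal{C}_G(\Omega_+,\Omega_-)=1/(1+u)$, where $$u=\inf\Big\{\sum_{\gamma\ne\mathbf 1}f(\gamma):\ f\in\ell^1(\widehat G),\ f\ge0,\ \mathbf 1+\sum_{\gamma\ne\mathbf 1}f(\gamma)\gamma\in Q\Big\}.$$ The linear programming dual of $u$ is $$v=\sup\Big\{-\mu(G):\ \mu\in Q^*,\ \int_G\gamma\,d\mu\le1\ \forall\gamma\ne\mathbf 1\Big\}$$ (inequalities between Fourier transforms include that the quantities are real), and $\mathcal{C}_G(\Omega_+,\Omega_-)^*$ is the dual problem in the sense that $\mathcal{C}_G(\Omega_+,\Omega_-)^*=1/(1+v)$. *)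

theory Defs
  imports "HOL-Analysis.Analysis"
begin

text \<open>
  A compact Abelian group is a type \<open>'a\<close> of classes \<open>topological_ab_group_add\<close> and \<open>t2_space\<close>
  with \<open>compact (UNIV :: 'a set)\<close>; its Haar measure \<open>haar\<close> is a parameter subject to
  \<open>normalised_haar\<close>, which determines it uniquely.
\<close>


subsection \<open>Regular Borel measures and regular signed Borel measures\<close>

definition regular_borel :: "'a::topological_space measure \<Rightarrow> bool" where
  "regular_borel M \<longleftrightarrow> sets M = sets borel \<and>
     (\<forall>A\<in>sets borel.
        emeasure M A = (INF U\<in>{U. open U \<and> A \<subseteq> U}. emeasure M U) \<and>
        emeasure M A = (SUP K\<in>{K. compact K \<and> K \<subseteq> A}. emeasure M K))"

definition normalised_haar :: "'a::{topological_ab_group_add, t2_space} measure \<Rightarrow> bool" where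
  "normalised_haar haar \<longleftrightarrow> regular_borel haar \<and> emeasure haar UNIV = 1 \<and>
     (\<forall>g. \<forall>A\<in>sets borel. emeasure haar ((+) g ` A) = emeasure haar A)"

text \<open>
  A signed Borel measure is a countably additive real-valued set function on the Borel sets.  It is
  given the value \<open>0\<close> on every other set, so that equality of measures is equality of functions.
  Since \<open>sums\<close> is required for every enumeration of the sets, the series converge absolutely;
  the constant sequence \<open>{}\<close> yields \<open>\<mu> {} = 0\<close>.
\<close>

definition signed_borel_measure :: "('a::topological_space set \<Rightarrow> real) \<Rightarrow> bool" where
  "signed_borel_measure \<mu> \<longleftrightarrow> (\<forall>A. A \<notin> sets borel \<longrightarrow> \<mu> A = 0) \<and>
     (\<forall>A :: nat \<Rightarrow> 'a set. range A \<subseteq> sets borel \<longrightarrow> disjoint_family A \<longrightarrow>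
        (\<lambda>n. \<mu> (A n)) sums \<mu> (\<Union>n. A n))"

text \<open>
  Jordan decomposition: \<open>\<mu>\<^sup>+(A)\<close> is the supremum of \<open>\<mu>(B)\<close> over Borel \<open>B \<subseteq> A\<close>.  The coercion
  \<open>ennreal\<close> truncates negative values to \<open>0\<close>, which is the value at \<open>B = {}\<close> anyway.
\<close>

definition upper_variation :: "('a::topological_space set \<Rightarrow> real) \<Rightarrow> 'a measure" where
  "upper_variation \<mu> = measure_of UNIV (sets borel)
     (\<lambda>A. SUP B\<in>{B \<in> sets borel. B \<subseteq> A}. ennreal (\<mu> B))"

definition lower_variation :: "('a::topological_space set \<Rightarrow> real) \<Rightarrow> 'a measure" where
  "lower_variation \<mu> = upper_variation (\<lambda>A. - \<mu> A)"

definition total_variation :: "('a::topological_space set \<Rightarrow> real) \<Rightarrow> 'a measure" where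
  "total_variation \<mu> = measure_of UNIV (sets borel)
     (\<lambda>A. emeasure (upper_variation \<mu>) A + emeasure (lower_variation \<mu>) A)"

definition signed_integral ::
    "('a::topological_space set \<Rightarrow> real) \<Rightarrow> ('a \<Rightarrow> 'b::{banach, second_countable_topology}) \<Rightarrow> 'b" where
  "signed_integral \<mu> f =
     integral\<^sup>L (upper_variation \<mu>) f - integral\<^sup>L (lower_variation \<mu>) f"

definition regular_signed_measures :: "('a::topological_space set \<Rightarrow> real) set" where
  "regular_signed_measures = {\<mu>. signed_borel_measure \<mu> \<and> regular_borel (total_variation \<mu>)}"

definition measure_support :: "('a::topological_space set \<Rightarrow> real) \<Rightarrow> 'a set" where
  "measure_support \<mu> = {x. \<forall>V. open V \<longrightarrow> x \<in> V \<longrightarrow> emeasure (total_variation \<mu>) V > 0}"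

definition dirac :: "'a::topological_space \<Rightarrow> 'a set \<Rightarrow> real" where
  "dirac x A = (if A \<in> sets borel then indicator A x else 0)"

text \<open>
  Minkowski sums and differences of sets of measures; the library's \<open>-\<close> on sets is the
  set-theoretic difference.
\<close>

definition minkowski_sum :: "('b \<Rightarrow> real) set \<Rightarrow> ('b \<Rightarrow> real) set \<Rightarrow> ('b \<Rightarrow> real) set" where
  "minkowski_sum X Y = {\<lambda>A. \<mu> A + \<nu> A | \<mu> \<nu>. \<mu> \<in> X \<and> \<nu> \<in> Y}"

definition minkowski_diff :: "('b \<Rightarrow> real) set \<Rightarrow> ('b \<Rightarrow> real) set \<Rightarrow> ('b \<Rightarrow> real) set" where
  "minkowski_diff X Y = {\<lambda>A. \<mu> A - \<nu> A | \<mu> \<nu>. \<mu> \<in> X \<and> \<nu> \<in> Y}"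


subsection \<open>Dual group, Fourier transform, positive definite measures\<close>

definition dual_group :: "('a::topological_ab_group_add \<Rightarrow> complex) set" where
  "dual_group = {\<gamma>. continuous_on UNIV \<gamma> \<and> (\<forall>x. cmod (\<gamma> x) = 1) \<and>
     (\<forall>x y. \<gamma> (x + y) = \<gamma> x * \<gamma> y)}"

abbreviation trivial_character :: "'a \<Rightarrow> complex" where
  "trivial_character \<equiv> \<lambda>_. 1"

definition fourier :: "'a measure \<Rightarrow> ('a \<Rightarrow> real) \<Rightarrow> ('a \<Rightarrow> complex) \<Rightarrow> complex" where
  "fourier haar \<phi> \<gamma> = (LINT x|haar. complex_of_real (\<phi> x) * cnj (\<gamma> x))"

definition convolution ::
    "'a::ab_group_add measure \<Rightarrow> ('a \<Rightarrow> complex) \<Rightarrow> ('a \<Rightarrow> complex) \<Rightarrow> 'a \<Rightarrow> complex" where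
  "convolution haar u w g = (LINT h|haar. u h * w (g - h))"

text \<open>
  Throughout, a complex number is called non-negative if it lies in \<open>\<real>\<^sub>\<ge>\<^sub>0\<close>, i.e. if it is real
  and non-negative.
\<close>

definition positive_definite_measure ::
    "'a::topological_ab_group_add measure \<Rightarrow> ('a set \<Rightarrow> real) \<Rightarrow> bool" where
  "positive_definite_measure haar \<mu> \<longleftrightarrow>
     (\<forall>u :: 'a \<Rightarrow> complex. continuous_on UNIV u \<longrightarrow>
        signed_integral \<mu> (convolution haar u (\<lambda>g. cnj (u (- g)))) \<in> \<real>\<^sub>\<ge>\<^sub>0)"


subsection \<open>The primal extremal problem\<close>

definition assumption_O :: "'a::topological_space measure \<Rightarrow> 'a set \<Rightarrow> bool" where
  "assumption_O haar S \<longleftrightarrow>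
     (\<forall>g\<in>S. \<forall>V. open V \<longrightarrow> g \<in> V \<longrightarrow> emeasure haar (V \<inter> S) > 0)"

definition sign_cone :: "'a::topological_space set \<Rightarrow> 'a set \<Rightarrow> ('a \<Rightarrow> real) set" where
  "sign_cone \<Omega>p \<Omega>m = {\<phi>. continuous_on UNIV \<phi> \<and>
     (\<forall>x\<in>- \<Omega>p. \<phi> x \<le> 0) \<and> (\<forall>x\<in>- \<Omega>m. \<phi> x \<ge> 0)}"

definition function_class ::
    "'a::topological_ab_group_add measure \<Rightarrow> 'a set \<Rightarrow> 'a set \<Rightarrow> ('a \<Rightarrow> real) set" where
  "function_class haar \<Omega>p \<Omega>m = {\<phi>. continuous_on UNIV \<phi> \<and>
     (\<forall>\<gamma>\<in>dual_group. fourier haar \<phi> \<gamma> \<in> \<real>\<^sub>\<ge>\<^sub>0) \<and> \<phi> 0 = 1 \<and>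
     (\<forall>x\<in>- \<Omega>p. \<phi> x \<le> 0) \<and> (\<forall>x\<in>- \<Omega>m. \<phi> x \<ge> 0)}"

text \<open>
  Suprema and infima are taken in \<open>ereal\<close>, so that none of the values below is an artefact of
  the convention for suprema of empty or unbounded sets of reals.
\<close>

definition primal_value ::
    "'a::topological_ab_group_add measure \<Rightarrow> 'a set \<Rightarrow> 'a set \<Rightarrow> ereal" where
  "primal_value haar \<Omega>p \<Omega>m = (SUP \<phi>\<in>function_class haar \<Omega>p \<Omega>m. ereal (LINT x|haar. \<phi> x))"


subsection \<open>The dual extremal problem\<close>

definition M_star :: "'a::topological_space set \<Rightarrow> ('a set \<Rightarrow> real) set" where
  "M_star \<Theta> = {\<mu> \<in> regular_signed_measures.
     (\<forall>A. \<mu> A \<ge> 0) \<and> measure_support \<mu> \<subseteq> closure (- \<Theta>)}"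

definition T_zero :: "'a::topological_ab_group_add measure \<Rightarrow> ('a set \<Rightarrow> real) set" where
  "T_zero haar = {\<tau> \<in> regular_signed_measures.
     positive_definite_measure haar \<tau> \<and> \<tau> UNIV = 0}"

definition dual_value ::
    "'a::topological_ab_group_add measure \<Rightarrow> 'a set \<Rightarrow> 'a set \<Rightarrow> ereal" where
  "dual_value haar \<Omega>p \<Omega>m = (INF \<alpha>\<in>{\<alpha> :: real.
      (\<lambda>A. \<alpha> * dirac 0 A - measure haar A)
        \<in> minkowski_sum (minkowski_diff (M_star \<Omega>m) (M_star \<Omega>p)) (T_zero haar)}. ereal \<alpha>)"


subsection \<open>The associated linear programme and its linear programming dual\<close>

text \<open>
  The elements of \<open>sign_cone\<close> are real-valued whereas characters are complex-valued, hence the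
  embedding \<open>complex_of_real\<close>.
\<close>

definition lp_primal_feasible ::
    "'a::topological_ab_group_add set \<Rightarrow> 'a set \<Rightarrow> (('a \<Rightarrow> complex) \<Rightarrow> real) set" where
  "lp_primal_feasible \<Omega>p \<Omega>m = {f. f summable_on dual_group \<and> (\<forall>\<gamma>\<in>dual_group. f \<gamma> \<ge> 0) \<and>
     (\<exists>\<phi>\<in>sign_cone \<Omega>p \<Omega>m. \<forall>x. complex_of_real (\<phi> x) =
        trivial_character x
        + (\<Sum>\<^sub>\<infinity>\<gamma>\<in>dual_group - {trivial_character}. complex_of_real (f \<gamma>) * \<gamma> x))}"

definition lp_primal_value :: "'a::topological_ab_group_add set \<Rightarrow> 'a set \<Rightarrow> ereal" where
  "lp_primal_value \<Omega>p \<Omega>m = (INF f\<in>lp_primal_feasible \<Omega>p \<Omega>m.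
     ereal (\<Sum>\<^sub>\<infinity>\<gamma>\<in>dual_group - {trivial_character}. f \<gamma>))"

definition sign_cone_dual :: "'a::topological_space set \<Rightarrow> 'a set \<Rightarrow> ('a set \<Rightarrow> real) set" where
  "sign_cone_dual \<Omega>p \<Omega>m = {\<mu> \<in> regular_signed_measures.
     \<forall>\<phi>\<in>sign_cone \<Omega>p \<Omega>m. signed_integral \<mu> \<phi> \<ge> 0}"

definition lp_dual_feasible ::
    "'a::topological_ab_group_add set \<Rightarrow> 'a set \<Rightarrow> ('a set \<Rightarrow> real) set" where
  "lp_dual_feasible \<Omega>p \<Omega>m = {\<mu> \<in> sign_cone_dual \<Omega>p \<Omega>m.
     \<forall>\<gamma>\<in>dual_group - {trivial_character}. 1 - signed_integral \<mu> \<gamma> \<in> \<real>\<^sub>\<ge>\<^sub>0}"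

definition lp_dual_value :: "'a::topological_ab_group_add set \<Rightarrow> 'a set \<Rightarrow> ereal" where
  "lp_dual_value \<Omega>p \<Omega>m = (SUP \<mu>\<in>lp_dual_feasible \<Omega>p \<Omega>m. ereal (- \<mu> UNIV))"

end

theory Submission
  imports Defs
begin

text \<open>
  Let \<open>u\<close> be the value of the linear programme.  A function \<open>\<phi>\<close> of the class with \<open>c = \<integral>\<phi> > 0\<close>
  is a continuous function with non-negative Fourier coefficients; such coefficients are summable and
  recover the function.  Writing \<open>\<phi>^\<close> for the Fourier transform, \<open>\<phi> / c\<close> is the sum of \<open>\<one>\<close> and of
  the series of all \<open>(\<phi>^(\<gamma>) / c) \<gamma>\<close> with \<open>\<gamma> \<noteq> \<one>\<close>; it is feasible with value \<open>1 / c - 1\<close>.  This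
  correspondence can be reversed, and the primal value is \<open>1 / (1 + u)\<close>.  Both weak duality
  inequalities come from integrating an absolutely convergent series of characters against a measure,
  term by term (\<open>lp_weak_duality\<close>, \<open>function_class_dual_bound\<close>).

  Strong duality starts from the primal side, where there is compactness.  The non-negative
  coefficient families of total mass at most \<open>r\<close> are compact for pointwise convergence, and this is
  weak-star convergence of summable families: it is seen by every density whose Fourier coefficients
  tend to zero, in particular by every bounded Borel density.  Assumption O makes the sign
  conditions on a continuous function equivalent to inequalities against bounded densities carried
  by \<open>\<Omega>\<^sub>+\<^sup>c\<close> or \<open>\<Omega>\<^sub>-\<^sup>c\<close>.  If \<open>r < u\<close>, no family of mass at most \<open>r\<close> is feasible; compactness and a
  separation argument in the plane then give one density \<open>p = a - b\<close> that refutes all of them at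
  once.  Testing \<open>p\<close> on the zero family and on families carried by a character and its conjugate shows
  that, after scaling, \<open>p\<lambda>\<close> is feasible for the dual programme with value \<open>r\<close>, and that
  \<open>\<delta>\<^sub>0 / (1 + r) - \<lambda> - p\<lambda> / (1 + r)\<close> is positive definite with total mass zero.  Letting
  \<open>r\<close> tend to \<open>u\<close>, such measures bring both dual problems to the bounds given by weak duality: their
  values are \<open>u\<close> and \<open>1 / (1 + u)\<close>.

  All of this rests on the uniqueness theorem: a continuous function whose Fourier coefficients vanish
  is zero (\<open>fourier_uniqueness\<close>).  It is proved inside the convolution algebra of continuous functions.
  For Hermitian \<open>s \<noteq> 0\<close> the squared \<open>L\<^sup>2\<close> norms of the powers of \<open>s\<close> form a log-convex and
  submultiplicative sequence.  This forces the powers of \<open>s \<star> s\<close>, divided by those of a suitable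
  \<open>\<mu> > 0\<close>, to converge uniformly to a Hermitian idempotent \<open>e \<noteq> 0\<close> with \<open>s \<star> s \<star> e = \<mu> e\<close>.
  A non-zero Hermitian idempotent satisfies \<open>e(0) = \<parallel>e\<parallel>\<^sup>2 \<ge> 1\<close>, so splitting idempotents terminates, and a
  minimal one spans a translation-invariant line: it is a character.
\<close>

section \<open>Step functions and iterated integrals on a compact space\<close>

lemma continuous_on_uniform_approximation:
  fixes f :: "'b::topological_space \<Rightarrow> 'c::metric_space"
  assumes "\<And>\<epsilon>. \<epsilon> > 0 \<Longrightarrow> \<exists>h. continuous_on S h \<and> (\<forall>x\<in>S. dist (f x) (h x) \<le> \<epsilon>)"
  shows "continuous_on S f"
  unfolding continuous_on_def
proof (intro ballI tendstoI)
  fix x and e :: real assume x: "x \<in> S" and e: "e > 0"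
  obtain h where h: "continuous_on S h" "\<And>y. y \<in> S \<Longrightarrow> dist (f y) (h y) \<le> e / 4"
    using assms[of "e / 4"] e by auto
  have "\<forall>\<^sub>F y in at x within S. dist (h y) (h x) < e / 4"
    using h(1) x e unfolding continuous_on_def by (intro tendstoD) auto
  moreover have "\<forall>\<^sub>F y in at x within S. y \<in> S"
    by (simp add: eventually_at_topological) (use open_UNIV in blast)
  ultimately show "\<forall>\<^sub>F y in at x within S. dist (f y) (f x) < e"
  proof eventually_elim
    case (elim y)
    have "dist (f y) (f x) \<le> dist (f y) (h y) + dist (h y) (h x) + dist (f x) (h x)"
      using dist_triangle[of "f y" "f x" "h y"] dist_triangle[of "h y" "f x" "h x"] by (simp add: dist_commute)
    also have "\<dots> < e" using elim h(2)[of y] h(2)[OF x] e by linarith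
    finally show ?case .
  qed
qed

lemma nonpos_if_le_every_positive_multiple:
  fixes a C :: real
  assumes "\<And>\<epsilon>. \<epsilon> > 0 \<Longrightarrow> a \<le> C * \<epsilon>"
  shows "a \<le> 0"
proof -
  have "(\<lambda>n. C * inverse (real (Suc n))) \<longlonglongrightarrow> C * 0"
    by (intro tendsto_intros LIMSEQ_inverse_real_of_nat)
  then have "a \<le> C * 0"
    using assms by (intro LIMSEQ_le_const) auto
  then show ?thesis by simp
qed

lemma space_eq_UNIV_if_sets_borel: "sets M = sets borel \<Longrightarrow> space M = UNIV"
  by (metis sets_eq_imp_space_eq space_borel)

text \<open>
  Only the first \<open>n\<close> blocks matter: they cover the space, so disjointness makes the others empty.
\<close>

definition borel_partition :: "nat \<Rightarrow> (nat \<Rightarrow> 'a::topological_space set) \<Rightarrow> bool" where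
  "borel_partition n B \<longleftrightarrow>
     (\<forall>i. B i \<in> sets borel) \<and> disjoint_family B \<and> (\<Union>i<n. B i) = UNIV"

text \<open>
  A finite subcover made disjoint.  This is what replaces second countability: the Borel sets of
  \<open>G \<times> G\<close> need not be generated by rectangles, so neither the usual Fubini theorem nor product
  measurability is at hand, but every continuous function is a uniform limit of step functions.
\<close>

lemma borel_partition_subordinate:
  fixes R :: "'a::topological_space \<Rightarrow> 'a \<Rightarrow> bool"
  assumes "compact (UNIV :: 'a set)"
    and nbhd: "\<And>y. \<exists>V. open V \<and> y \<in> V \<and> (\<forall>z\<in>V. R y z)"
  obtains n B c where "borel_partition n B" "\<And>i z. i < n \<Longrightarrow> z \<in> B i \<Longrightarrow> R (c i) z"
proof -
  obtain V where V: "\<And>y. open (V y)" "\<And>y. y \<in> V y" "\<And>y z. z \<in> V y \<Longrightarrow> R y z"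
    using nbhd by metis
  have "\<exists>Y. Y \<subseteq> UNIV \<and> finite Y \<and> UNIV \<subseteq> (\<Union>y\<in>Y. V y)"
    by (rule compactE_image[OF assms(1), of UNIV V]) (use V in auto)
  then obtain Y where Y: "finite Y" "UNIV \<subseteq> (\<Union>y\<in>Y. V y)" by blast
  obtain n :: nat and c where c: "Y = c ` {i. i < n}"
    using finite_imp_nat_seg_image_inj_on[OF Y(1)] by blast
  define A where "A i = (if i < n then V (c i) else {})" for i
  have "disjointed A i \<in> sets borel" for i
    using V(1) by (intro sets.range_disjointed_sets'[THEN subsetD, of A borel]) (auto simp: A_def)
  moreover have "(\<Union>i<n. disjointed A i) = (\<Union>i<n. A i)"
    using finite_UN_disjointed_eq[of A n] by (simp add: lessThan_atLeast0)
  moreover have "(\<Union>i<n. A i) = UNIV"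
    using Y(2) by (auto simp: A_def c)
  ultimately have "borel_partition n (disjointed A)"
    by (simp add: borel_partition_def disjoint_family_disjointed)
  moreover have "R (c i) z" if "i < n" "z \<in> disjointed A i" for i z
    using that disjointed_subset[of A i] V(3) by (auto simp: A_def)
  ultimately show thesis by (rule that)
qed

lemma step_approximation:
  fixes f :: "'a::topological_space \<Rightarrow> 'b::real_normed_vector"
  assumes "compact (UNIV :: 'a set)" "continuous_on UNIV f" "\<epsilon> > 0"
  obtains n B k where "borel_partition n B" "\<And>i x. i < n \<Longrightarrow> x \<in> B i \<Longrightarrow> norm (f x - k i) \<le> \<epsilon>"
proof -
  have nb: "\<exists>V. open V \<and> y \<in> V \<and> (\<forall>z\<in>V. norm (f z - f y) \<le> \<epsilon>)" for y
  proof (intro exI conjI)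
    show "open (f -` ball (f y) \<epsilon>)"
      using assms(2) by (intro open_vimage) auto
  qed (use assms(3) in \<open>auto simp: dist_norm norm_minus_commute\<close>)
  obtain n B c where "borel_partition n B" "\<And>i z. i < n \<Longrightarrow> z \<in> B i \<Longrightarrow> norm (f z - f (c i)) \<le> \<epsilon>"
    using borel_partition_subordinate[of "\<lambda>y z. norm (f z - f y) \<le> \<epsilon>", OF assms(1) nb] by blast
  then show thesis by (rule that[of n B "\<lambda>i. f (c i)"])
qed

lemma borel_partition_sum_indicator:
  assumes "borel_partition n B"
  shows "(\<Sum>i<n. indicator (B i) x *\<^sub>R (v :: 'b::real_normed_vector)) = v"
proof -
  have "(\<Sum>i<n. indicator (B i) x) = (indicator (\<Union>i<n. B i) x :: real)"
    using assms
    by (subst indicator_UN_disjoint) (auto simp: borel_partition_def disjoint_family_on_def)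
  then have "(\<Sum>i<n. indicator (B i) x) = (1 :: real)"
    using assms by (simp add: borel_partition_def)
  then show ?thesis by (simp flip: scaleR_left.sum)
qed

lemma integral_step_approx:
  fixes f :: "'a::topological_space \<Rightarrow> 'b::{banach, second_countable_topology}"
  assumes part: "borel_partition n B" and appr: "\<And>i x. i < n \<Longrightarrow> x \<in> B i \<Longrightarrow> norm (f x - k i) \<le> \<epsilon>"
    and M: "finite_measure M" "sets M = sets borel" and f: "integrable M f"
  shows "norm (integral\<^sup>L M f - (\<Sum>i<n. measure M (B i) *\<^sub>R k i)) \<le> \<epsilon> * measure M UNIV"
proof -
  interpret finite_measure M by (rule M)
  have B: "B i \<in> sets M" for i
    using part M(2) by (auto simp: borel_partition_def)
  have ind: "integrable M (indicator (B i) :: 'a \<Rightarrow> real)" for i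
    using B by (intro integrable_real_indicator) (simp_all add: less_top[symmetric])
  have int_f: "integrable M (\<lambda>x. indicator (B i) x *\<^sub>R f x)" for i
    using integrable_mult_indicator[OF B f] .
  have int_k: "integrable M (\<lambda>x. indicator (B i) x *\<^sub>R k i)" for i
    using ind by (intro integrable_scaleR_left)
  have sp: "space M = UNIV" by (rule space_eq_UNIV_if_sets_borel[OF M(2)])
  have summand: "(LINT x|M. indicator (B i) x *\<^sub>R f x - indicator (B i) x *\<^sub>R k i)
      = (LINT x|M. indicator (B i) x *\<^sub>R f x) - measure M (B i) *\<^sub>R k i" for i
    unfolding Bochner_Integration.integral_diff[OF int_f int_k] using ind by (simp add: sp)
  have "integral\<^sup>L M f = (LINT x|M. (\<Sum>i<n. indicator (B i) x *\<^sub>R f x))"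
    by (intro Bochner_Integration.integral_cong refl) (rule borel_partition_sum_indicator[OF part, symmetric])
  also have "\<dots> = (\<Sum>i<n. LINT x|M. indicator (B i) x *\<^sub>R f x)"
    by (intro Bochner_Integration.integral_sum int_f)
  finally have "integral\<^sup>L M f - (\<Sum>i<n. measure M (B i) *\<^sub>R k i)
      = (\<Sum>i<n. LINT x|M. indicator (B i) x *\<^sub>R f x - indicator (B i) x *\<^sub>R k i)"
    unfolding summand sum_subtractf by simp
  also have "norm \<dots> \<le> (\<Sum>i<n. LINT x|M. indicator (B i) x * \<epsilon>)"
  proof (rule sum_norm_le)
    fix i assume i: "i \<in> {..<n}"
    have "norm (indicator (B i) x *\<^sub>R f x - indicator (B i) x *\<^sub>R k i) \<le> indicator (B i) x * \<epsilon>" for x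
      using appr[of i x] i by (auto simp: indicator_def)
    then show "norm (LINT x|M. indicator (B i) x *\<^sub>R f x - indicator (B i) x *\<^sub>R k i)
        \<le> (LINT x|M. indicator (B i) x * \<epsilon>)"
      using Bochner_Integration.integrable_diff[OF int_f int_k] ind[of i]
      by (intro order_trans[OF integral_norm_bound] integral_mono) auto
  qed
  also have "\<dots> = (\<Sum>i<n. measure M (B i)) * \<epsilon>"
    by (simp add: sp sum_distrib_right)
  also have "(\<Sum>i<n. measure M (B i)) = measure M UNIV"
  proof -
    have "measure M (\<Union>i<n. B i) = (\<Sum>i<n. measure M (B i))"
      using part B by (intro finite_measure_finite_Union) (auto simp: borel_partition_def disjoint_family_on_def)
    then show ?thesis using part by (simp add: borel_partition_def)
  qed
  finally show ?thesis by (simp add: mult.commute)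
qed

lemma continuous_bounded_on_compact:
  fixes f :: "'a::topological_space \<Rightarrow> 'b::real_normed_vector"
  assumes "compact (UNIV :: 'a set)" "continuous_on UNIV f"
  obtains K where "K > 0" "\<And>x. norm (f x) \<le> K"
  using compact_imp_bounded[OF compact_continuous_image[OF assms(2,1)]]
  unfolding bounded_pos by auto

lemma integrable_bounded_borel:
  fixes f :: "'a::topological_space \<Rightarrow> 'b::{banach, second_countable_topology}"
  assumes "finite_measure M" "sets M = sets borel" "f \<in> borel_measurable borel" "\<And>x. norm (f x) \<le> K"
  shows "integrable M f"
proof -
  interpret finite_measure M by fact
  have "f \<in> borel_measurable M" using assms(2,3) measurable_cong_sets by blast
  then show ?thesis using assms(4) by (intro integrable_const_bound[of _ K]) auto
qed

lemma integrable_continuous_compact: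
  fixes f :: "'a::topological_space \<Rightarrow> 'b::{banach, second_countable_topology}"
  assumes "compact (UNIV :: 'a set)" "finite_measure M" "sets M = sets borel" "continuous_on UNIV f"
  shows "integrable M f"
proof -
  obtain K where "\<And>x. norm (f x) \<le> K"
    using continuous_bounded_on_compact[OF assms(1,4)] by metis
  then show ?thesis
    using assms by (intro integrable_bounded_borel borel_measurable_continuous_onI) auto
qed

text \<open>
  By compactness \<open>y \<mapsto> F(\<cdot>, y)\<close> is continuous for the supremum norm (the tube lemma), so one
  partition serves all \<open>x\<close> at once.
\<close>

lemma uniform_partition_of_second_argument:
  fixes F :: "'a::topological_space \<times> 'a \<Rightarrow> 'b::real_normed_vector"
  assumes cpt: "compact (UNIV :: 'a set)" and F: "continuous_on UNIV F" and "\<epsilon> > 0"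
  obtains n B c where "borel_partition n B"
    "\<And>i x y. i < n \<Longrightarrow> y \<in> B i \<Longrightarrow> norm (F (x, y) - F (x, c i)) \<le> \<epsilon>"
proof -
  have nb: "\<exists>V. open V \<and> y \<in> V \<and> (\<forall>z\<in>V. \<forall>x. norm (F (x, z) - F (x, y)) \<le> \<epsilon>)" for y
  proof -
    have "continuous_on (UNIV \<times> UNIV) (\<lambda>p. F (snd p, fst p))"
      by (intro continuous_on_compose2[OF F] continuous_intros) simp
    from continuous_on_prod_compactE[OF this cpt UNIV_I \<open>\<epsilon> > 0\<close>, of y]
    obtain V where "y \<in> V" "open V" "\<forall>x\<in>V \<inter> UNIV. \<forall>t\<in>UNIV. dist (F (snd (x, t), fst (x, t))) (F (snd (y, t), fst (y, t))) \<le> \<epsilon>"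
      by blast
    then show ?thesis by (intro exI[of _ V]) (simp add: dist_norm)
  qed
  obtain n B c where "borel_partition n B"
    "\<And>i z. i < n \<Longrightarrow> z \<in> B i \<Longrightarrow> \<forall>x. norm (F (x, z) - F (x, c i)) \<le> \<epsilon>"
    using borel_partition_subordinate[of "\<lambda>y z. \<forall>x. norm (F (x, z) - F (x, y)) \<le> \<epsilon>", OF cpt nb] by blast
  then show thesis using that by blast
qed

lemma continuous_section:
  assumes "continuous_on UNIV F"
  shows "continuous_on UNIV (\<lambda>y. F (x, y))" "continuous_on UNIV (\<lambda>y. F (y, x))"
  by (intro continuous_on_compose2[OF assms] continuous_intros; simp)+

lemma integral_section_step_approx:
  fixes F :: "'a::topological_space \<times> 'a \<Rightarrow> 'b::{banach, second_countable_topology}"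
  assumes cpt: "compact (UNIV :: 'a set)" and F: "continuous_on UNIV F"
    and N: "finite_measure N" "sets N = sets borel" and "\<epsilon> > 0"
  shows "\<exists>n B c. borel_partition n B \<and>
      (\<forall>i<n. \<forall>y\<in>B i. \<forall>x. norm (F (x, y) - F (x, c i)) \<le> \<epsilon>) \<and>
      (\<forall>x. norm ((LINT y|N. F (x, y)) - (\<Sum>i<n. measure N (B i) *\<^sub>R F (x, c i))) \<le> \<epsilon> * measure N UNIV)"
proof -
  obtain n B c where *: "borel_partition n B"
    "\<And>i x y. i < n \<Longrightarrow> y \<in> B i \<Longrightarrow> norm (F (x, y) - F (x, c i)) \<le> \<epsilon>"
    using uniform_partition_of_second_argument[OF cpt F \<open>\<epsilon> > 0\<close>] by blast
  have "norm ((LINT y|N. F (x, y)) - (\<Sum>i<n. measure N (B i) *\<^sub>R F (x, c i))) \<le> \<epsilon> * measure N UNIV" for x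
    by (rule integral_step_approx[OF *(1) _ N integrable_continuous_compact[OF cpt N continuous_section(1)[OF F]]])
       (rule *(2))
  with * show ?thesis by (intro exI[of _ n] exI[of _ B] exI[of _ c]) simp
qed

lemma continuous_integral_parameter:
  fixes F :: "'a::topological_space \<times> 'a \<Rightarrow> 'b::{banach, second_countable_topology}"
  assumes cpt: "compact (UNIV :: 'a set)" and F: "continuous_on UNIV F"
    and N: "finite_measure N" "sets N = sets borel"
  shows "continuous_on UNIV (\<lambda>x. LINT y|N. F (x, y))"
proof (rule continuous_on_uniform_approximation)
  fix \<epsilon> :: real assume \<epsilon>: "\<epsilon> > 0"
  let ?n = "measure N UNIV"
  define \<delta> where "\<delta> = \<epsilon> / (?n + 1)"
  have n: "?n + 1 > 0" by (simp add: add_nonneg_pos)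
  then have \<delta>: "\<delta> > 0" "\<delta> * ?n \<le> \<epsilon>" using \<epsilon> by (simp_all add: \<delta>_def field_simps)
  from integral_section_step_approx[OF cpt F N \<delta>(1)]
  obtain n B c where "borel_partition n B \<and>
      (\<forall>i<n. \<forall>y\<in>B i. \<forall>x. norm (F (x, y) - F (x, c i)) \<le> \<delta>) \<and>
      (\<forall>x. norm ((LINT y|N. F (x, y)) - (\<Sum>i<n. measure N (B i) *\<^sub>R F (x, c i))) \<le> \<delta> * ?n)"
    by (elim exE) (rule that, assumption)
  then have close: "\<forall>x. norm ((LINT y|N. F (x, y)) - (\<Sum>i<n. measure N (B i) *\<^sub>R F (x, c i))) \<le> \<delta> * ?n"
    by (elim conjE)
  have "continuous_on UNIV (\<lambda>x. \<Sum>i<n. measure N (B i) *\<^sub>R F (x, c i))"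
    by (intro continuous_intros continuous_section(2)[OF F])
  moreover have "dist (LINT y|N. F (x, y)) (\<Sum>i<n. measure N (B i) *\<^sub>R F (x, c i)) \<le> \<epsilon>" for x
    using close[rule_format, of x] \<delta>(2) unfolding dist_norm by linarith
  ultimately show "\<exists>h. continuous_on UNIV h \<and> (\<forall>x\<in>UNIV. dist (LINT y|N. F (x, y)) (h x) \<le> \<epsilon>)"
    by blast
qed

text \<open>
  Up to a multiple of \<open>\<epsilon>\<close>, both iterated integrals equal \<open>\<Sum>i<n. N(B i) \<integral> F(x, c i) dM(x)\<close>, where the
  partition is the one of the previous lemmas.
\<close>

lemma fubini_continuous:
  fixes F :: "'a::topological_space \<times> 'a \<Rightarrow> 'b::{banach, second_countable_topology}"
  assumes cpt: "compact (UNIV :: 'a set)" and F: "continuous_on UNIV F"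
    and M: "finite_measure M" "sets M = sets borel" and N: "finite_measure N" "sets N = sets borel"
  shows "(LINT x|M. LINT y|N. F (x, y)) = (LINT y|N. LINT x|M. F (x, y))"
proof -
  interpret M: finite_measure M by fact
  interpret N: finite_measure N by fact
  have sp: "space M = UNIV" "space N = UNIV" by (simp_all add: space_eq_UNIV_if_sets_borel M(2) N(2))
  let ?I = "\<lambda>x. LINT y|N. F (x, y)" and ?J = "\<lambda>y. LINT x|M. F (x, y)"
  let ?m = "measure M UNIV" and ?n = "measure N UNIV"
  have contI: "continuous_on UNIV ?I" by (rule continuous_integral_parameter[OF cpt F N])
  have "continuous_on UNIV (\<lambda>p. F (snd p, fst p))"
    by (intro continuous_on_compose2[OF F] continuous_intros) simp
  from continuous_integral_parameter[OF cpt this M] have contJ: "continuous_on UNIV ?J" by simp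
  have intM: "integrable M (\<lambda>x. F (x, y))" for y
    by (rule integrable_continuous_compact[OF cpt M continuous_section(2)[OF F]])
  have intI: "integrable M ?I" and intJ: "integrable N ?J"
    by (rule integrable_continuous_compact[OF cpt M contI] integrable_continuous_compact[OF cpt N contJ])+
  have "norm (integral\<^sup>L M ?I - integral\<^sup>L N ?J) \<le> (2 * ?m * ?n) * \<epsilon>" if "\<epsilon> > 0" for \<epsilon>
  proof -
    obtain n B c where nBc: "borel_partition n B \<and>
        (\<forall>i<n. \<forall>y\<in>B i. \<forall>x. norm (F (x, y) - F (x, c i)) \<le> \<epsilon>) \<and>
        (\<forall>x. norm (?I x - (\<Sum>i<n. measure N (B i) *\<^sub>R F (x, c i))) \<le> \<epsilon> * ?n)"
      using integral_section_step_approx[OF cpt F N \<open>\<epsilon> > 0\<close>] by (elim exE) (rule that, assumption)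
    then have part: "borel_partition n B"
      and B: "\<And>i x y. i < n \<Longrightarrow> y \<in> B i \<Longrightarrow> norm (F (x, y) - F (x, c i)) \<le> \<epsilon>"
      and I: "\<And>x. norm (?I x - (\<Sum>i<n. measure N (B i) *\<^sub>R F (x, c i))) \<le> \<epsilon> * ?n"
      by simp_all
    have const: "integrable M (\<lambda>_. r)" "integral\<^sup>L M (\<lambda>_. r) = r * ?m" for r :: real
      by (simp_all add: sp mult.commute)
    have bound: "norm (integral\<^sup>L M h) \<le> r * ?m" if "integrable M h" "\<And>x. norm (h x) \<le> r" for h :: "'a \<Rightarrow> 'b" and r
    proof -
      have "norm (integral\<^sup>L M h) \<le> (LINT x|M. norm (h x))" by (rule integral_norm_bound)
      also have "\<dots> \<le> (LINT x|M. r)"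
        using that by (intro integral_mono const) auto
      finally show ?thesis by (simp add: sp mult.commute)
    qed
    have "norm (LINT x|M. ?I x - (\<Sum>i<n. measure N (B i) *\<^sub>R F (x, c i))) \<le> \<epsilon> * ?n * ?m"
    proof (rule bound)
      show "integrable M (\<lambda>x. ?I x - (\<Sum>i<n. measure N (B i) *\<^sub>R F (x, c i)))"
        by (intro Bochner_Integration.integrable_diff intI Bochner_Integration.integrable_sum
            integrable_scaleR_right intM)
    qed (rule I)
    also have "(LINT x|M. ?I x - (\<Sum>i<n. measure N (B i) *\<^sub>R F (x, c i)))
        = integral\<^sup>L M ?I - (\<Sum>i<n. measure N (B i) *\<^sub>R ?J (c i))"
      using intI intM by simp
    finally have 1: "norm (integral\<^sup>L M ?I - (\<Sum>i<n. measure N (B i) *\<^sub>R ?J (c i))) \<le> \<epsilon> * ?n * ?m" .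
    have "norm (?J y - ?J (c i)) \<le> \<epsilon> * ?m" if "i < n" "y \<in> B i" for i y
    proof -
      have "norm (LINT x|M. F (x, y) - F (x, c i)) \<le> \<epsilon> * ?m"
        by (rule bound) (use that in \<open>auto intro!: Bochner_Integration.integrable_diff intM B\<close>)
      then show ?thesis using intM by simp
    qed
    then have 2: "norm (integral\<^sup>L N ?J - (\<Sum>i<n. measure N (B i) *\<^sub>R ?J (c i))) \<le> \<epsilon> * ?m * ?n"
      by (intro integral_step_approx[OF part _ N intJ])
    from norm_triangle_ineq4[of "integral\<^sup>L M ?I - (\<Sum>i<n. measure N (B i) *\<^sub>R ?J (c i))"
        "integral\<^sup>L N ?J - (\<Sum>i<n. measure N (B i) *\<^sub>R ?J (c i))"] 1 2
    show ?thesis by (simp add: algebra_simps)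
  qed
  then have "norm (integral\<^sup>L M ?I - integral\<^sup>L N ?J) \<le> 0"
    by (rule nonpos_if_le_every_positive_multiple)
  then show ?thesis by simp
qed

section \<open>Signed Borel measures\<close>

lemma signed_borel_measure_sums:
  assumes "signed_borel_measure \<mu>" "range A \<subseteq> sets borel" "disjoint_family A"
  shows "(\<lambda>n. \<mu> (A n)) sums \<mu> (\<Union>n. A n)"
  using assms unfolding signed_borel_measure_def by blast

lemma signed_borel_measure_empty:
  assumes "signed_borel_measure \<mu>" shows "\<mu> {} = 0"
proof -
  have "(\<lambda>n::nat. \<mu> {}) sums \<mu> (\<Union>n::nat. {})"
    by (rule signed_borel_measure_sums[OF assms]) (auto simp: disjoint_family_on_def)
  then have "(\<lambda>_::nat. \<mu> {}) \<longlonglongrightarrow> 0"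
    by (intro summable_LIMSEQ_zero sums_summable)
  then show ?thesis by (simp add: LIMSEQ_const_iff)
qed

lemma signed_borel_measure_Un:
  assumes "signed_borel_measure \<mu>" "A \<in> sets borel" "B \<in> sets borel" "A \<inter> B = {}"
  shows "\<mu> (A \<union> B) = \<mu> A + \<mu> B"
proof -
  have "(\<lambda>n. \<mu> (binaryset A B n)) sums \<mu> (\<Union>n. binaryset A B n)"
    using assms(2-4)
    by (intro signed_borel_measure_sums[OF assms(1)]) (auto simp: disjoint_family_on_def binaryset_def)
  moreover have "(\<lambda>n. \<mu> (binaryset A B n)) sums (\<mu> A + \<mu> B)"
    by (rule binaryset_sums) (rule signed_borel_measure_empty[OF assms(1)])
  ultimately show ?thesis by (metis sums_unique2 UN_binaryset_eq)
qed

text \<open>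
  If \<open>\<mu>\<close> were unbounded on the subsets of \<open>E\<close>, some \<open>B \<subseteq> E\<close> would have \<open>\<bar>\<mu> B\<bar> > \<bar>\<mu> E\<bar> + 1\<close>, so that
  \<open>B\<close> and \<open>E - B\<close> both have mass greater than \<open>1\<close> in absolute value, and \<open>\<mu>\<close> would still be unbounded
  on the subsets of one of them.  Iterating splits off infinitely many disjoint sets of mass greater
  than \<open>1\<close>, against the convergence of the series over them.
\<close>

lemma signed_borel_measure_bounded:
  assumes \<mu>: "signed_borel_measure \<mu>"
  obtains K where "\<And>A. \<bar>\<mu> A\<bar> \<le> K"
proof -
  define unb where "unb E \<longleftrightarrow> E \<in> sets borel \<and> (\<forall>K. \<exists>B\<in>sets borel. B \<subseteq> E \<and> \<bar>\<mu> B\<bar> > K)" for E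
  have split: "\<exists>E'. unb E' \<and> E' \<subseteq> E \<and> \<bar>\<mu> (E - E')\<bar> > 1" if E: "unb E" for E
  proof -
    have E_borel: "E \<in> sets borel" using E by (simp add: unb_def)
    obtain B where B: "B \<in> sets borel" "B \<subseteq> E" "\<bar>\<mu> B\<bar> > \<bar>\<mu> E\<bar> + 1"
      using E unfolding unb_def by blast
    have "\<mu> E = \<mu> B + \<mu> (E - B)"
      using signed_borel_measure_Un[OF \<mu> B(1), of "E - B"] B(1,2) E_borel
      by (simp add: Un_absorb1)
    with B(3) have big: "\<bar>\<mu> B\<bar> > 1" "\<bar>\<mu> (E - B)\<bar> > 1" by auto
    have "unb B \<or> unb (E - B)"
    proof (rule ccontr)
      assume "\<not> (unb B \<or> unb (E - B))"
      then obtain K L where K: "\<And>D. D \<in> sets borel \<Longrightarrow> D \<subseteq> B \<Longrightarrow> \<bar>\<mu> D\<bar> \<le> K"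
        and L: "\<And>D. D \<in> sets borel \<Longrightarrow> D \<subseteq> E - B \<Longrightarrow> \<bar>\<mu> D\<bar> \<le> L"
        using B(1) E_borel unfolding unb_def by (metis sets.Diff not_less)
      obtain D where D: "D \<in> sets borel" "D \<subseteq> E" "\<bar>\<mu> D\<bar> > K + L"
        using E unfolding unb_def by blast
      have "\<mu> D = \<mu> (D \<inter> B) + \<mu> (D - B)"
        using signed_borel_measure_Un[OF \<mu>, of "D \<inter> B" "D - B"] D(1) B(1)
        by (auto simp: Int_Diff_Un)
      with K[of "D \<inter> B"] L[of "D - B"] D B(1) show False by force
    qed
    then show ?thesis
    proof
      assume "unb B" with B(2) big(2) show ?thesis by blast
    next
      assume "unb (E - B)"
      moreover have "E - (E - B) = B" using B(2) by blast
      ultimately show ?thesis using big(1) by (metis Diff_subset)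
    qed
  qed
  \<comment> \<open>Peel off a set of mass greater than \<open>1\<close> again and again.\<close>
  have "\<not> unb UNIV"
  proof
    assume 0: "unb UNIV"
    obtain nxt where nxt: "\<And>E. unb E \<Longrightarrow> unb (nxt E) \<and> nxt E \<subseteq> E \<and> \<bar>\<mu> (E - nxt E)\<bar> > 1"
      using split by metis
    define E where "E n = (nxt ^^ n) UNIV" for n
    have E: "unb (E n)" for n by (induction n) (use 0 nxt in \<open>auto simp: E_def\<close>)
    have E_Suc: "E (Suc n) \<subseteq> E n" "\<bar>\<mu> (E n - E (Suc n))\<bar> > 1" for n
      using nxt[OF E[of n]] by (auto simp: E_def)
    define A where "A n = E n - E (Suc n)" for n
    have dec: "E n \<subseteq> E m" if "m \<le> n" for m n
      using lift_Suc_antimono_le[of E] E_Suc(1) that by blast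
    have "A m \<inter> A n = {}" if "m < n" for m n
      using dec[of "Suc m" n] that by (auto simp: A_def)
    then have "disjoint_family A"
      unfolding disjoint_family_on_def by (metis Int_commute nat_neq_iff)
    moreover have "range A \<subseteq> sets borel"
      using E by (auto simp: A_def unb_def)
    ultimately have "(\<lambda>n. \<mu> (A n)) \<longlonglongrightarrow> 0"
      by (intro summable_LIMSEQ_zero sums_summable[OF signed_borel_measure_sums[OF \<mu>]])
    then have "\<forall>\<^sub>F n in sequentially. \<bar>\<mu> (A n)\<bar> < 1"
      using order_tendstoD(2)[OF tendsto_rabs[of "\<lambda>n. \<mu> (A n)" 0], of sequentially 1] by simp
    then obtain n where "\<bar>\<mu> (A n)\<bar> < 1" by (auto simp: eventually_sequentially)
    then show False using E_Suc(2)[of n] by (simp add: A_def)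
  qed
  then obtain K where K: "\<And>B. B \<in> sets borel \<Longrightarrow> \<bar>\<mu> B\<bar> \<le> K"
    unfolding unb_def by (metis not_less sets.top space_borel subset_UNIV)
  have "\<bar>\<mu> A\<bar> \<le> K" for A
  proof (cases "A \<in> sets borel")
    case False
    then have "\<mu> A = 0" using \<mu> unfolding signed_borel_measure_def by blast
    with K[of "{}"] show ?thesis by force
  qed (rule K)
  then show thesis by (rule that)
qed

lemma sets_upper_variation [simp, measurable_cong]: "sets (upper_variation \<mu>) = sets borel"
  unfolding upper_variation_def by (subst sets_measure_of) (auto simp: sets.sigma_sets_eq[of borel, simplified])

lemma space_upper_variation [simp]: "space (upper_variation \<mu>) = UNIV"
  unfolding upper_variation_def by (simp add: space_measure_of_conv)

text \<open>
  \<open>measure_of\<close> yields the zero measure unless the set function is countably additive, so this has to be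
  proved before anything can be said about the variations.  Subadditivity comes from cutting a set
  \<open>B \<subseteq> \<Union>i. A i\<close> along the \<open>A i\<close>, superadditivity from uniting sets of non-negative measure.
\<close>

lemma emeasure_upper_variation:
  assumes \<mu>: "signed_borel_measure \<mu>" and A: "A \<in> sets borel"
  shows "emeasure (upper_variation \<mu>) A = (SUP B\<in>{B \<in> sets borel. B \<subseteq> A}. ennreal (\<mu> B))"
proof -
  let ?V = "\<lambda>A. SUP B\<in>{B \<in> sets borel. B \<subseteq> A}. ennreal (\<mu> B)"
  have mono: "?V A \<le> ?V B" if "A \<subseteq> B" for A B
    using that by (intro SUP_subset_mono) auto
  have empty: "?V {} = 0"
  proof -
    have "{B \<in> sets borel. B \<subseteq> {}} = {{}}" by auto
    then show ?thesis by (simp add: signed_borel_measure_empty[OF \<mu>])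
  qed
  have super: "?V A + ?V B \<le> ?V (A \<union> B)" if "A \<inter> B = {}" for A B
  proof -
    have ne: "{D \<in> sets borel. D \<subseteq> E} \<noteq> {}" for E :: "'a set" by auto
    have "?V A + ?V B = (SUP C\<in>{B \<in> sets borel. B \<subseteq> A}. ennreal (\<mu> C) + ?V B)"
      by (rule ennreal_SUP_add_left[OF ne, symmetric])
    also have "\<dots> = (SUP C\<in>{B \<in> sets borel. B \<subseteq> A}. SUP D\<in>{D \<in> sets borel. D \<subseteq> B}. ennreal (\<mu> C) + ennreal (\<mu> D))"
      by (simp only: ennreal_SUP_add_right[OF ne])
    also have "\<dots> \<le> ?V (A \<union> B)"
    proof (intro SUP_least)
      fix C D assume CD: "C \<in> {B \<in> sets borel. B \<subseteq> A}" "D \<in> {D \<in> sets borel. D \<subseteq> B}"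
      \<comment> \<open>\<open>ennreal\<close> truncates at \<open>0\<close>, so a set of negative measure may be replaced by \<open>{}\<close>.\<close>
      define C' where "C' = (if \<mu> C \<ge> 0 then C else {})"
      define D' where "D' = (if \<mu> D \<ge> 0 then D else {})"
      have "ennreal (\<mu> C) + ennreal (\<mu> D) = ennreal (\<mu> C') + ennreal (\<mu> D')"
        by (auto simp: C'_def D'_def signed_borel_measure_empty[OF \<mu>] ennreal_neg)
      also have "\<dots> = ennreal (\<mu> C' + \<mu> D')"
        by (rule ennreal_plus[symmetric]) (auto simp: C'_def D'_def signed_borel_measure_empty[OF \<mu>])
      also have "\<mu> C' + \<mu> D' = \<mu> (C' \<union> D')"
        using CD that by (intro signed_borel_measure_Un[OF \<mu>, symmetric]) (auto simp: C'_def D'_def)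
      also have "ennreal \<dots> \<le> ?V (A \<union> B)"
        using CD by (intro SUP_upper) (auto simp: C'_def D'_def)
      finally show "ennreal (\<mu> C) + ennreal (\<mu> D) \<le> ?V (A \<union> B)" .
    qed
    finally show ?thesis .
  qed
  have "countably_additive (sets borel) ?V"
  proof (rule countably_additiveI)
    fix A :: "nat \<Rightarrow> 'a set"
    assume A: "range A \<subseteq> sets borel" "disjoint_family A" "(\<Union>i. A i) \<in> sets borel"
    show "(\<Sum>i. ?V (A i)) = ?V (\<Union>i. A i)"
    proof (rule antisym)
      have "(\<Sum>i<n. ?V (A i)) \<le> ?V (\<Union>i<n. A i)" for n
      proof (induction n)
        case 0 then show ?case by (simp only: lessThan_0 sum.empty UN_empty empty order_refl)
      next
        case (Suc n)
        have "(\<Union>i<n. A i) \<inter> A n = {}"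
          using A(2) unfolding disjoint_family_on_def by (fastforce dest: less_imp_neq)
        then have "?V (\<Union>i<n. A i) + ?V (A n) \<le> ?V ((\<Union>i<n. A i) \<union> A n)" by (rule super)
        with add_right_mono[OF Suc, of "?V (A n)"]
        have "(\<Sum>i<Suc n. ?V (A i)) \<le> ?V ((\<Union>i<n. A i) \<union> A n)"
          by (simp only: sum.lessThan_Suc)
        moreover have "(\<Union>i<Suc n. A i) = (\<Union>i<n. A i) \<union> A n" by (auto simp: less_Suc_eq)
        ultimately show ?case by simp
      qed
      also have "?V (\<Union>i<n. A i) \<le> ?V (\<Union>i. A i)" for n by (rule mono) auto
      finally show "(\<Sum>i. ?V (A i)) \<le> ?V (\<Union>i. A i)"
        by (intro suminf_le_const summableI)
    next
      show "?V (\<Union>i. A i) \<le> (\<Sum>i. ?V (A i))"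
      proof (rule SUP_least)
        fix B assume B: "B \<in> {B \<in> sets borel. B \<subseteq> (\<Union>i. A i)}"
        have "(\<lambda>i. \<mu> (B \<inter> A i)) sums \<mu> (\<Union>i. B \<inter> A i)"
        proof -
          have "range (\<lambda>i. B \<inter> A i) \<subseteq> sets borel" "disjoint_family (\<lambda>i. B \<inter> A i)"
            using A B by (auto simp: disjoint_family_on_def)
          then show ?thesis by (rule signed_borel_measure_sums[OF \<mu>])
        qed
        moreover have "(\<Union>i. B \<inter> A i) = B" using B by auto
        ultimately have "(\<lambda>n. \<Sum>i<n. \<mu> (B \<inter> A i)) \<longlonglongrightarrow> \<mu> B" by (simp add: sums_def)
        then have lim: "(\<lambda>n. ennreal (\<Sum>i<n. \<mu> (B \<inter> A i))) \<longlonglongrightarrow> ennreal (\<mu> B)" by (rule tendsto_ennrealI)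
        have "ennreal (\<Sum>i<n. \<mu> (B \<inter> A i)) \<le> (\<Sum>i. ?V (A i))" for n
        proof -
          have "ennreal (\<Sum>i<n. \<mu> (B \<inter> A i)) \<le> ennreal (\<Sum>i<n. max 0 (\<mu> (B \<inter> A i)))"
            by (intro ennreal_leI sum_mono) auto
          also have "\<dots> = (\<Sum>i<n. ennreal (max 0 (\<mu> (B \<inter> A i))))" by (simp add: sum_ennreal)
          also have "\<dots> = (\<Sum>i<n. ennreal (\<mu> (B \<inter> A i)))"
            by (intro sum.cong refl) (auto simp: max_def ennreal_neg)
          also have "\<dots> \<le> (\<Sum>i<n. ?V (A i))"
            using A(1) B by (intro sum_mono SUP_upper) auto
          also have "\<dots> \<le> (\<Sum>i. ?V (A i))"
            by (intro sum_le_suminf summableI) auto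
          finally show ?thesis .
        qed
        then show "ennreal (\<mu> B) \<le> (\<Sum>i. ?V (A i))"
          by (intro LIMSEQ_le_const2[OF lim]) auto
      qed
    qed
  qed
  moreover have "positive (sets borel) ?V" unfolding positive_def using empty by simp
  ultimately show ?thesis
    unfolding upper_variation_def
    using sets.sigma_algebra_axioms[of borel] A by (intro emeasure_measure_of_sigma) auto
qed

lemma signed_borel_measure_uminus: "signed_borel_measure \<mu> \<Longrightarrow> signed_borel_measure (\<lambda>A. - \<mu> A)"
  unfolding signed_borel_measure_def by (simp add: sums_minus)

lemma signed_borel_measure_linear:
  assumes "signed_borel_measure \<mu>" "signed_borel_measure \<nu>"
  shows "signed_borel_measure (\<lambda>A. a * \<mu> A + b * \<nu> A)"
  using assms unfolding signed_borel_measure_def by (auto intro!: sums_add sums_mult)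

lemma finite_measure_upper_variation:
  assumes \<mu>: "signed_borel_measure \<mu>"
  shows "finite_measure (upper_variation \<mu>)"
proof
  obtain K where K: "\<And>A. \<bar>\<mu> A\<bar> \<le> K" using signed_borel_measure_bounded[OF \<mu>] by blast
  have "emeasure (upper_variation \<mu>) UNIV \<le> ennreal K"
    using K by (subst emeasure_upper_variation[OF \<mu>]) (auto intro!: SUP_least ennreal_leI intro: abs_le_D1)
  then show "emeasure (upper_variation \<mu>) (space (upper_variation \<mu>)) \<noteq> \<infinity>"
    by (auto simp: top_unique)
qed

lemma sets_lower_variation [simp, measurable_cong]: "sets (lower_variation \<mu>) = sets borel"
  and space_lower_variation [simp]: "space (lower_variation \<mu>) = UNIV"
  by (simp_all add: lower_variation_def)

lemma finite_measure_lower_variation: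
  "signed_borel_measure \<mu> \<Longrightarrow> finite_measure (lower_variation \<mu>)"
  unfolding lower_variation_def by (intro finite_measure_upper_variation signed_borel_measure_uminus)

lemma upper_variation_le:
  assumes \<mu>: "signed_borel_measure \<mu>" and A: "A \<in> sets borel"
    and le: "\<And>B. B \<in> sets borel \<Longrightarrow> B \<subseteq> A \<Longrightarrow> \<mu> B \<le> c"
  shows "measure (upper_variation \<mu>) A \<le> c"
proof -
  have "0 \<le> c" using le[of "{}"] signed_borel_measure_empty[OF \<mu>] by simp
  moreover have "emeasure (upper_variation \<mu>) A \<le> ennreal c"
    unfolding emeasure_upper_variation[OF \<mu> A] using le by (intro SUP_least ennreal_leI) auto
  ultimately show ?thesis
    by (simp add: finite_measure.emeasure_eq_measure[OF finite_measure_upper_variation[OF \<mu>]])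
qed

lemma upper_variation_ge:
  assumes \<mu>: "signed_borel_measure \<mu>" and A: "A \<in> sets borel" and B: "B \<in> sets borel" "B \<subseteq> A"
  shows "\<mu> B \<le> measure (upper_variation \<mu>) A"
proof -
  have "ennreal (\<mu> B) \<le> emeasure (upper_variation \<mu>) A"
    unfolding emeasure_upper_variation[OF \<mu> A] using B by (intro SUP_upper) auto
  then show ?thesis
    by (simp add: finite_measure.emeasure_eq_measure[OF finite_measure_upper_variation[OF \<mu>]])
qed

text \<open>
  For \<open>B \<subseteq> A\<close> write \<open>\<mu> B = \<mu> A - \<mu> (A - B)\<close> and take suprema, once for \<open>\<mu>\<close> and once for \<open>-\<mu>\<close>.
\<close>

lemma jordan_decomposition:
  assumes \<mu>: "signed_borel_measure \<mu>" and A: "A \<in> sets borel"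
  shows "\<mu> A = measure (upper_variation \<mu>) A - measure (lower_variation \<mu>) A"
proof -
  have compl: "\<mu> A = \<mu> B + \<mu> (A - B)" if "B \<in> sets borel" "B \<subseteq> A" for B
    using signed_borel_measure_Un[OF \<mu> that(1), of "A - B"] A that by (simp add: Un_absorb1)
  have "measure (upper_variation \<mu>) A \<le> \<mu> A + measure (lower_variation \<mu>) A"
  proof (rule upper_variation_le[OF \<mu> A])
    fix B assume "B \<in> sets borel" "B \<subseteq> A"
    then show "\<mu> B \<le> \<mu> A + measure (lower_variation \<mu>) A"
      using compl[of B] upper_variation_ge[OF signed_borel_measure_uminus[OF \<mu>] A, of "A - B"] A
      by (simp add: lower_variation_def)
  qed
  moreover have "measure (lower_variation \<mu>) A \<le> - \<mu> A + measure (upper_variation \<mu>) A"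
    unfolding lower_variation_def
  proof (rule upper_variation_le[OF signed_borel_measure_uminus[OF \<mu>] A])
    fix B assume "B \<in> sets borel" "B \<subseteq> A"
    then show "- \<mu> B \<le> - \<mu> A + measure (upper_variation \<mu>) A"
      using compl[of B] upper_variation_ge[OF \<mu> A, of "A - B"] A by simp
  qed
  ultimately show ?thesis by simp
qed

lemma sets_total_variation [simp, measurable_cong]: "sets (total_variation \<mu>) = sets borel"
  unfolding total_variation_def by (subst sets_measure_of) (auto simp: sets.sigma_sets_eq[of borel, simplified])

lemma emeasure_total_variation:
  assumes "A \<in> sets borel"
  shows "emeasure (total_variation \<mu>) A = emeasure (upper_variation \<mu>) A + emeasure (lower_variation \<mu>) A"
proof -
  have "countably_additive (sets borel) (\<lambda>A. emeasure (upper_variation \<mu>) A + emeasure (lower_variation \<mu>) A)"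
    by (intro countably_additiveI) (simp add: suminf_add[OF summableI summableI, symmetric] suminf_emeasure)
  then show ?thesis
    unfolding total_variation_def
    using sets.sigma_algebra_axioms[of borel] assms
    by (intro emeasure_measure_of_sigma) (auto simp: positive_def)
qed

lemma signed_integral_step_approx:
  fixes f :: "'a::topological_space \<Rightarrow> 'b::{banach, second_countable_topology}"
  assumes cpt: "compact (UNIV :: 'a set)" and f: "continuous_on UNIV f" and \<mu>: "signed_borel_measure \<mu>"
  shows "\<exists>C\<ge>0. \<forall>\<epsilon> n B k. borel_partition n B \<longrightarrow> (\<forall>i<n. \<forall>x\<in>B i. norm (f x - k i) \<le> \<epsilon>) \<longrightarrow>
     norm (signed_integral \<mu> f - (\<Sum>i<n. \<mu> (B i) *\<^sub>R k i)) \<le> C * \<epsilon>"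
proof -
  let ?U = "upper_variation \<mu>" and ?L = "lower_variation \<mu>"
  have fin: "finite_measure ?U" "finite_measure ?L"
    using \<mu> by (simp_all add: finite_measure_upper_variation finite_measure_lower_variation)
  have "norm (signed_integral \<mu> f - (\<Sum>i<n. \<mu> (B i) *\<^sub>R k i)) \<le> (measure ?U UNIV + measure ?L UNIV) * \<epsilon>"
    if part: "borel_partition n B" and k: "\<forall>i<n. \<forall>x\<in>B i. norm (f x - k i) \<le> \<epsilon>" for \<epsilon> n B k
  proof -
    have B: "B i \<in> sets borel" for i using part by (simp add: borel_partition_def)
    have appr: "norm (integral\<^sup>L M f - (\<Sum>i<n. measure M (B i) *\<^sub>R k i)) \<le> measure M UNIV * \<epsilon>"
      if M: "finite_measure M" "sets M = sets borel" for M
      using integral_step_approx[OF part _ M integrable_continuous_compact[OF cpt M f], of k \<epsilon>] k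
      by (simp add: mult.commute)
    have "signed_integral \<mu> f - (\<Sum>i<n. \<mu> (B i) *\<^sub>R k i)
        = (integral\<^sup>L ?U f - (\<Sum>i<n. measure ?U (B i) *\<^sub>R k i)) - (integral\<^sup>L ?L f - (\<Sum>i<n. measure ?L (B i) *\<^sub>R k i))"
      by (simp add: signed_integral_def jordan_decomposition[OF \<mu> B] scaleR_diff_left sum_subtractf)
    also have "norm \<dots> \<le> measure ?U UNIV * \<epsilon> + measure ?L UNIV * \<epsilon>"
      using fin by (intro order_trans[OF norm_triangle_ineq4] add_mono appr) simp_all
    finally show ?thesis by (simp add: distrib_right)
  qed
  then show ?thesis by (intro exI[of _ "measure ?U UNIV + measure ?L UNIV"]) auto
qed

text \<open>
  The integral of a continuous function is the limit of its step sums.  The variations of a sum of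
  measures are not the sums of the variations, but step sums are linear in the measure; this is
  how linearity in \<open>\<mu>\<close> and all concrete integrals are obtained.
\<close>

lemma signed_integral_eqI:
  fixes f :: "'a::topological_space \<Rightarrow> 'b::{banach, second_countable_topology}"
  assumes cpt: "compact (UNIV :: 'a set)" and f: "continuous_on UNIV f" and \<mu>: "signed_borel_measure \<mu>"
    and J: "\<And>\<epsilon> n B k. \<epsilon> > 0 \<Longrightarrow> borel_partition n B \<Longrightarrow> (\<forall>i<n. \<forall>x\<in>B i. norm (f x - k i) \<le> \<epsilon>) \<Longrightarrow>
       norm (J - (\<Sum>i<n. \<mu> (B i) *\<^sub>R k i)) \<le> D * \<epsilon>"
  shows "signed_integral \<mu> f = J"
proof -
  obtain C where C: "C \<ge> 0" "\<And>\<epsilon> n B k. borel_partition n B \<Longrightarrow> (\<forall>i<n. \<forall>x\<in>B i. norm (f x - k i) \<le> \<epsilon>) \<Longrightarrow>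
     norm (signed_integral \<mu> f - (\<Sum>i<n. \<mu> (B i) *\<^sub>R k i)) \<le> C * \<epsilon>"
    using signed_integral_step_approx[OF cpt f \<mu>] by blast
  have "norm (signed_integral \<mu> f - J) \<le> (C + D) * \<epsilon>" if "\<epsilon> > 0" for \<epsilon>
  proof -
    obtain n B k where nBk: "borel_partition n B" "\<forall>i<n. \<forall>x\<in>B i. norm (f x - k i) \<le> \<epsilon>"
      using step_approximation[OF cpt f \<open>\<epsilon> > 0\<close>] by metis
    let ?s = "\<Sum>i<n. \<mu> (B i) *\<^sub>R k i"
    have "norm (signed_integral \<mu> f - J) \<le> norm (signed_integral \<mu> f - ?s) + norm (J - ?s)"
      using norm_triangle_ineq4[of "signed_integral \<mu> f - ?s" "J - ?s"] by simp
    also have "\<dots> \<le> (C + D) * \<epsilon>"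
      using C(2)[OF nBk] J[OF \<open>\<epsilon> > 0\<close> nBk] by (simp add: distrib_right)
    finally show ?thesis .
  qed
  then have "norm (signed_integral \<mu> f - J) \<le> 0"
    by (rule nonpos_if_le_every_positive_multiple)
  then show ?thesis by simp
qed

lemma signed_integral_linear_measure:
  fixes f :: "'a::topological_space \<Rightarrow> 'b::{banach, second_countable_topology}"
  assumes cpt: "compact (UNIV :: 'a set)" and f: "continuous_on UNIV f"
    and \<mu>: "signed_borel_measure \<mu>" and \<nu>: "signed_borel_measure \<nu>"
  shows "signed_integral (\<lambda>A. a * \<mu> A + b * \<nu> A) f = a *\<^sub>R signed_integral \<mu> f + b *\<^sub>R signed_integral \<nu> f"
proof -
  obtain C where C: "\<And>\<epsilon> n B k. borel_partition n B \<Longrightarrow> (\<forall>i<n. \<forall>x\<in>B i. norm (f x - k i) \<le> \<epsilon>) \<Longrightarrow>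
     norm (signed_integral \<mu> f - (\<Sum>i<n. \<mu> (B i) *\<^sub>R k i)) \<le> C * \<epsilon>"
    using signed_integral_step_approx[OF cpt f \<mu>] by blast
  obtain D where D: "\<And>\<epsilon> n B k. borel_partition n B \<Longrightarrow> (\<forall>i<n. \<forall>x\<in>B i. norm (f x - k i) \<le> \<epsilon>) \<Longrightarrow>
     norm (signed_integral \<nu> f - (\<Sum>i<n. \<nu> (B i) *\<^sub>R k i)) \<le> D * \<epsilon>"
    using signed_integral_step_approx[OF cpt f \<nu>] by blast
  show ?thesis
  proof (rule signed_integral_eqI[OF cpt f signed_borel_measure_linear[OF \<mu> \<nu>]])
    fix \<epsilon> :: real and n B and k :: "nat \<Rightarrow> 'b"
    assume nBk: "borel_partition n B" "\<forall>i<n. \<forall>x\<in>B i. norm (f x - k i) \<le> \<epsilon>"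
    have "a *\<^sub>R signed_integral \<mu> f + b *\<^sub>R signed_integral \<nu> f - (\<Sum>i<n. (a * \<mu> (B i) + b * \<nu> (B i)) *\<^sub>R k i)
       = a *\<^sub>R (signed_integral \<mu> f - (\<Sum>i<n. \<mu> (B i) *\<^sub>R k i)) + b *\<^sub>R (signed_integral \<nu> f - (\<Sum>i<n. \<nu> (B i) *\<^sub>R k i))"
      by (simp add: scaleR_diff_right scaleR_add_left sum.distrib scaleR_sum_right add_diff_add)
    also have "norm \<dots> \<le> \<bar>a\<bar> * (C * \<epsilon>) + \<bar>b\<bar> * (D * \<epsilon>)"
      using C[OF nBk] D[OF nBk] by (intro order_trans[OF norm_triangle_ineq] add_mono) (auto intro!: mult_left_mono)
    finally show "norm (a *\<^sub>R signed_integral \<mu> f + b *\<^sub>R signed_integral \<nu> f - (\<Sum>i<n. (a * \<mu> (B i) + b * \<nu> (B i)) *\<^sub>R k i))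
       \<le> (\<bar>a\<bar> * C + \<bar>b\<bar> * D) * \<epsilon>" by (simp add: algebra_simps)
  qed
qed

lemma signed_borel_measure_measure:
  fixes M :: "'a::topological_space measure"
  assumes "finite_measure M" "sets M = sets borel"
  shows "signed_borel_measure (measure M)"
proof -
  interpret finite_measure M by fact
  show ?thesis
    unfolding signed_borel_measure_def
    using assms(2) by (auto simp: measure_notin_sets intro!: finite_measure_UNION)
qed

lemma signed_integral_measure:
  fixes f :: "'a::topological_space \<Rightarrow> 'b::{banach, second_countable_topology}"
  assumes cpt: "compact (UNIV :: 'a set)" and f: "continuous_on UNIV f"
    and M: "finite_measure M" "sets M = sets borel"
  shows "signed_integral (measure M) f = integral\<^sup>L M f"
  using integral_step_approx[OF _ _ M integrable_continuous_compact[OF cpt M f]]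
  by (intro signed_integral_eqI[OF cpt f signed_borel_measure_measure[OF M], where D = "measure M UNIV"])
     (simp add: mult.commute)

lemma signed_borel_measure_dirac: "signed_borel_measure (dirac x)"
  unfolding signed_borel_measure_def
proof (intro conjI allI impI)
  fix A :: "nat \<Rightarrow> 'a set"
  assume A: "range A \<subseteq> sets borel" "disjoint_family A"
  have "(\<lambda>i. indicator (A i) x :: real) sums indicator (\<Union>i. A i) x"
    by (rule indicator_sums) (use A(2) in \<open>auto simp: disjoint_family_on_def\<close>)
  moreover have "A i \<in> sets borel" "(\<Union>i. A i) \<in> sets borel" for i using A(1) by auto
  ultimately show "(\<lambda>i. dirac x (A i)) sums dirac x (\<Union>i. A i)" by (simp add: dirac_def)
qed (simp add: dirac_def)

lemma signed_integral_dirac: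
  fixes f :: "'a::topological_space \<Rightarrow> 'b::{banach, second_countable_topology}"
  assumes "compact (UNIV :: 'a set)" "continuous_on UNIV f"
  shows "signed_integral (dirac x) f = f x"
proof (rule signed_integral_eqI[OF assms signed_borel_measure_dirac, where D = 1])
  fix \<epsilon> :: real and n B and k :: "nat \<Rightarrow> 'b"
  assume part: "borel_partition n B" and k: "\<forall>i<n. \<forall>x\<in>B i. norm (f x - k i) \<le> \<epsilon>"
  have "f x - (\<Sum>i<n. dirac x (B i) *\<^sub>R k i) = (\<Sum>i<n. indicator (B i) x *\<^sub>R (f x - k i))"
    using part borel_partition_sum_indicator[OF part, of x "f x"]
    by (simp add: dirac_def borel_partition_def scaleR_diff_right sum_subtractf)
  also have "norm \<dots> \<le> (\<Sum>i<n. indicator (B i) x *\<^sub>R \<epsilon>)"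
    using k by (intro sum_norm_le) (auto simp: indicator_def)
  also have "\<dots> = \<epsilon>" by (rule borel_partition_sum_indicator[OF part])
  finally show "norm (f x - (\<Sum>i<n. dirac x (B i) *\<^sub>R k i)) \<le> 1 * \<epsilon>" by simp
qed

text \<open>
  For finite measures regularity is the existence of \<open>K \<subseteq> A \<subseteq> U\<close> with \<open>U - K\<close> small.  In this form it
  passes to every measure that is dominated by a regular one.
\<close>

lemma regular_borelI:
  assumes sets: "sets M = sets borel" and fin: "finite_measure M"
    and approx: "\<And>A \<epsilon>. A \<in> sets borel \<Longrightarrow> \<epsilon> > 0 \<Longrightarrow>
      \<exists>K U. compact K \<and> open U \<and> K \<in> sets borel \<and> K \<subseteq> A \<and> A \<subseteq> U \<and> measure M (U - K) \<le> \<epsilon>"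
  shows "regular_borel M"
  unfolding regular_borel_def
proof (intro conjI ballI sets)
  interpret finite_measure M by (rule fin)
  fix A :: "'a set" assume A: "A \<in> sets borel"
  show "emeasure M A = (INF U\<in>{U. open U \<and> A \<subseteq> U}. emeasure M U)"
  proof (rule antisym)
    show "emeasure M A \<le> (INF U\<in>{U. open U \<and> A \<subseteq> U}. emeasure M U)"
      using sets by (intro INF_greatest emeasure_mono) auto
    show "(INF U\<in>{U. open U \<and> A \<subseteq> U}. emeasure M U) \<le> emeasure M A"
    proof (rule ennreal_le_epsilon)
      fix e :: real assume "0 < e"
      then obtain K U where KU: "open U" "K \<in> sets borel" "K \<subseteq> A" "A \<subseteq> U" "measure M (U - K) \<le> e"
        using approx[OF A] by metis
      have m: "A \<in> sets M" "U \<in> sets M" "K \<in> sets M" using A KU sets by auto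
      have "(INF U\<in>{U. open U \<and> A \<subseteq> U}. emeasure M U) \<le> emeasure M U"
        using KU by (intro INF_lower) auto
      also have "\<dots> \<le> emeasure M (A \<union> (U - K))" using m KU by (intro emeasure_mono) auto
      also have "\<dots> \<le> emeasure M A + emeasure M (U - K)" using m by (intro emeasure_subadditive) auto
      also have "\<dots> \<le> emeasure M A + ennreal e"
        using KU(5) by (intro add_left_mono) (simp add: emeasure_eq_measure ennreal_leI)
      finally show "(INF U\<in>{U. open U \<and> A \<subseteq> U}. emeasure M U) \<le> emeasure M A + ennreal e" .
    qed
  qed
  show "emeasure M A = (SUP K\<in>{K. compact K \<and> K \<subseteq> A}. emeasure M K)"
  proof (rule antisym)
    show "(SUP K\<in>{K. compact K \<and> K \<subseteq> A}. emeasure M K) \<le> emeasure M A"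
      using A sets by (intro SUP_least emeasure_mono) auto
    show "emeasure M A \<le> (SUP K\<in>{K. compact K \<and> K \<subseteq> A}. emeasure M K)"
    proof (rule ennreal_le_epsilon)
      fix e :: real assume "0 < e"
      then obtain K U where KU: "compact K" "open U" "K \<in> sets borel" "K \<subseteq> A" "A \<subseteq> U" "measure M (U - K) \<le> e"
        using approx[OF A] by metis
      have m: "A \<in> sets M" "U \<in> sets M" "K \<in> sets M" using A KU sets by auto
      have "emeasure M A \<le> emeasure M (K \<union> (U - K))" using m KU by (intro emeasure_mono) auto
      also have "\<dots> \<le> emeasure M K + emeasure M (U - K)" using m by (intro emeasure_subadditive) auto
      also have "\<dots> \<le> (SUP K\<in>{K. compact K \<and> K \<subseteq> A}. emeasure M K) + ennreal e"
        using KU by (intro add_mono SUP_upper) (auto simp: emeasure_eq_measure ennreal_leI)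
      finally show "emeasure M A \<le> (SUP K\<in>{K. compact K \<and> K \<subseteq> A}. emeasure M K) + ennreal e" .
    qed
  qed
qed

lemma finite_measure_total_variation:
  assumes "signed_borel_measure \<mu>"
  shows "finite_measure (total_variation \<mu>)"
proof -
  interpret U: finite_measure "upper_variation \<mu>" by (rule finite_measure_upper_variation[OF assms])
  interpret L: finite_measure "lower_variation \<mu>" by (rule finite_measure_lower_variation[OF assms])
  show ?thesis
  proof
    show "emeasure (total_variation \<mu>) (space (total_variation \<mu>)) \<noteq> \<infinity>"
      by (subst emeasure_total_variation)
         (simp_all add: space_eq_UNIV_if_sets_borel U.emeasure_eq_measure L.emeasure_eq_measure)
  qed
qed

lemma measure_total_variation:
  assumes \<mu>: "signed_borel_measure \<mu>" and A: "A \<in> sets borel"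
  shows "measure (total_variation \<mu>) A = measure (upper_variation \<mu>) A + measure (lower_variation \<mu>) A"
proof -
  interpret U: finite_measure "upper_variation \<mu>" by (rule finite_measure_upper_variation[OF \<mu>])
  interpret L: finite_measure "lower_variation \<mu>" by (rule finite_measure_lower_variation[OF \<mu>])
  show ?thesis
    unfolding measure_def[of "total_variation \<mu>"] emeasure_total_variation[OF A]
    by (simp add: U.emeasure_eq_measure L.emeasure_eq_measure flip: ennreal_plus)
qed

lemma measure_total_variation_le:
  assumes \<mu>: "signed_borel_measure \<mu>" and A: "A \<in> sets borel"
    and le: "\<And>B. B \<in> sets borel \<Longrightarrow> B \<subseteq> A \<Longrightarrow> \<bar>\<mu> B\<bar> \<le> c"
  shows "measure (total_variation \<mu>) A \<le> 2 * c"
proof -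
  have "measure (upper_variation \<mu>) A \<le> c"
    using le by (intro upper_variation_le[OF \<mu> A]) (meson abs_le_D1)
  moreover have "measure (lower_variation \<mu>) A \<le> c"
    unfolding lower_variation_def using le
    by (intro upper_variation_le[OF signed_borel_measure_uminus[OF \<mu>] A]) (meson abs_le_D2)
  ultimately show ?thesis by (simp add: measure_total_variation[OF \<mu> A])
qed

lemma lower_variation_nonneg:
  assumes \<mu>: "signed_borel_measure \<mu>" and nonneg: "\<And>A. \<mu> A \<ge> 0"
  shows "integral\<^sup>L (lower_variation \<mu>) (f :: _ \<Rightarrow> real) = 0"
proof -
  have "emeasure (lower_variation \<mu>) UNIV = 0"
    unfolding lower_variation_def
    using nonneg by (subst emeasure_upper_variation[OF signed_borel_measure_uminus[OF \<mu>]])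
      (auto simp: ennreal_neg intro!: antisym SUP_least)
  then have "AE x in lower_variation \<mu>. f x = 0"
    by (intro AE_I[of _ _ UNIV]) auto
  then show ?thesis by (rule integral_eq_zero_AE)
qed

text \<open>
  The set \<open>{\<phi> < 0}\<close> is open and misses the support.  Each of its compact subsets is covered by finitely
  many open null sets, so inner regularity makes \<open>{\<phi> < 0}\<close> itself null; without regularity a
  measure may charge the complement of its support.
\<close>

lemma M_star_integral_nonneg:
  fixes \<phi> :: "'a::t2_space \<Rightarrow> real"
  assumes cpt: "compact (UNIV :: 'a set)" and \<mu>: "\<mu> \<in> M_star \<Theta>"
    and \<phi>: "continuous_on UNIV \<phi>" "\<And>x. x \<notin> \<Theta> \<Longrightarrow> \<phi> x \<ge> 0"
  shows "signed_integral \<mu> \<phi> \<ge> 0"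
proof -
  have sb: "signed_borel_measure \<mu>" and reg: "regular_borel (total_variation \<mu>)"
    and nonneg: "\<And>A. \<mu> A \<ge> 0" and supp: "measure_support \<mu> \<subseteq> closure (- \<Theta>)"
    using \<mu> by (auto simp: M_star_def regular_signed_measures_def)
  let ?T = "total_variation \<mu>"
  define N where "N = {x. \<phi> x < 0}"
  have N: "open N" unfolding N_def by (intro open_Collect_less \<phi>(1) continuous_intros)
  have closed: "closed {x. 0 \<le> \<phi> x}" by (intro closed_Collect_le \<phi>(1) continuous_intros)
  have "closure (- \<Theta>) \<subseteq> {x. 0 \<le> \<phi> x}"
    by (rule closure_minimal[OF _ closed]) (use \<phi>(2) in auto)
  then have disj: "N \<inter> measure_support \<mu> = {}" using supp by (auto simp: N_def)
  have "emeasure ?T K \<le> 0" if K: "compact K" "K \<subseteq> N" for K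
  proof -
    have "\<exists>V. open V \<and> x \<in> V \<and> emeasure ?T V = 0" if "x \<in> K" for x
    proof -
      have "x \<notin> measure_support \<mu>" using disj K(2) that by blast
      then show ?thesis by (auto simp: measure_support_def)
    qed
    then obtain V where V: "\<And>x. x \<in> K \<Longrightarrow> open (V x) \<and> x \<in> V x \<and> emeasure ?T (V x) = 0"
      by metis
    have "\<exists>D. D \<subseteq> K \<and> finite D \<and> K \<subseteq> (\<Union>x\<in>D. V x)"
      by (rule compactE_image[OF K(1), of K V]) (use V in auto)
    then obtain D where D: "D \<subseteq> K" "finite D" "K \<subseteq> (\<Union>x\<in>D. V x)" by blast
    have op: "open (V x)" if "x \<in> D" for x using V D(1) that by blast
    have "emeasure ?T K \<le> emeasure ?T (\<Union>x\<in>D. V x)"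
      using D op by (intro emeasure_mono) (auto intro!: sets.finite_UN)
    also have "\<dots> \<le> (\<Sum>x\<in>D. emeasure ?T (V x))"
      using op by (intro emeasure_subadditive_finite D(2)) auto
    also have "\<dots> = 0" using V D(1) by (intro sum.neutral) blast
    finally show ?thesis .
  qed
  moreover have "emeasure ?T N = (SUP K\<in>{K. compact K \<and> K \<subseteq> N}. emeasure ?T K)"
    using reg N unfolding regular_borel_def by (meson borel_open)
  ultimately have "emeasure ?T N = 0" by (auto intro!: antisym SUP_least)
  then have "emeasure (upper_variation \<mu>) N = 0"
    using N by (simp add: emeasure_total_variation)
  then have "AE x in upper_variation \<mu>. 0 \<le> \<phi> x"
    using N by (intro AE_I[of _ _ N]) (auto simp: N_def)
  then have "integral\<^sup>L (upper_variation \<mu>) \<phi> \<ge> 0" by (rule integral_nonneg_AE)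
  then show ?thesis by (simp add: signed_integral_def lower_variation_nonneg[OF sb nonneg])
qed

lemma signed_integral_of_real:
  "signed_integral \<mu> (\<lambda>x. complex_of_real (\<phi> x)) = of_real (signed_integral \<mu> \<phi>)"
  by (simp add: signed_integral_def)

lemma has_sum_nonneg_Reals:
  fixes f :: "'b \<Rightarrow> complex"
  assumes "(f has_sum s) X" "\<And>x. x \<in> X \<Longrightarrow> f x \<in> \<real>\<^sub>\<ge>\<^sub>0"
  shows "s \<in> \<real>\<^sub>\<ge>\<^sub>0"
proof -
  have "Re s \<ge> 0"
    using assms(2) by (intro has_sum_nonneg[OF has_sum_Re[OF assms(1)]]) (auto simp: complex_nonneg_Reals_iff)
  moreover have "Im s = 0"
  proof -
    have "((\<lambda>x. Im (f x)) has_sum 0) X"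
      using assms(2) by (intro has_sum_0) (auto simp: complex_nonneg_Reals_iff)
    then show ?thesis using has_sum_unique has_sum_Im[OF assms(1)] by blast
  qed
  ultimately show ?thesis by (simp add: complex_nonneg_Reals_iff)
qed

lemma minkowski_sumI:
  assumes "\<mu> \<in> X" "\<nu> \<in> Y" "\<sigma> = (\<lambda>A. \<mu> A + \<nu> A)"
  shows "\<sigma> \<in> minkowski_sum X Y"
  using assms unfolding minkowski_sum_def by blast

section \<open>Haar measure on a compact Abelian group\<close>

lemma urysohn_compact_hausdorff:
  fixes S T :: "'a::t2_space set"
  assumes "compact (UNIV :: 'a set)" "closed S" "closed T" "S \<inter> T = {}"
  obtains f :: "'a \<Rightarrow> real" where "continuous_on UNIV f" "\<And>x. 0 \<le> f x" "\<And>x. f x \<le> 1"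
    "\<And>x. x \<in> S \<Longrightarrow> f x = 0" "\<And>x. x \<in> T \<Longrightarrow> f x = 1"
proof -
  have "compact_space (euclidean :: 'a topology)"
    using assms(1) by (simp add: compact_space_def)
  then have "normal_space (euclidean :: 'a topology)"
    by (rule compact_Hausdorff_or_regular_imp_normal_space, intro disjI1)
       (simp add: Hausdorff_space_def disjnt_def, meson hausdorff)
  from Urysohn_lemma[OF this, of S T 0 1] assms(2-4)
  obtain f where f: "continuous_map euclidean (top_of_set {0..1::real}) f" "f ` S \<subseteq> {0}" "f ` T \<subseteq> {1}"
    by (auto simp: disjnt_def)
  then have "continuous_on UNIV f" "range f \<subseteq> {0..1}"
    by (auto simp: continuous_map_in_subtopology)
  then show thesis using f(2,3) by (intro that[of f]) (auto simp: image_subset_iff)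
qed

locale compact_ab_group =
  fixes haar :: "'a::{topological_ab_group_add, t2_space} measure"
  assumes compact_group: "compact (UNIV :: 'a set)"
    and normalised: "normalised_haar haar"
begin

lemma sets_haar [simp, measurable_cong]: "sets haar = sets borel"
  using normalised by (simp add: normalised_haar_def regular_borel_def)

lemma space_haar [simp]: "space haar = UNIV"
  by (rule space_eq_UNIV_if_sets_borel) simp

lemma prob_space_haar: "emeasure haar UNIV = 1"
  using normalised by (simp add: normalised_haar_def)

sublocale finite_measure haar
  by standard (simp add: prob_space_haar)

lemma measure_haar_UNIV [simp]: "measure haar UNIV = 1"
  by (simp add: measure_def prob_space_haar)

lemma integrable_indicator: "A \<in> sets borel \<Longrightarrow> integrable haar (indicator A :: 'a \<Rightarrow> real)"
  by (rule integrable_real_indicator) (simp_all add: less_top[symmetric])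

lemma continuous_translate: "continuous_on UNIV (\<lambda>x::'a. x + g)" "continuous_on UNIV (\<lambda>x::'a. g + x)"
  "continuous_on UNIV (\<lambda>x::'a. g - x)" "continuous_on UNIV (\<lambda>x::'a. - x)"
  by (intro continuous_intros)+

lemma haar_translate: "emeasure haar ((+) g ` A) = emeasure haar A" if "A \<in> sets borel"
  using normalised that by (simp add: normalised_haar_def)

lemma distr_haar_translate: "distr haar haar (\<lambda>x. x + g) = haar"
proof (rule measure_eqI)
  have [measurable]: "(\<lambda>x::'a. x + g) \<in> borel \<rightarrow>\<^sub>M borel"
    by (intro borel_measurable_continuous_onI continuous_translate)
  fix A assume "A \<in> sets (distr haar haar (\<lambda>x. x + g))"
  then have A [measurable]: "A \<in> sets borel" by simp
  have "(\<lambda>x. x + g) -` A = (+) (- g) ` A"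
    by (force simp: image_iff algebra_simps)
  then show "emeasure (distr haar haar (\<lambda>x. x + g)) A = emeasure haar A"
    using haar_translate[OF A, of "- g"] by (subst emeasure_distr) auto
qed simp

lemma integral_translate:
  fixes f :: "'a \<Rightarrow> 'b::{banach, second_countable_topology}"
  assumes [measurable]: "f \<in> borel_measurable borel"
  shows "(LINT x|haar. f (x + g)) = (LINT x|haar. f x)"
proof -
  have [measurable]: "(\<lambda>x::'a. x + g) \<in> borel \<rightarrow>\<^sub>M borel"
    by (intro borel_measurable_continuous_onI continuous_translate)
  have "(LINT x|distr haar haar (\<lambda>x. x + g). f x) = (LINT x|haar. f (x + g))"
    by (rule integral_distr) auto
  then show ?thesis by (simp add: distr_haar_translate)
qed

text \<open>
  Finitely many translates of a non-empty open set cover the group.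
\<close>

lemma haar_open_pos:
  assumes "open U" "U \<noteq> {}"
  shows "0 < measure haar U"
proof (rule ccontr)
  assume "\<not> 0 < measure haar U"
  then have 0: "emeasure haar U = 0"
    by (simp add: emeasure_eq_measure) (meson measure_nonneg antisym not_less)
  obtain u where u: "u \<in> U" using assms(2) by blast
  have op: "open ((+) g ` U)" for g
  proof -
    have "(+) g ` U = (+) (- g) -` U" by (force simp: image_iff algebra_simps)
    then show ?thesis using open_vimage[OF assms(1) continuous_translate(2)] by metis
  qed
  have "\<exists>D. D \<subseteq> UNIV \<and> finite D \<and> UNIV \<subseteq> (\<Union>g\<in>D. (+) g ` U)"
  proof (rule compactE_image[OF compact_group, of UNIV "\<lambda>g. (+) g ` U"])
    show "UNIV \<subseteq> (\<Union>g\<in>UNIV. (+) g ` U)"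
    proof
      fix x :: 'a
      have "x = (x - u) + u" by simp
      then show "x \<in> (\<Union>g\<in>UNIV. (+) g ` U)" using u by blast
    qed
  qed (use op in auto)
  then obtain D where D: "finite D" "(\<Union>g\<in>D. (+) g ` U) = UNIV" by blast
  have "emeasure haar (\<Union>g\<in>D. (+) g ` U) \<le> (\<Sum>g\<in>D. emeasure haar ((+) g ` U))"
    using op by (intro emeasure_subadditive_finite D(1)) auto
  also have "\<dots> = 0" using assms(1) 0 by (simp add: haar_translate)
  finally show False by (simp add: D(2) prob_space_haar)
qed

lemma integrable_continuous:
  fixes f :: "'a \<Rightarrow> 'b::{banach, second_countable_topology}"
  assumes "continuous_on UNIV f"
  shows "integrable haar f"
  by (rule integrable_continuous_compact[OF compact_group _ _ assms]) (simp_all add: finite_measure_axioms)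

lemma fubini_haar:
  fixes F :: "'a \<times> 'a \<Rightarrow> 'b::{banach, second_countable_topology}"
  assumes "continuous_on UNIV F"
  shows "(LINT x|haar. LINT y|haar. F (x, y)) = (LINT y|haar. LINT x|haar. F (x, y))"
  by (rule fubini_continuous[OF compact_group assms]) (simp_all add: finite_measure_axioms)

lemma continuous_haar_parameter:
  fixes F :: "'a \<times> 'a \<Rightarrow> 'b::{banach, second_countable_topology}"
  assumes "continuous_on UNIV F"
  shows "continuous_on UNIV (\<lambda>x. LINT y|haar. F (x, y))"
  by (rule continuous_integral_parameter[OF compact_group assms]) (simp_all add: finite_measure_axioms)

text \<open>
  Integrating \<open>f(x - y)\<close> first over \<open>x\<close> gives \<open>\<integral> f\<close>, first over \<open>y\<close> it gives \<open>\<integral> f(-y) dy\<close>.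
\<close>

lemma integral_reflect_continuous:
  fixes f :: "'a \<Rightarrow> 'b::{banach, second_countable_topology}"
  assumes f: "continuous_on UNIV f"
  shows "(LINT x|haar. f (- x)) = (LINT x|haar. f x)"
proof -
  have f': "continuous_on UNIV (\<lambda>x. f (- x))"
    by (intro continuous_on_compose2[OF f] continuous_intros) simp
  have "continuous_on UNIV (\<lambda>p. f (fst p - snd p))"
    by (intro continuous_on_compose2[OF f] continuous_intros) simp
  from fubini_haar[OF this]
  have "(LINT x|haar. LINT y|haar. f (x - y)) = (LINT y|haar. LINT x|haar. f (x - y))" by simp
  moreover have "(LINT x|haar. f (x - y)) = (LINT x|haar. f x)" for y
    using integral_translate[of f "- y"] f by (simp add: borel_measurable_continuous_onI)
  moreover have "(LINT y|haar. f (x - y)) = (LINT y|haar. f (- y))" for x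
    using integral_translate[of "\<lambda>x. f (- x)" "- x"] f' by (simp add: borel_measurable_continuous_onI)
  ultimately show ?thesis by simp
qed

lemma haar_outer: "A \<in> sets borel \<Longrightarrow> emeasure haar A = (INF U\<in>{U. open U \<and> A \<subseteq> U}. emeasure haar U)"
  and haar_inner: "A \<in> sets borel \<Longrightarrow> emeasure haar A = (SUP K\<in>{K. compact K \<and> K \<subseteq> A}. emeasure haar K)"
  using normalised unfolding normalised_haar_def regular_borel_def by blast+

lemma borel_uminus_image: "uminus ` A \<in> sets borel" if "A \<in> sets borel" for A :: "'a set"
proof -
  have meas: "(uminus :: 'a \<Rightarrow> 'a) \<in> borel \<rightarrow>\<^sub>M borel"
    by (intro borel_measurable_continuous_onI continuous_translate)
  have "uminus ` A = uminus -` A \<inter> space (borel :: 'a measure)" by (force simp: image_iff)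
  also have "\<dots> \<in> sets borel"
    using that by (rule measurable_sets[OF meas])
  finally show ?thesis .
qed

lemma open_uminus_image: "open (uminus ` U)" if "open U" for U :: "'a set"
proof -
  have "uminus ` U = uminus -` U" by (force simp: image_iff)
  then show ?thesis using that by (simp add: open_vimage continuous_translate)
qed

text \<open>
  Urysohn functions transfer the invariance from continuous functions to measures: if \<open>f\<close> is \<open>1\<close> on the
  compact set \<open>K\<close> and \<open>0\<close> off \<open>-V\<close>, then \<open>\<lambda>(K) \<le> \<integral> f = \<integral> f(-x) dx \<le> \<lambda>(V)\<close> for every open \<open>V \<supseteq> -K\<close>.
\<close>

lemma haar_reflect:
  assumes "A \<in> sets borel" shows "emeasure haar (uminus ` A) = emeasure haar A"
proof -
  have compact_le: "emeasure haar K \<le> emeasure haar (uminus ` K)" if K: "compact K" for K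
  proof -
    have K_borel: "K \<in> sets borel" using K by (simp add: borel_closed compact_imp_closed)
    have "emeasure haar K \<le> emeasure haar V" if V: "open V" "uminus ` K \<subseteq> V" for V
    proof -
      have disj: "uminus ` (- V) \<inter> K = {}" using V(2) by force
      have "closed (uminus ` (- V))"
        using V(1) open_uminus_image[of V] by (simp add: closed_def bij_image_Compl_eq[OF bij_uminus])
      then obtain f :: "'a \<Rightarrow> real" where f: "continuous_on UNIV f" "\<And>x. 0 \<le> f x" "\<And>x. f x \<le> 1"
        "\<And>x. x \<in> uminus ` (- V) \<Longrightarrow> f x = 0" "\<And>x. x \<in> K \<Longrightarrow> f x = 1"
        using urysohn_compact_hausdorff[OF compact_group _ compact_imp_closed[OF K] disj] by blast
      have f': "continuous_on UNIV (\<lambda>x. f (- x))"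
        by (intro continuous_on_compose2[OF f(1)] continuous_intros) simp
      have V': "V \<in> sets haar" "K \<in> sets haar" using V(1) K_borel by auto
      have "measure haar K = (LINT x|haar. indicator K x)" by simp
      also have "\<dots> \<le> (LINT x|haar. f x)"
      proof (rule integral_mono)
        fix x show "indicator K x \<le> f x" using f(2,5) by (auto simp: indicator_def)
      qed (use V' f(1) in \<open>simp_all add: integrable_continuous integrable_indicator\<close>)
      also have "\<dots> = (LINT x|haar. f (- x))" by (rule integral_reflect_continuous[OF f(1), symmetric])
      also have "\<dots> \<le> (LINT x|haar. indicator V x)"
      proof (rule integral_mono)
        fix x show "f (- x) \<le> indicator V x" using f(3)[of "- x"] f(4)[of "- x"] by (auto simp: indicator_def)
      qed (use V' f' in \<open>simp_all add: integrable_continuous integrable_indicator\<close>)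
      also have "\<dots> = measure haar V" by simp
      finally show ?thesis by (simp add: emeasure_eq_measure)
    qed
    then show ?thesis
      unfolding haar_outer[OF borel_uminus_image[OF K_borel]] by (intro INF_greatest) auto
  qed
  have le: "emeasure haar A \<le> emeasure haar (uminus ` A)" if A: "A \<in> sets borel" for A
    unfolding haar_inner[OF A]
  proof (rule SUP_least)
    fix K assume K: "K \<in> {K. compact K \<and> K \<subseteq> A}"
    then have "emeasure haar K \<le> emeasure haar (uminus ` K)" using compact_le by blast
    also have "\<dots> \<le> emeasure haar (uminus ` A)"
      using K borel_uminus_image[OF A] by (intro emeasure_mono) auto
    finally show "emeasure haar K \<le> emeasure haar (uminus ` A)" .
  qed
  show ?thesis
    using le[OF assms] le[OF borel_uminus_image[OF assms]] by (simp add: image_image)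
qed

lemma distr_haar_reflect: "distr haar haar uminus = haar"
proof (rule measure_eqI)
  have [measurable]: "(uminus :: 'a \<Rightarrow> 'a) \<in> borel \<rightarrow>\<^sub>M borel"
    by (intro borel_measurable_continuous_onI continuous_translate)
  fix A assume "A \<in> sets (distr haar haar uminus)"
  then have A [measurable]: "A \<in> sets borel" by simp
  have "uminus -` A = uminus ` A" by (force simp: image_iff)
  then show "emeasure (distr haar haar uminus) A = emeasure haar A"
    using haar_reflect[OF A] by (subst emeasure_distr) auto
qed simp

lemma integral_reflect:
  fixes f :: "'a \<Rightarrow> 'b::{banach, second_countable_topology}"
  assumes [measurable]: "f \<in> borel_measurable borel"
  shows "(LINT x|haar. f (- x)) = (LINT x|haar. f x)"
proof -
  have [measurable]: "(uminus :: 'a \<Rightarrow> 'a) \<in> borel \<rightarrow>\<^sub>M borel"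
    by (intro borel_measurable_continuous_onI continuous_translate)
  have "(LINT x|distr haar haar uminus. f x) = (LINT x|haar. f (- x))"
    by (rule integral_distr) auto
  then show ?thesis by (simp add: distr_haar_reflect)
qed

end

section \<open>The convolution algebra of continuous functions\<close>

context compact_ab_group
begin

abbreviation conv :: "('a \<Rightarrow> complex) \<Rightarrow> ('a \<Rightarrow> complex) \<Rightarrow> 'a \<Rightarrow> complex" (infixl "\<star>" 70) where
  "u \<star> w \<equiv> convolution haar u w"

text \<open>
  Written \<open>u\<^sup>*\<close> below; \<open>u\<close> is called Hermitian if \<open>u\<^sup>* = u\<close>.
\<close>

definition adjoint_fun :: "('a \<Rightarrow> complex) \<Rightarrow> 'a \<Rightarrow> complex" where
  "adjoint_fun u = (\<lambda>g. cnj (u (- g)))"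

text \<open>
  The square of the \<open>L\<^sup>2\<close> norm.  Only continuous functions are convolved, so the space \<open>L\<^sup>2\<close> itself is
  avoided; convergence is always uniform convergence.
\<close>

definition energy :: "('a \<Rightarrow> complex) \<Rightarrow> real" where
  "energy u = (LINT x|haar. (cmod (u x))\<^sup>2)"

abbreviation continuous_fun :: "('a \<Rightarrow> complex) \<Rightarrow> bool" where
  "continuous_fun u \<equiv> continuous_on UNIV u"

lemma integral_pos:
  fixes f :: "'a \<Rightarrow> real"
  assumes "continuous_on UNIV f" "\<And>x. f x \<ge> 0" "f x0 > 0"
  shows "(LINT x|haar. f x) > 0"
proof -
  define U where "U = {x. f x > f x0 / 2}"
  have U: "open U" "x0 \<in> U"
    using assms(1,3) by (auto simp: U_def intro!: open_Collect_less continuous_intros)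
  have "0 < f x0 / 2 * measure haar U"
    using haar_open_pos[OF U(1)] U(2) assms(3) by (intro mult_pos_pos) auto
  also have "\<dots> = (LINT x|haar. f x0 / 2 * indicator U x)" by simp
  also have "\<dots> \<le> (LINT x|haar. f x)"
  proof (rule integral_mono)
    show "integrable haar (\<lambda>x. f x0 / 2 * indicat_real U x)"
      using U(1) by (intro integrable_mult_right integrable_indicator) auto
    fix x show "f x0 / 2 * indicator U x \<le> f x"
      using assms(2)[of x] by (auto simp: U_def indicator_def)
  qed (rule integrable_continuous[OF assms(1)])
  finally show ?thesis .
qed

lemma cauchy_schwarz_integral:
  fixes a b :: "'a \<Rightarrow> real"
  assumes a: "continuous_on UNIV a" and b: "continuous_on UNIV b"
  shows "(LINT x|haar. a x * b x)\<^sup>2 \<le> (LINT x|haar. (a x)\<^sup>2) * (LINT x|haar. (b x)\<^sup>2)"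
proof -
  let ?A = "LINT x|haar. (a x)\<^sup>2" and ?B = "LINT x|haar. (b x)\<^sup>2" and ?P = "LINT x|haar. a x * b x"
  have int: "integrable haar (\<lambda>x. (a x)\<^sup>2)" "integrable haar (\<lambda>x. (b x)\<^sup>2)" "integrable haar (\<lambda>x. a x * b x)"
    using a b by (auto intro!: integrable_continuous continuous_intros)
  show ?thesis
  proof (cases "\<exists>x. b x \<noteq> 0")
    case True
    then obtain x0 where "b x0 \<noteq> 0" by blast
    then have B: "?B > 0"
      using b by (intro integral_pos[of _ x0]) (auto intro!: continuous_intros)
    have "0 \<le> (LINT x|haar. (?B * a x - ?P * b x)\<^sup>2)" by simp
    also have "(\<lambda>x. (?B * a x - ?P * b x)\<^sup>2)
        = (\<lambda>x. ?B\<^sup>2 * (a x)\<^sup>2 + ?P\<^sup>2 * (b x)\<^sup>2 - 2 * ?B * ?P * (a x * b x))"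
      by (auto simp: power2_eq_square algebra_simps)
    also have "integral\<^sup>L haar \<dots> = ?B\<^sup>2 * ?A + ?P\<^sup>2 * ?B - 2 * ?B * ?P * ?P"
      using int by simp
    also have "\<dots> = ?B * (?A * ?B - ?P\<^sup>2)" by (simp add: power2_eq_square algebra_simps)
    finally have "0 \<le> ?A * ?B - ?P\<^sup>2" using B by (simp add: zero_le_mult_iff)
    then show ?thesis by simp
  qed simp
qed

lemma continuous_comp_diff: "continuous_fun w \<Longrightarrow> continuous_fun (\<lambda>h. w (g - h))"
  by (rule continuous_on_compose2) (auto intro!: continuous_intros)

lemma continuous_comp_uminus: "continuous_fun w \<Longrightarrow> continuous_fun (\<lambda>h. w (- h))"
  by (rule continuous_on_compose2) (auto intro!: continuous_intros)

lemma continuous_comp_plus: "continuous_fun w \<Longrightarrow> continuous_fun (\<lambda>h. w (h + g))"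
  by (rule continuous_on_compose2) (auto intro!: continuous_intros)

lemma integral_reverse:
  fixes f :: "'a \<Rightarrow> 'b::{banach, second_countable_topology}"
  assumes "f \<in> borel_measurable borel"
  shows "(LINT h|haar. f (g - h)) = (LINT h|haar. f h)"
proof -
  have "(\<lambda>x::'a. x + g) \<in> borel \<rightarrow>\<^sub>M borel"
    by (intro borel_measurable_continuous_onI continuous_translate)
  from measurable_compose[OF this assms] integral_reflect[of "\<lambda>h. f (h + g)"] integral_translate[OF assms]
  show ?thesis by simp
qed

lemma conv_continuous:
  assumes "continuous_fun u" "continuous_fun w"
  shows "continuous_fun (u \<star> w)"
proof -
  have "continuous_on UNIV (\<lambda>p. u (snd p) * w (fst p - snd p))"
    by (intro continuous_intros continuous_on_compose2[OF assms(1)] continuous_on_compose2[OF assms(2)]; simp)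
  from continuous_haar_parameter[OF this] show ?thesis
    by (simp add: convolution_def[abs_def])
qed

lemma conv_commute:
  assumes "continuous_fun u" "continuous_fun w"
  shows "u \<star> w = w \<star> u"
proof
  fix g
  have "(\<lambda>h. w h * u (g - h)) \<in> borel_measurable borel"
    using assms by (intro borel_measurable_continuous_onI continuous_intros continuous_comp_diff)
  from integral_reverse[OF this, of g] show "(u \<star> w) g = (w \<star> u) g"
    by (simp add: convolution_def mult.commute)
qed

lemma conv_assoc:
  assumes u: "continuous_fun u" and v: "continuous_fun v" and w: "continuous_fun w"
  shows "u \<star> v \<star> w = u \<star> (v \<star> w)"
proof
  fix g
  have F: "continuous_on UNIV (\<lambda>p. u (snd p) * v (fst p - snd p) * w (g - fst p))"
    by (intro continuous_intros continuous_on_compose2[OF u] continuous_on_compose2[OF v]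
        continuous_on_compose2[OF w]; simp)
  have "(u \<star> v \<star> w) g = (LINT k|haar. LINT h|haar. u h * v (k - h) * w (g - k))"
    by (simp add: convolution_def)
  also have "\<dots> = (LINT h|haar. LINT k|haar. u h * v (k - h) * w (g - k))"
    using fubini_haar[OF F] by simp
  also have "\<dots> = (LINT h|haar. u h * (LINT k|haar. v (k - h) * w (g - k)))"
    by (simp add: mult.assoc)
  also have "\<dots> = (LINT h|haar. u h * (LINT k|haar. v k * w (g - h - k)))"
  proof -
    have "(LINT k|haar. v (k - h) * w (g - k)) = (LINT k|haar. v k * w (g - h - k))" for h
    proof -
      have "(\<lambda>k. v k * w (g - h - k)) \<in> borel_measurable borel"
        using v w by (intro borel_measurable_continuous_onI continuous_intros continuous_comp_diff)
      from integral_translate[OF this, of "- h"] show ?thesis by (simp add: algebra_simps)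
    qed
    then show ?thesis by simp
  qed
  finally show "(u \<star> v \<star> w) g = (u \<star> (v \<star> w)) g"
    by (simp add: convolution_def)
qed

lemma conv_linear:
  assumes "continuous_fun u" "continuous_fun v" "continuous_fun w"
  shows "(\<lambda>x. a * u x + b * v x) \<star> w = (\<lambda>x. a * (u \<star> w) x + b * (v \<star> w) x)"
proof
  fix g
  have "integrable haar (\<lambda>h. u h * w (g - h))" "integrable haar (\<lambda>h. v h * w (g - h))"
    using assms by (auto intro!: integrable_continuous continuous_intros continuous_comp_diff)
  then show "((\<lambda>x. a * u x + b * v x) \<star> w) g = a * (u \<star> w) g + b * (v \<star> w) g"
    by (simp add: convolution_def distrib_right mult.assoc)
qed

lemma conv_scale: "(\<lambda>x. a * u x) \<star> w = (\<lambda>x. a * (u \<star> w) x)"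
  by (simp add: convolution_def fun_eq_iff mult.assoc)

lemma energy_nonneg [simp]: "energy u \<ge> 0"
  by (simp add: energy_def)

lemma energy_reverse:
  assumes "continuous_fun u"
  shows "(LINT h|haar. (cmod (u (g - h)))\<^sup>2) = energy u"
proof -
  have "(\<lambda>h. (cmod (u h))\<^sup>2) \<in> borel_measurable borel"
    using assms by (intro borel_measurable_continuous_onI continuous_intros)
  from integral_reverse[OF this] show ?thesis by (simp add: energy_def)
qed

text \<open>
  Cauchy and Schwarz.  Convolution with a fixed function turns \<open>L\<^sup>2\<close> estimates into uniform ones, which
  keeps limits inside the continuous functions.
\<close>

lemma conv_bound:
  assumes u: "continuous_fun u" and w: "continuous_fun w"
  shows "(cmod ((u \<star> w) g))\<^sup>2 \<le> energy u * energy w"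
proof -
  have "cmod ((u \<star> w) g) \<le> (LINT h|haar. cmod (u h) * cmod (w (g - h)))"
    unfolding convolution_def norm_mult[symmetric] by (rule integral_norm_bound)
  then have "(cmod ((u \<star> w) g))\<^sup>2 \<le> (LINT h|haar. cmod (u h) * cmod (w (g - h)))\<^sup>2"
    by (intro power_mono) auto
  also have "\<dots> \<le> (LINT h|haar. (cmod (u h))\<^sup>2) * (LINT h|haar. (cmod (w (g - h)))\<^sup>2)"
    using u w by (intro cauchy_schwarz_integral continuous_intros continuous_comp_diff)
  also have "\<dots> = energy u * energy w" using w by (simp add: energy_reverse energy_def)
  finally show ?thesis .
qed

lemma energy_bound:
  assumes "continuous_fun u" "\<And>x. (cmod (u x))\<^sup>2 \<le> K"
  shows "energy u \<le> K"
proof -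
  have "energy u \<le> (LINT x|haar. K)"
    unfolding energy_def using assms
    by (intro integral_mono integrable_continuous continuous_intros) auto
  then show ?thesis by simp
qed

lemma energy_conv_le:
  "continuous_fun u \<Longrightarrow> continuous_fun w \<Longrightarrow> energy (u \<star> w) \<le> energy u * energy w"
  by (rule energy_bound) (auto intro: conv_continuous conv_bound)

lemma energy_pos: "continuous_fun u \<Longrightarrow> u x \<noteq> 0 \<Longrightarrow> energy u > 0"
  unfolding energy_def by (rule integral_pos[of _ x]) (auto intro!: continuous_intros)

lemma adjoint_continuous: "continuous_fun u \<Longrightarrow> continuous_fun (adjoint_fun u)"
  unfolding adjoint_fun_def by (intro continuous_intros continuous_comp_uminus)

lemma adjoint_adjoint [simp]: "adjoint_fun (adjoint_fun u) = u"
  by (simp add: adjoint_fun_def)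

lemma adjoint_conv:
  assumes "continuous_fun u" "continuous_fun w"
  shows "adjoint_fun (u \<star> w) = adjoint_fun u \<star> adjoint_fun w"
proof
  fix g
  have "adjoint_fun (u \<star> w) g = (LINT h|haar. cnj (u h) * cnj (w (- g - h)))"
    unfolding adjoint_fun_def convolution_def
    by (simp only: Bochner_Integration.integral_cnj[symmetric] complex_cnj_mult)
  also have "\<dots> = (LINT h|haar. cnj (u (- h)) * cnj (w (- (g - h))))"
  proof -
    have "(\<lambda>h. cnj (u h) * cnj (w (- g - h))) \<in> borel_measurable borel"
      using assms by (intro borel_measurable_continuous_onI continuous_intros continuous_comp_diff)
    from integral_reflect[OF this] show ?thesis by (simp add: algebra_simps)
  qed
  finally show "adjoint_fun (u \<star> w) g = (adjoint_fun u \<star> adjoint_fun w) g"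
    by (simp add: adjoint_fun_def convolution_def)
qed

lemma conv_adjoint_at_0: "(u \<star> adjoint_fun u) 0 = of_real (energy u)"
  by (simp add: convolution_def adjoint_fun_def energy_def complex_norm_square[symmetric] flip: integral_complex_of_real)

lemma conv_adjoint_at_0_inner:
  "(u \<star> adjoint_fun w) 0 = (LINT h|haar. u h * cnj (w h))"
  by (simp add: convolution_def adjoint_fun_def)

lemma energy_diff:
  assumes u: "continuous_fun u" and w: "continuous_fun w"
  shows "energy (\<lambda>x. u x - w x) = energy u + energy w - 2 * Re ((u \<star> adjoint_fun w) 0)"
proof -
  have "integrable haar (\<lambda>h. u h * cnj (w h))"
    using u w by (intro integrable_continuous continuous_intros)
  then have "Re ((u \<star> adjoint_fun w) 0) = (LINT h|haar. Re (u h * cnj (w h)))"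
    by (simp only: conv_adjoint_at_0_inner integral_Re)
  moreover have "(\<lambda>h. (cmod (u h - w h))\<^sup>2) = (\<lambda>h. (cmod (u h))\<^sup>2 + (cmod (w h))\<^sup>2 - 2 * Re (u h * cnj (w h)))"
    unfolding cmod_power2 by (auto simp: power2_eq_square algebra_simps)
  moreover have "integrable haar (\<lambda>h. (cmod (u h))\<^sup>2)" "integrable haar (\<lambda>h. (cmod (w h))\<^sup>2)"
    "integrable haar (\<lambda>h. Re (u h * cnj (w h)))"
    using u w by (auto intro!: integrable_continuous continuous_intros simp del: times_complex.sel)
  ultimately show ?thesis by (simp add: energy_def del: times_complex.sel)
qed

end

section \<open>Spectral idempotents\<close>

text \<open>
  Log-convexity makes the ratios \<open>b(n+1) / b(n)\<close> increase; submultiplicativity bounds them by \<open>b(0)\<close>, so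
  they have a limit \<open>\<mu>\<close>, and \<open>b(n) / \<mu>\<^sup>n\<^sup>+\<^sup>1\<close> decreases.  The point is that this quotient stays away from zero.  If
  \<open>b(n) < r\<^sup>n\<^sup>+\<^sup>1\<close> for a ratio \<open>r = b(J+1) / b(J)\<close>, then submultiplicativity makes \<open>b\<close> geometrically
  smaller than \<open>r\<^sup>m\<^sup>+\<^sup>1\<close> along the indices \<open>m = k(n+1) + n\<close>, whereas increasing ratios keep \<open>b(m)\<close>
  above a fixed multiple of it.  Hence \<open>b(n) \<ge> r\<^sup>n\<^sup>+\<^sup>1\<close> for all such \<open>r\<close>, and \<open>b(n) \<ge> \<mu>\<^sup>n\<^sup>+\<^sup>1\<close>.
\<close>

lemma log_convex_submultiplicative_limit:
  fixes b :: "nat \<Rightarrow> real"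
  assumes pos: "b 0 > 0" "b 1 > 0"
    and nonneg: "\<And>n. b n \<ge> 0"
    and convex: "\<And>n. (b (Suc n))\<^sup>2 \<le> b n * b (Suc (Suc n))"
    and submult: "\<And>m n. b (Suc (m + n)) \<le> b m * b n"
  obtains \<mu> L where "\<mu> > 0" "L \<ge> 1" "(\<lambda>n. b n / \<mu> ^ Suc n) \<longlonglongrightarrow> L" "\<And>n. b n / \<mu> ^ Suc n \<ge> 1"
proof -
  have b_pos: "b n > 0 \<and> b (Suc n) > 0" for n
  proof (induction n)
    case (Suc n)
    then have "0 < b n * b (Suc (Suc n))" using convex[of n] by (meson less_le_trans zero_less_power)
    then show ?case using Suc by (simp add: zero_less_mult_iff)
  qed (use pos in auto)
  then have bp: "b n > 0" for n by blast
  define r where "r n = b (Suc n) / b n" for n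
  have r_pos: "r n > 0" for n by (simp add: r_def bp)
  have "r n \<le> r (Suc n)" for n
    using convex[of n] bp[of n] bp[of "Suc n"] by (simp add: r_def field_simps power2_eq_square)
  then have "incseq r" by (rule incseq_SucI)
  have r_le: "r n \<le> b 0" for n
    using submult[of 0 n] bp[of n] by (simp add: r_def field_simps)
  obtain \<mu> where lim: "r \<longlonglongrightarrow> \<mu>" and le: "\<And>n. r n \<le> \<mu>"
    using incseq_convergent[OF \<open>incseq r\<close>, of "b 0"] r_le by blast
  have "\<mu> > 0" using r_pos[of 0] le[of 0] by linarith
  have ge1: "b n / \<mu> ^ Suc n \<ge> 1" for n
  proof -
    have "b n \<ge> r J ^ Suc n" for J
    proof (rule ccontr)
      assume "\<not> b n \<ge> r J ^ Suc n"
      define q where "q = b n / r J ^ Suc n"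
      have q: "0 < q" "q < 1"
        using \<open>\<not> b n \<ge> r J ^ Suc n\<close> bp[of n] r_pos[of J] by (auto simp: q_def field_simps)
      have lower: "b (J + i) \<ge> b J * r J ^ i" for i
      proof (induction i)
        case (Suc i)
        have "b J * r J ^ Suc i \<le> b (J + i) * r J" using Suc r_pos[of J] by (simp add: mult.commute mult_left_mono)
        also have "\<dots> \<le> b (J + i) * r (J + i)"
          using incseqD[OF \<open>incseq r\<close>, of J "J + i"] bp[of "J + i"] by (intro mult_left_mono) auto
        also have "\<dots> = b (J + Suc i)" using bp[of "J + i"] by (simp add: r_def)
        finally show ?case .
      qed simp
      \<comment> \<open>With \<open>A(n+1) = b(n)\<close> this is \<open>A((n+1)(k+1)) \<le> A(n+1)\<^sup>k\<^sup>+\<^sup>1\<close>.\<close>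
      have upper: "b (k * Suc n + n) \<le> b n ^ Suc k" for k
      proof (induction k)
        case (Suc k)
        have "b (Suc k * Suc n + n) = b (Suc (n + (k * Suc n + n)))" by (simp add: algebra_simps)
        also have "\<dots> \<le> b n * b (k * Suc n + n)" by (rule submult)
        also have "\<dots> \<le> b n * b n ^ Suc k" using Suc bp[of n] by (intro mult_left_mono) auto
        finally show ?case by simp
      qed simp
      have "(b J / r J ^ Suc J) \<le> q ^ Suc k" if "k \<ge> J" for k
      proof -
        define i where "i = k * Suc n + n - J"
        have "k * Suc n \<ge> k" by simp
        then have i: "k * Suc n + n = J + i" using that unfolding i_def by linarith
        have "b J * r J ^ i \<le> b n ^ Suc k" using lower[of i] upper[of k] i by simp
        moreover have "(r J ^ Suc n) ^ Suc k = r J ^ Suc (J + i)"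
          unfolding power_mult[symmetric] i[symmetric] by (simp add: algebra_simps)
        ultimately show ?thesis
          using r_pos[of J] by (simp add: q_def power_divide field_simps power_add)
      qed
      then have "\<forall>\<^sub>F k in sequentially. b J / r J ^ Suc J \<le> q ^ Suc k"
        by (auto simp: eventually_sequentially)
      moreover have "(\<lambda>k. q ^ Suc k) \<longlonglongrightarrow> 0"
        using q LIMSEQ_Suc[OF LIMSEQ_realpow_zero[of q]] by simp
      ultimately have "b J / r J ^ Suc J \<le> 0"
        by (intro tendsto_lowerbound[of _ 0 sequentially]) auto
      then show False using bp[of J] r_pos[of J] by (simp add: field_simps zero_less_mult_iff)
    qed
    then have "\<mu> ^ Suc n \<le> b n"
      by (intro LIMSEQ_le_const2[OF tendsto_power[OF lim]]) auto
    then show ?thesis using \<open>\<mu> > 0\<close> by simp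
  qed
  have dec: "b (Suc n) / \<mu> ^ Suc (Suc n) \<le> b n / \<mu> ^ Suc n" for n
  proof -
    have "b (Suc n) \<le> \<mu> * b n" using le[of n] bp[of n] by (simp add: r_def field_simps)
    then show ?thesis using \<open>\<mu> > 0\<close> by (simp add: field_simps)
  qed
  have "decseq (\<lambda>n. b n / \<mu> ^ Suc n)" by (rule decseq_SucI) (rule dec)
  from decseq_convergent[OF this, of 1] ge1 obtain L where L: "(\<lambda>n. b n / \<mu> ^ Suc n) \<longlonglongrightarrow> L" by blast
  have "L \<ge> 1" using ge1 by (intro LIMSEQ_le_const[OF L]) auto
  then show thesis using that \<open>\<mu> > 0\<close> L ge1 by blast
qed

context compact_ab_group
begin

lemma conv_tendsto:
  assumes u: "\<And>n. continuous_fun (u n)" and w: "continuous_fun w"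
    and lim: "uniform_limit UNIV u v sequentially"
  shows "(\<lambda>n. (u n \<star> w) g) \<longlonglongrightarrow> (v \<star> w) g"
proof (rule LIMSEQ_I)
  fix r :: real assume "r > 0"
  have v: "continuous_fun v"
    by (rule uniform_limit_theorem[OF _ lim]) (use u in auto)
  define K where "K = energy w + 1"
  have K: "K > 0" "energy w \<le> K" by (simp_all add: K_def add_pos_nonneg add.commute less_add_one le_less_trans[OF energy_nonneg])
  define \<epsilon> where "\<epsilon> = r / (2 * sqrt K)"
  have \<epsilon>: "\<epsilon> > 0" using \<open>r > 0\<close> K by (simp add: \<epsilon>_def)
  have "\<forall>\<^sub>F n in sequentially. \<forall>x\<in>UNIV. dist (u n x) (v x) < \<epsilon>"
    using uniform_limitD[OF lim \<epsilon>] .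
  then obtain N where N: "\<And>n x. n \<ge> N \<Longrightarrow> dist (u n x) (v x) < \<epsilon>"
    by (auto simp: eventually_sequentially)
  have "norm ((u n \<star> w) g - (v \<star> w) g) < r" if "n \<ge> N" for n
  proof -
    have cont: "continuous_fun (\<lambda>x. u n x - v x)" using u v by (intro continuous_intros)
    have "energy (\<lambda>x. u n x - v x) \<le> \<epsilon>\<^sup>2"
      using N[OF that] by (intro energy_bound[OF cont] power_mono) (auto simp: dist_norm intro: less_imp_le)
    moreover have "(u n \<star> w) g - (v \<star> w) g = ((\<lambda>x. u n x - v x) \<star> w) g"
      using fun_cong[OF conv_linear[OF u[of n] v w, of 1 "-1"], of g] by simp
    moreover have "energy (\<lambda>x. u n x - v x) * energy w \<le> \<epsilon>\<^sup>2 * K"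
      using calculation(1) K by (intro mult_mono) auto
    ultimately have "(norm ((u n \<star> w) g - (v \<star> w) g))\<^sup>2 \<le> \<epsilon>\<^sup>2 * K"
      using conv_bound[OF cont w, of g] by simp
    also have "\<dots> = (r / 2)\<^sup>2" using K by (simp add: \<epsilon>_def power_divide power_mult_distrib)
    finally have "norm ((u n \<star> w) g - (v \<star> w) g) \<le> r / 2"
      using \<open>r > 0\<close> by (simp add: power2_le_iff_abs_le)
    then show ?thesis using \<open>r > 0\<close> by linarith
  qed
  then show "\<exists>N. \<forall>n\<ge>N. norm ((u n \<star> w) g - (v \<star> w) g) < r" by blast
qed

text \<open>
  The exponent is shifted: \<open>conv_pow s n\<close> is the power \<open>s\<^sup>n\<^sup>+\<^sup>1\<close>, because the continuous
  functions have no unit for convolution unless \<open>G\<close> is finite.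
\<close>

primrec conv_pow :: "('a \<Rightarrow> complex) \<Rightarrow> nat \<Rightarrow> 'a \<Rightarrow> complex" where
  "conv_pow s 0 = s"
| "conv_pow s (Suc n) = s \<star> conv_pow s n"

lemma conv_pow_continuous: "continuous_fun s \<Longrightarrow> continuous_fun (conv_pow s n)"
  by (induction n) (auto intro: conv_continuous)

lemma conv_pow_add: "continuous_fun s \<Longrightarrow> conv_pow s m \<star> conv_pow s n = conv_pow s (Suc (m + n))"
  by (induction m) (auto simp: conv_assoc conv_pow_continuous)

lemma conv_pow_adjoint: "continuous_fun s \<Longrightarrow> adjoint_fun s = s \<Longrightarrow> adjoint_fun (conv_pow s n) = conv_pow s n"
  by (induction n) (auto simp: adjoint_conv conv_pow_continuous)

text \<open>
  These are the kernels of the orthogonal projections onto finite-dimensional translation-invariant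
  spaces of functions; the value at \<open>0\<close> is the dimension.
\<close>

definition idempotent_fun :: "('a \<Rightarrow> complex) \<Rightarrow> bool" where
  "idempotent_fun e \<longleftrightarrow> continuous_fun e \<and> adjoint_fun e = e \<and> e \<star> e = e \<and> (\<exists>x. e x \<noteq> 0)"

text \<open>
  In spectral terms \<open>\<mu>\<close> is the largest eigenvalue of convolution with \<open>q = s \<star> s\<close>, and \<open>e\<close> is the kernel
  of the projection onto its eigenspace, obtained as the limit of \<open>q\<^sup>n / \<mu>\<^sup>n\<close>.  With
  \<open>d(n) = \<parallel>s\<^sup>n\<^sup>+\<^sup>1\<parallel>\<^sup>2 / \<mu>\<^sup>n\<^sup>+\<^sup>1\<close> the squared distance of two of these functions is
  \<open>d(2m+1) + d(2n+1) - 2d(m+n+1)\<close>, which tends to zero because \<open>d\<close> converges; the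
  limit is not zero because \<open>d \<ge> 1\<close>.  The last conclusion passes an identity
  \<open>f\<close> for \<open>s\<close> on to \<open>e\<close>; it places \<open>e\<close> below a given idempotent.
\<close>

lemma spectral_idempotent:
  assumes s: "continuous_fun s" and herm: "adjoint_fun s = s" and nz: "s x0 \<noteq> 0"
  obtains e \<mu> where "\<mu> > 0" "idempotent_fun e" "s \<star> s \<star> e = (\<lambda>x. of_real \<mu> * e x)"
    "\<And>f. continuous_fun f \<Longrightarrow> s \<star> f = s \<Longrightarrow> e \<star> f = e"
proof -
  let ?S = "conv_pow s"
  define b where "b n = energy (?S n)" for n
  note contS = conv_pow_continuous[OF s]
  have S0: "?S (Suc (2 * n)) 0 = of_real (b n)" for n
    using conv_adjoint_at_0[of "?S n"] conv_pow_add[OF s, of n n]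
    by (simp add: conv_pow_adjoint[OF s herm] b_def mult_2)
  obtain \<mu> L where \<mu>: "\<mu> > 0" and L: "L \<ge> 1" and lim: "(\<lambda>n. b n / \<mu> ^ Suc n) \<longlonglongrightarrow> L"
    and ge1: "\<And>n. b n / \<mu> ^ Suc n \<ge> 1"
  proof (rule log_convex_submultiplicative_limit[of b])
    show b0: "b 0 > 0" using energy_pos[OF s nz] by (simp add: b_def)
    have "?S 1 0 \<noteq> 0" using S0[of 0] b0 by simp
    then show "b 1 > 0" unfolding b_def by (rule energy_pos[OF contS])
    show "b n \<ge> 0" for n by (simp add: b_def)
    show "(b (Suc n))\<^sup>2 \<le> b n * b (Suc (Suc n))" for n
    proof -
      have "?S (Suc (2 * Suc n)) = ?S n \<star> ?S (Suc (Suc n))"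
        using conv_pow_add[OF s, of n "Suc (Suc n)"] by (simp add: mult_2)
      then have "(cmod (of_real (b (Suc n))))\<^sup>2 \<le> b n * b (Suc (Suc n))"
        using conv_bound[OF contS contS, of n "Suc (Suc n)" 0] S0[of "Suc n"] by (simp add: b_def del: conv_pow.simps)
      then show ?thesis by simp
    qed
    show "b (Suc (m + n)) \<le> b m * b n" for m n
      unfolding b_def conv_pow_add[OF s, symmetric] by (intro energy_conv_le contS)
  qed blast
  define d where "d n = b n / \<mu> ^ Suc n" for n
  \<comment> \<open>\<open>E n = q\<^sup>n\<^sup>+\<^sup>1 / \<mu>\<^sup>n\<^sup>+\<^sup>1\<close> for \<open>q = s \<star> s\<close>, since \<open>?S (Suc (2 * n))\<close> is \<open>s\<close> to the power \<open>2n + 2\<close>.\<close>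
  define E where "E n = (\<lambda>x. of_real (1 / \<mu> ^ Suc n) * ?S (Suc (2 * n)) x)" for n
  have contE: "continuous_fun (E n)" for n unfolding E_def by (intro continuous_intros contS)
  have hermE: "adjoint_fun (E n) = E n" for n
    using conv_pow_adjoint[OF s herm, of "Suc (2 * n)"] by (simp add: E_def adjoint_fun_def fun_eq_iff)
  have EE: "E m \<star> E n = E (Suc (m + n))" for m n
  proof -
    have "E m \<star> E n = (\<lambda>x. of_real (1 / \<mu> ^ Suc m) * (?S (Suc (2 * m)) \<star> E n) x)"
      unfolding E_def by (rule conv_scale)
    also have "?S (Suc (2 * m)) \<star> E n = E n \<star> ?S (Suc (2 * m))"
      by (rule conv_commute[OF contS contE])
    also have "\<dots> = (\<lambda>x. of_real (1 / \<mu> ^ Suc n) * (?S (Suc (2 * n)) \<star> ?S (Suc (2 * m))) x)"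
      unfolding E_def by (rule conv_scale)
    also have "?S (Suc (2 * n)) \<star> ?S (Suc (2 * m)) = ?S (Suc (2 * Suc (m + n)))"
      unfolding conv_pow_add[OF s] by (rule arg_cong[of _ _ ?S]) simp
    finally show ?thesis by (simp add: E_def power_add fun_eq_iff)
  qed
  have inner: "Re ((E m \<star> adjoint_fun (E n)) 0) = d (Suc (m + n))" for m n
    unfolding hermE EE by (simp add: E_def S0 d_def del: conv_pow.simps mult_Suc_right power_Suc)
  have energyE: "energy (E n) = d (Suc (2 * n))" for n
    using inner[of n n] conv_adjoint_at_0[of "E n"] by (simp add: mult_2)
  have energy_diffE: "energy (\<lambda>x. E m x - E n x) = d (Suc (2 * m)) + d (Suc (2 * n)) - 2 * d (Suc (m + n))" for m n
    unfolding energy_diff[OF contE contE] inner energyE ..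
  have E_Suc: "E (Suc n) = (\<lambda>x. of_real (1 / \<mu>) * (E n \<star> ?S 1) x)" for n
  proof -
    have E0: "E 0 = (\<lambda>x. of_real (1 / \<mu>) * ?S 1 x)" by (simp add: E_def)
    have "E n \<star> E 0 = (\<lambda>x. of_real (1 / \<mu>) * (?S 1 \<star> E n) x)"
      unfolding conv_commute[OF contE[of n] contE[of 0]] by (simp only: E0 conv_scale)
    then show ?thesis using EE[of n 0] conv_commute[OF contE[of n] contS[of 1]] by simp
  qed
  define K where "K = energy (?S 1) / \<mu>\<^sup>2 + 1"
  have K: "K > 0" "energy (?S 1) / \<mu>\<^sup>2 \<le> K" by (simp_all add: K_def add_nonneg_pos del: conv_pow.simps One_nat_def)
  \<comment> \<open>One more convolution with \<open>q / \<mu>\<close> turns \<open>L\<^sup>2\<close> Cauchy into uniformly Cauchy.\<close>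
  have step: "(cmod (E (Suc m) x - E (Suc n) x))\<^sup>2 \<le> K * energy (\<lambda>x. E m x - E n x)" for m n x
  proof -
    have cont: "continuous_fun (\<lambda>x. E m x - E n x)" by (intro continuous_intros contE)
    have "E (Suc m) x - E (Suc n) x = of_real (1 / \<mu>) * ((\<lambda>x. E m x - E n x) \<star> ?S 1) x"
      using fun_cong[OF conv_linear[OF contE[of m] contE[of n] contS[of 1], of 1 "-1"], of x]
      unfolding E_Suc by (simp add: right_diff_distrib del: conv_pow.simps One_nat_def)
    then have "(cmod (E (Suc m) x - E (Suc n) x))\<^sup>2 = (1 / \<mu>\<^sup>2) * (cmod (((\<lambda>x. E m x - E n x) \<star> ?S 1) x))\<^sup>2"
      using \<mu> by (simp add: norm_mult norm_divide power_mult_distrib power_divide del: conv_pow.simps One_nat_def)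
    also have "\<dots> \<le> (1 / \<mu>\<^sup>2) * (energy (\<lambda>x. E m x - E n x) * energy (?S 1))"
      by (intro mult_left_mono conv_bound cont contS) simp
    also have "\<dots> = (energy (?S 1) / \<mu>\<^sup>2) * energy (\<lambda>x. E m x - E n x)" by simp
    also have "\<dots> \<le> K * energy (\<lambda>x. E m x - E n x)" by (intro mult_right_mono K) simp
    finally show ?thesis .
  qed
  have lim_d: "d \<longlonglongrightarrow> L" using lim by (simp add: d_def[abs_def])
  have "uniformly_Cauchy_on UNIV (\<lambda>n. E (Suc n))"
  proof (rule uniformly_Cauchy_onI)
    fix r :: real assume r: "r > 0"
    define \<epsilon> where "\<epsilon> = r\<^sup>2 / (8 * K)"
    have \<epsilon>: "\<epsilon> > 0" using r K by (simp add: \<epsilon>_def)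
    obtain N where N: "\<And>n. n \<ge> N \<Longrightarrow> \<bar>d n - L\<bar> < \<epsilon>"
      using LIMSEQ_D[OF lim_d \<epsilon>] by auto
    show "\<exists>M. \<forall>x\<in>UNIV. \<forall>m\<ge>M. \<forall>n\<ge>M. dist (E (Suc m) x) (E (Suc n) x) < r"
    proof (intro exI[of _ N] ballI allI impI)
      fix x m n assume mn: "N \<le> m" "N \<le> n"
      have "energy (\<lambda>x. E m x - E n x) < 4 * \<epsilon>"
        using N[of "Suc (2 * m)"] N[of "Suc (2 * n)"] N[of "Suc (m + n)"] mn
        unfolding energy_diffE by linarith
      then have "K * energy (\<lambda>x. E m x - E n x) < K * (4 * \<epsilon>)" using K by simp
      also have "K * (4 * \<epsilon>) = r\<^sup>2 / 2" using K by (simp add: \<epsilon>_def)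
      finally have "(cmod (E (Suc m) x - E (Suc n) x))\<^sup>2 < r\<^sup>2"
        using step[of m x n] r by (smt (verit) half_gt_zero_iff zero_less_power field_sum_of_halves)
      then show "dist (E (Suc m) x) (E (Suc n) x) < r"
        using r unfolding dist_norm by (meson power_less_imp_less_base less_imp_le)
    qed
  qed
  then obtain e where "uniform_limit UNIV (\<lambda>n. E (Suc n)) e sequentially"
    using uniformly_convergent_eq_Cauchy unfolding uniformly_convergent_on_def by metis
  then have unif: "uniform_limit UNIV E e sequentially"
    unfolding uniform_limit_iff by (subst (asm) eventually_sequentially_Suc)
  have conte: "continuous_fun e"
    by (rule uniform_limit_theorem[OF _ unif]) (use contE in auto)
  have pointw: "(\<lambda>n. E n x) \<longlonglongrightarrow> e x" for x
    using tendsto_uniform_limitI[OF unif] by simp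
  have herme: "adjoint_fun e = e"
  proof
    fix x
    have "(\<lambda>n. cnj (E n (- x))) \<longlonglongrightarrow> cnj (e (- x))"
      by (intro tendsto_intros pointw)
    moreover have "cnj (E n (- x)) = E n x" for n
      using hermE[of n] by (simp add: adjoint_fun_def fun_eq_iff)
    ultimately show "adjoint_fun e x = e x"
      using pointw[of x] LIMSEQ_unique by (simp add: adjoint_fun_def)
  qed
  \<comment> \<open>Let \<open>n\<close> tend to infinity in \<open>E n \<star> E m = E (n + m + 1)\<close>.\<close>
  have eE: "e \<star> E m = e" for m
  proof
    fix x
    have "(\<lambda>n. (E n \<star> E m) x) \<longlonglongrightarrow> (e \<star> E m) x" by (rule conv_tendsto[OF contE contE unif])
    moreover have "(\<lambda>n. (E n \<star> E m) x) \<longlonglongrightarrow> e x"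
      unfolding EE using LIMSEQ_ignore_initial_segment[OF pointw[of x], of "Suc m"] by simp
    ultimately show "(e \<star> E m) x = e x" by (rule LIMSEQ_unique)
  qed
  have ee: "e \<star> e = e"
  proof
    fix x
    have "(\<lambda>n. (E n \<star> e) x) \<longlonglongrightarrow> (e \<star> e) x" by (rule conv_tendsto[OF contE conte unif])
    moreover have "E n \<star> e = e" for n using eE conv_commute[OF contE conte] by simp
    ultimately show "(e \<star> e) x = e x" by (simp add: LIMSEQ_const_iff)
  qed
  have "\<exists>x. e x \<noteq> 0"
  proof (rule ccontr)
    assume "\<nexists>x. e x \<noteq> 0"
    then have e0: "e = (\<lambda>x. 0)" by auto
    have "\<forall>\<^sub>F n in sequentially. \<forall>x\<in>UNIV. dist (E n x) (e x) < 1 / 2"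
      by (rule uniform_limitD[OF unif]) simp
    then obtain n where n: "\<And>x. cmod (E n x) < 1 / 2" by (auto simp: eventually_sequentially e0)
    have "energy (E n) \<le> (1 / 2)\<^sup>2"
      by (rule energy_bound[OF contE]) (use n in \<open>auto intro!: power_mono less_imp_le simp del: power_divide\<close>)
    moreover have "energy (E n) \<ge> 1" unfolding energyE d_def by (rule ge1)
    ultimately show False by (simp add: power2_eq_square)
  qed
  then have idem: "idempotent_fun e" using conte herme ee by (simp add: idempotent_fun_def)
  have "s \<star> s \<star> e = (\<lambda>x. of_real \<mu> * e x)"
  proof -
    have E0: "E 0 = (\<lambda>x. of_real (1 / \<mu>) * (s \<star> s) x)" by (simp add: E_def)
    have "E 0 \<star> e = e" using eE conv_commute[OF contE conte] by simp
    then have "(\<lambda>x. of_real (1 / \<mu>) * (s \<star> s \<star> e) x) = e" unfolding E0 conv_scale .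
    then have "of_real (1 / \<mu>) * (s \<star> s \<star> e) x = e x" for x by (rule fun_cong)
    then have "of_real \<mu> * (of_real (1 / \<mu>) * (s \<star> s \<star> e) x) = of_real \<mu> * e x" for x by simp
    then show ?thesis using \<mu> by (auto simp: field_simps)
  qed
  moreover have "e \<star> f = e" if f: "continuous_fun f" and sf: "s \<star> f = s" for f
  proof
    fix x
    have Sf: "?S n \<star> f = ?S n" for n
    proof (cases n)
      case (Suc k)
      then have "?S n = ?S k \<star> s" by (simp add: conv_commute[OF s contS])
      then show ?thesis by (simp add: conv_assoc[OF contS s f] sf)
    qed (simp add: sf)
    have "E n \<star> f = E n" for n unfolding E_def conv_scale Sf ..
    with conv_tendsto[OF contE f unif, of x] have "(\<lambda>n. E n x) \<longlonglongrightarrow> (e \<star> f) x" by simp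
    then show "(e \<star> f) x = e x" using pointw LIMSEQ_unique by blast
  qed
  ultimately show thesis using that \<mu> idem by blast
qed

end

section \<open>Minimal idempotents are characters\<close>

context compact_ab_group
begin

lemma idempotent_at_0: "idempotent_fun e \<Longrightarrow> e 0 = of_real (energy e)"
  using conv_adjoint_at_0[of e] by (simp add: idempotent_fun_def)

lemma idempotent_bound: "idempotent_fun e \<Longrightarrow> cmod (e x) \<le> energy e"
  using conv_bound[of e e x]
  by (simp add: idempotent_fun_def power2_eq_square[symmetric] power2_le_iff_abs_le)

text \<open>
  \<open>\<bar>e\<bar> \<le> \<parallel>e\<parallel>\<^sup>2\<close> holds pointwise because \<open>e = e \<star> e\<close>; integrating the square over a space of mass one
  gives \<open>\<parallel>e\<parallel>\<^sup>2 \<le> \<parallel>e\<parallel>\<^sup>4\<close>.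
\<close>

lemma idempotent_energy_ge_1:
  assumes "idempotent_fun e" shows "energy e \<ge> 1"
proof -
  have "energy e > 0" using assms energy_pos by (auto simp: idempotent_fun_def)
  moreover have "energy e \<le> (energy e)\<^sup>2"
    using assms idempotent_bound[OF assms] 
    by (intro energy_bound power_mono) (auto simp: idempotent_fun_def)
  ultimately show ?thesis by (simp add: power2_eq_square)
qed

definition minimal_idempotent :: "('a \<Rightarrow> complex) \<Rightarrow> bool" where
  "minimal_idempotent e \<longleftrightarrow> idempotent_fun e \<and>
     (\<forall>f. idempotent_fun f \<longrightarrow> f \<star> e = f \<longrightarrow> f = e)"

text \<open>
  A proper sub-idempotent \<open>f\<close> of \<open>e\<close> leaves the idempotent \<open>e - f\<close>, whose value at \<open>0\<close> is at least \<open>1\<close>.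
  So \<open>e(0) = \<parallel>e\<parallel>\<^sup>2\<close> drops by at least \<open>1\<close> with every step down.
\<close>

lemma minimal_idempotent_exists:
  assumes "idempotent_fun e"
  obtains f where "minimal_idempotent f" "f \<star> e = f"
  using assms
proof (induction "nat \<lfloor>energy e\<rfloor>" arbitrary: e thesis rule: less_induct)
  case less
  show ?case
  proof (cases "minimal_idempotent e")
    case True
    then show ?thesis using less.prems by (auto simp: idempotent_fun_def)
  next
    case False
    then obtain f where f: "idempotent_fun f" "f \<star> e = f" "f \<noteq> e"
      using less.prems(2) by (auto simp: minimal_idempotent_def)
    have e: "continuous_fun e" "adjoint_fun e = e" "e \<star> e = e"
      and f': "continuous_fun f" "adjoint_fun f = f" "f \<star> f = f"
      using less.prems(2) f(1) by (auto simp: idempotent_fun_def)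
    define r where "r = (\<lambda>x. e x - f x)"
    have ef: "e \<star> f = f" using f(2) conv_commute[OF e(1) f'(1)] by simp
    have r_cont: "continuous_fun r" unfolding r_def using e f' by (intro continuous_intros)
    have lin: "r \<star> w = (\<lambda>x. (e \<star> w) x - (f \<star> w) x)" if "continuous_fun w" for w
      using conv_linear[OF e(1) f'(1) that, of 1 "-1"] by (simp add: r_def)
    have "r \<star> r = r"
      using lin[OF r_cont] lin[OF e(1)] lin[OF f'(1)]
        conv_commute[OF e(1) r_cont] conv_commute[OF f'(1) r_cont] e(3) f'(3) f(2) ef
      by (simp add: r_def)
    moreover have "adjoint_fun r = r"
      using e(2) f'(2) by (simp add: r_def adjoint_fun_def fun_eq_iff)
    moreover have "\<exists>x. r x \<noteq> 0" using f(3) by (auto simp: r_def)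
    ultimately have r: "idempotent_fun r" using r_cont by (simp add: idempotent_fun_def)
    have "complex_of_real (energy r) = of_real (energy e - energy f)"
      using idempotent_at_0[OF r] idempotent_at_0[OF f(1)] idempotent_at_0[OF less.prems(2)]
      by (simp add: r_def)
    then have "energy f = energy e - energy r" by (simp only: of_real_eq_iff)
    then have "energy f + 1 \<le> energy e" using idempotent_energy_ge_1[OF r] by simp
    then have "nat \<lfloor>energy f\<rfloor> < nat \<lfloor>energy e\<rfloor>"
      using idempotent_energy_ge_1[OF f(1)] by linarith
    from less.hyps[OF this _ f(1)] obtain h where h: "minimal_idempotent h" "h \<star> f = h" by blast
    have "h \<star> e = h"
      using h f(2) conv_assoc[of h f e] e f' by (metis minimal_idempotent_def idempotent_fun_def)
    then show ?thesis using h(1) less.prems(1) by blast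
  qed
qed

text \<open>
  Minimality forces the spectral idempotent of every Hermitian \<open>r \<noteq> 0\<close> below \<open>e\<close> to be \<open>e\<close>, so
  \<open>r \<star> r = \<mu> e\<close> with \<open>\<mu> > 0\<close>, and such an \<open>r\<close> is invertible.  Then \<open>0 = q \<star> q - t\<^sup>2 e = (q - t e) \<star> (q + t e)\<close>
  with \<open>t = \<surd>\<mu>\<close> shows that one of the two factors vanishes.
\<close>

lemma hermitian_multiple_of_minimal_idempotent:
  assumes min: "minimal_idempotent e" and q: "continuous_fun q" "adjoint_fun q = q" "q \<star> e = q"
  obtains t :: real where "q = (\<lambda>x. of_real t * e x)"
proof -
  have e: "continuous_fun e" "adjoint_fun e = e" "e \<star> e = e"
    using min by (auto simp: minimal_idempotent_def idempotent_fun_def)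
  have square: "\<exists>\<mu>>0. r \<star> r = (\<lambda>x. of_real \<mu> * e x)"
    if r: "continuous_fun r" "adjoint_fun r = r" "r \<star> e = r" "r x0 \<noteq> 0" for r x0
  proof -
    obtain f \<mu> where f: "\<mu> > 0" "idempotent_fun f" "r \<star> r \<star> f = (\<lambda>x. of_real \<mu> * f x)"
      "\<And>g. continuous_fun g \<Longrightarrow> r \<star> g = r \<Longrightarrow> f \<star> g = f"
      using spectral_idempotent[OF r(1,2,4)] by blast
    have "f \<star> e = f" by (rule f(4)[OF e(1) r(3)])
    then have "f = e" using min f(2) by (simp add: minimal_idempotent_def)
    moreover have "r \<star> r \<star> e = r \<star> r" by (simp add: conv_assoc r e(1))
    ultimately show ?thesis using f(1,3) by auto
  qed
  show thesis
  proof (cases "\<exists>x. q x \<noteq> 0")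
    case False
    then show ?thesis by (intro that[of 0]) auto
  next
    case True
    then obtain \<mu> where \<mu>: "\<mu> > 0" "q \<star> q = (\<lambda>x. of_real \<mu> * e x)" using square[OF q] by blast
    define t where "t = sqrt \<mu>"
    have t: "of_real \<mu> = complex_of_real t * of_real t"
      using \<mu>(1) by (simp add: t_def flip: of_real_mult)
    define r where "r = (\<lambda>x. q x - of_real t * e x)"
    define p where "p = (\<lambda>x. q x + of_real t * e x)"
    have r_cont: "continuous_fun r" and p_cont: "continuous_fun p"
      unfolding r_def p_def using q(1) e(1) by (intro continuous_intros; simp)+
    have lin: "r \<star> w = (\<lambda>x. (q \<star> w) x - of_real t * (e \<star> w) x)"
      "p \<star> w = (\<lambda>x. (q \<star> w) x + of_real t * (e \<star> w) x)" if "continuous_fun w" for w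
      using conv_linear[OF q(1) e(1) that, of 1 "- of_real t"] conv_linear[OF q(1) e(1) that, of 1 "of_real t"]
      by (simp_all add: r_def p_def)
    have eq: "e \<star> q = q" using q(3) conv_commute[OF e(1) q(1)] by simp
    have re: "r \<star> e = r" and pe: "p \<star> e = p"
      using lin[OF e(1)] q(3) e(3) by (simp_all add: r_def p_def)
    have "p \<star> q = (\<lambda>x. of_real t * p x)"
      using lin(2)[OF q(1)] \<mu>(2) eq by (simp add: p_def t algebra_simps)
    then have pq: "q \<star> p = (\<lambda>x. of_real t * p x)" using conv_commute[OF q(1) p_cont] by simp
    have ep: "e \<star> p = p" using pe conv_commute[OF e(1) p_cont] by simp
    have rp: "r \<star> p = (\<lambda>x. 0)" using lin(1)[OF p_cont] pq ep by simp
    show ?thesis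
    proof (cases "\<exists>x. r x \<noteq> 0")
      case False
      then have "q = (\<lambda>x. of_real t * e x)" by (auto simp: r_def)
      then show ?thesis by (rule that)
    next
      case True
      have "adjoint_fun r = r"
        using q(2) e(2) by (simp add: r_def adjoint_fun_def fun_eq_iff)
      then obtain \<nu> where \<nu>: "\<nu> > 0" "r \<star> r = (\<lambda>x. of_real \<nu> * e x)"
        using square[OF r_cont _ re] True by blast
      have "r \<star> r \<star> p = r \<star> (r \<star> p)" by (rule conv_assoc[OF r_cont r_cont p_cont])
      also have "\<dots> = (\<lambda>x. 0)" by (simp add: rp convolution_def fun_eq_iff)
      finally have "(\<lambda>x. of_real \<nu> * p x) = (\<lambda>x. 0)" by (simp add: \<nu>(2) conv_scale ep)
      then have "p x = 0" for x using \<nu>(1) by (simp add: fun_eq_iff)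
      then have "q = (\<lambda>x. of_real (- t) * e x)" by (simp add: p_def fun_eq_iff add_eq_0_iff)
      then show ?thesis by (rule that)
    qed
  qed
qed

lemma multiple_of_minimal_idempotent:
  assumes min: "minimal_idempotent e" and u: "continuous_fun u" "u \<star> e = u"
  obtains c where "u = (\<lambda>x. c * e x)"
proof -
  have e: "continuous_fun e" "adjoint_fun e = e" "e \<star> e = e"
    using min by (auto simp: minimal_idempotent_def idempotent_fun_def)
  define v where "v = adjoint_fun u"
  have v: "continuous_fun v" "v \<star> e = v"
    using adjoint_continuous[OF u(1)] adjoint_conv[OF u(1) e(1)] u(2) e(2) by (simp_all add: v_def)
  define a where "a = (\<lambda>x. u x + v x)"
  \<comment> \<open>\<open>a\<close> and \<open>b\<close> are Hermitian, and \<open>2u = a - \<i> b\<close>.\<close>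
  define b where "b = (\<lambda>x. \<i> * u x + (- \<i>) * v x)"
  have "a = (\<lambda>x. 1 * u x + 1 * v x)" by (simp add: a_def)
  then have ae: "a \<star> e = a" using conv_linear[OF u(1) v(1) e(1), of 1 1] u(2) v(2) by simp
  have be: "b \<star> e = b" using conv_linear[OF u(1) v(1) e(1), of \<i> "- \<i>"] u(2) v(2) by (simp add: b_def)
  have "continuous_fun a" "continuous_fun b"
    unfolding a_def b_def using u(1) v(1) by (intro continuous_intros; simp)+
  moreover have "adjoint_fun a = a" "adjoint_fun b = b"
    by (simp_all add: a_def b_def v_def adjoint_fun_def fun_eq_iff)
  ultimately obtain s t where st: "a = (\<lambda>x. of_real s * e x)" "b = (\<lambda>x. of_real t * e x)"
    using hermitian_multiple_of_minimal_idempotent[OF min _ _ ae]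
      hermitian_multiple_of_minimal_idempotent[OF min _ _ be] by metis
  have "u x = ((of_real s - \<i> * of_real t) / 2) * e x" for x
  proof -
    have "2 * u x = a x - \<i> * b x" by (simp add: a_def b_def algebra_simps)
    then show ?thesis unfolding st by (simp add: algebra_simps)
  qed
  then show thesis using that by blast
qed

lemma
  fixes \<gamma> :: "'a \<Rightarrow> complex"
  assumes "\<gamma> \<in> dual_group"
  shows dual_group_continuous: "continuous_fun \<gamma>"
    and dual_group_norm: "cmod (\<gamma> x) = 1"
    and dual_group_add: "\<gamma> (x + y) = \<gamma> x * \<gamma> y"
  using assms by (auto simp: dual_group_def)

lemma dual_group_at_0:
  fixes \<gamma> :: "'a \<Rightarrow> complex"
  assumes "\<gamma> \<in> dual_group" shows "\<gamma> 0 = 1"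
  using dual_group_add[OF assms, of 0 0] dual_group_norm[OF assms, of 0] by auto

lemma dual_group_minus:
  fixes \<gamma> :: "'a \<Rightarrow> complex"
  assumes "\<gamma> \<in> dual_group" shows "\<gamma> (- x) = cnj (\<gamma> x)"
proof -
  have "\<gamma> x * \<gamma> (- x) = 1"
    using dual_group_add[OF assms, of x "- x"] dual_group_at_0[OF assms] by simp
  moreover have "\<gamma> x * cnj (\<gamma> x) = 1"
    using dual_group_norm[OF assms, of x] by (simp add: complex_norm_square[symmetric])
  moreover have "\<gamma> x \<noteq> 0" using dual_group_norm[OF assms, of x] by auto
  ultimately show ?thesis by (metis mult_left_cancel)
qed

text \<open>
  A translate of \<open>e\<close> is still fixed by convolution with \<open>e\<close>, hence a multiple of \<open>e\<close>.  So \<open>e / e(0)\<close> is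
  multiplicative; being bounded by \<open>1\<close> together with its inverse, it is a character, and \<open>e = e \<star> e\<close>
  forces \<open>e(0) = 1\<close>.
\<close>

lemma minimal_idempotent_character:
  assumes min: "minimal_idempotent e"
  shows "e \<in> dual_group"
proof -
  have idem: "idempotent_fun e" using min by (simp add: minimal_idempotent_def)
  then have e: "continuous_fun e" "adjoint_fun e = e" "e \<star> e = e" by (auto simp: idempotent_fun_def)
  have pos: "energy e \<ge> 1" by (rule idempotent_energy_ge_1[OF idem])
  define \<xi> where "\<xi> = (\<lambda>x. e x / e 0)"
  have e0: "e 0 = of_real (energy e)" "e 0 \<noteq> 0"
    using idempotent_at_0[OF idem] pos by auto
  have mult: "e (x + y) * e 0 = e x * e y" for x y
  proof -
    have "(\<lambda>x. e (x + y)) \<star> e = (\<lambda>x. e (x + y))"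
    proof
      fix x
      have meas: "(\<lambda>h. e h * e (x + y - h)) \<in> borel_measurable borel"
        using e(1) by (intro borel_measurable_continuous_onI continuous_intros continuous_comp_diff)
      have "((\<lambda>x. e (x + y)) \<star> e) x = (LINT h|haar. e (h + y) * e (x + y - (h + y)))"
        by (simp add: convolution_def algebra_simps)
      also have "\<dots> = (e \<star> e) (x + y)"
        using integral_translate[OF meas, of y] by (simp add: convolution_def)
      finally show "((\<lambda>x. e (x + y)) \<star> e) x = e (x + y)" by (simp add: e(3))
    qed
    then obtain c where c: "(\<lambda>x. e (x + y)) = (\<lambda>x. c * e x)"
      using multiple_of_minimal_idempotent[OF min continuous_comp_plus[OF e(1)]] by blast
    have "e y = c * e 0" using fun_cong[OF c, of 0] by simp
    then show ?thesis using fun_cong[OF c, of x] by simp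
  qed
  have \<xi>_add: "\<xi> (x + y) = \<xi> x * \<xi> y" for x y
    using mult[of x y] e0(2) by (simp add: \<xi>_def field_simps)
  have \<xi>_le: "cmod (\<xi> x) \<le> 1" for x
    using idempotent_bound[OF idem, of x] pos by (simp add: \<xi>_def norm_divide e0(1))
  have "cmod (\<xi> x) = 1" for x
  proof -
    have "\<xi> x * \<xi> (- x) = 1" using \<xi>_add[of x "- x"] e0(2) by (simp add: \<xi>_def)
    then have "cmod (\<xi> x) * cmod (\<xi> (- x)) = 1" by (metis norm_mult norm_one)
    moreover have "cmod (\<xi> x) * cmod (\<xi> (- x)) \<le> cmod (\<xi> x) * 1"
      by (intro mult_left_mono \<xi>_le) simp
    ultimately show ?thesis using \<xi>_le[of x] by linarith
  qed
  moreover have "continuous_fun \<xi>" unfolding \<xi>_def using e0(2) e(1) by (intro continuous_intros) auto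
  ultimately have \<xi>: "\<xi> \<in> dual_group" using \<xi>_add by (simp add: dual_group_def)
  have "energy e = (energy e)\<^sup>2"
  proof -
    have "energy e = (LINT x|haar. (energy e)\<^sup>2 * (cmod (\<xi> x))\<^sup>2)"
      unfolding energy_def[of e]
      using pos by (intro Bochner_Integration.integral_cong) (simp_all add: \<xi>_def e0(1) norm_divide power_divide energy_def)
    also have "\<dots> = (energy e)\<^sup>2" by (simp add: dual_group_norm[OF \<xi>])
    finally show ?thesis .
  qed
  then have "energy e = 1" using pos by (simp add: power2_eq_square)
  then have "\<xi> = e" using e0(1) by (simp add: \<xi>_def)
  with \<xi> show ?thesis by simp
qed

definition fourier_coeff :: "('a \<Rightarrow> complex) \<Rightarrow> ('a \<Rightarrow> complex) \<Rightarrow> complex" where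
  "fourier_coeff f \<gamma> = (LINT x|haar. f x * cnj (\<gamma> x))"

lemma conv_character:
  assumes "\<gamma> \<in> dual_group"
  shows "f \<star> \<gamma> = (\<lambda>x. fourier_coeff f \<gamma> * \<gamma> x)"
proof
  fix g
  have "\<gamma> (g - h) = cnj (\<gamma> h) * \<gamma> g" for h
    using dual_group_add[OF assms, of g "- h"] dual_group_minus[OF assms, of h] by (simp add: mult.commute)
  then show "(f \<star> \<gamma>) g = fourier_coeff f \<gamma> * \<gamma> g"
    by (simp add: convolution_def fourier_coeff_def mult.assoc[symmetric])
qed

text \<open>
  If \<open>f \<noteq> 0\<close>, then \<open>s = f \<star> f\<^sup>*\<close> is Hermitian and non-zero, and below its spectral idempotent there is a
  character \<open>\<xi>\<close>.  Then \<open>s \<star> s \<star> \<xi> = \<mu> \<xi> \<noteq> 0\<close>, although \<open>f \<star> \<xi>\<close> is the multiple of \<open>\<xi>\<close> by the Fourier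
  coefficient of \<open>f\<close>.
\<close>

theorem fourier_uniqueness:
  assumes f: "continuous_fun f" and zero: "\<And>\<gamma>. \<gamma> \<in> dual_group \<Longrightarrow> fourier_coeff f \<gamma> = 0"
  shows "f x = 0"
proof (rule ccontr)
  assume "f x \<noteq> 0"
  define s where "s = f \<star> adjoint_fun f"
  have f': "continuous_fun (adjoint_fun f)" by (rule adjoint_continuous[OF f])
  have s: "continuous_fun s" unfolding s_def by (rule conv_continuous[OF f f'])
  have "adjoint_fun s = s"
    by (simp add: s_def adjoint_conv[OF f f'] conv_commute[OF f' f])
  moreover have "s 0 \<noteq> 0"
    using conv_adjoint_at_0[of f] energy_pos[OF f \<open>f x \<noteq> 0\<close>] by (simp add: s_def)
  ultimately obtain e \<mu> where e: "\<mu> > 0" "idempotent_fun e" "s \<star> s \<star> e = (\<lambda>x. of_real \<mu> * e x)"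
    using spectral_idempotent[OF s] by metis
  obtain \<xi> where min: "minimal_idempotent \<xi>" and \<xi>e: "\<xi> \<star> e = \<xi>"
    using minimal_idempotent_exists[OF e(2)] .
  have \<xi>: "\<xi> \<in> dual_group" by (rule minimal_idempotent_character[OF min])
  note cont = s f f' dual_group_continuous[OF \<xi>] conv_continuous
  have ce: "continuous_fun e" using e(2) by (simp add: idempotent_fun_def)
  have e\<xi>: "e \<star> \<xi> = \<xi>" using \<xi>e conv_commute[OF ce cont(4)] by simp
  have "(\<lambda>x. of_real \<mu> * \<xi> x) = s \<star> s \<star> e \<star> \<xi>" by (simp add: e(3) conv_scale e\<xi>)
  also have "\<dots> = s \<star> (s \<star> \<xi>)" by (simp add: conv_assoc cont ce e\<xi>)
  also have "s \<star> \<xi> = adjoint_fun f \<star> (f \<star> \<xi>)"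
    unfolding s_def conv_commute[OF f f'] by (simp add: conv_assoc cont)
  also have "f \<star> \<xi> = (\<lambda>x. 0)" by (simp add: conv_character[OF \<xi>] zero[OF \<xi>])
  also have "s \<star> (adjoint_fun f \<star> (\<lambda>x. 0)) = (\<lambda>x. 0)"
    by (simp add: convolution_def fun_eq_iff)
  finally have "of_real \<mu> * \<xi> 0 = 0" by (rule fun_cong)
  then show False using e(1) dual_group_at_0[OF \<xi>] by simp
qed

end

section \<open>Fourier series with summable coefficients\<close>

context compact_ab_group
begin

lemma integral_character:
  fixes \<gamma> :: "'a \<Rightarrow> complex"
  assumes \<gamma>: "\<gamma> \<in> dual_group"
  shows "(LINT x|haar. \<gamma> x) = (if \<gamma> = trivial_character then 1 else 0)"
proof (cases "\<gamma> = trivial_character")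
  case False
  then obtain g where g: "\<gamma> g \<noteq> 1" by auto
  have "(LINT x|haar. \<gamma> x) = (LINT x|haar. \<gamma> (x + g))"
    using dual_group_continuous[OF \<gamma>] by (intro integral_translate[symmetric] borel_measurable_continuous_onI)
  also have "\<dots> = (LINT x|haar. \<gamma> x) * \<gamma> g" by (simp add: dual_group_add[OF \<gamma>])
  finally show ?thesis using g False by (simp add: mult_cancel_left2)
qed simp

lemma dual_group_mult_cnj:
  fixes \<gamma> \<gamma>' :: "'a \<Rightarrow> complex"
  assumes "\<gamma> \<in> dual_group" "\<gamma>' \<in> dual_group"
  shows "(\<lambda>x. \<gamma> x * cnj (\<gamma>' x)) \<in> dual_group"
  using assms by (auto simp: dual_group_def norm_mult intro!: continuous_intros)

lemma trivial_in_dual_group: "trivial_character \<in> (dual_group :: ('a \<Rightarrow> complex) set)"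
  by (simp add: dual_group_def)

lemma dual_group_cnj:
  fixes \<gamma> :: "'a \<Rightarrow> complex"
  assumes "\<gamma> \<in> dual_group" shows "(\<lambda>x. cnj (\<gamma> x)) \<in> dual_group"
  using dual_group_mult_cnj[OF trivial_in_dual_group assms] by simp

lemma fourier_coeff_character:
  fixes \<gamma> \<gamma>' :: "'a \<Rightarrow> complex"
  assumes \<gamma>: "\<gamma> \<in> dual_group" and \<gamma>': "\<gamma>' \<in> dual_group"
  shows "fourier_coeff \<gamma> \<gamma>' = (if \<gamma> = \<gamma>' then 1 else 0)"
proof -
  have "(\<lambda>x. \<gamma> x * cnj (\<gamma>' x)) = trivial_character \<longleftrightarrow> \<gamma> = \<gamma>'"
  proof
    assume *: "(\<lambda>x. \<gamma> x * cnj (\<gamma>' x)) = trivial_character"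
    show "\<gamma> = \<gamma>'"
    proof
      fix x
      have "\<gamma> x * cnj (\<gamma>' x) = 1" "\<gamma>' x * cnj (\<gamma>' x) = 1" "cnj (\<gamma>' x) \<noteq> 0"
        using fun_cong[OF *, of x] dual_group_norm[OF \<gamma>', of x] by (auto simp: complex_norm_square[symmetric])
      then show "\<gamma> x = \<gamma>' x" by (metis mult_right_cancel)
    qed
  qed (use dual_group_norm[OF \<gamma>'] in \<open>auto simp: complex_norm_square[symmetric]\<close>)
  then show ?thesis
    unfolding fourier_coeff_def using integral_character[OF dual_group_mult_cnj[OF \<gamma> \<gamma>']] by simp
qed

lemma borel_measurable_cnj [measurable]:
  "f \<in> borel_measurable M \<Longrightarrow> (\<lambda>x. cnj (f x)) \<in> borel_measurable M"
  by (rule borel_measurable_continuous_on[of cnj]) (intro continuous_intros)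

text \<open>
  Stated for bounded Borel functions, since it is later applied to densities: it implies that their
  Fourier coefficients tend to zero.
\<close>

lemma bessel_inequality:
  assumes f: "f \<in> borel_measurable borel" "\<And>x. cmod (f x) \<le> K"
    and F: "finite F" "F \<subseteq> dual_group"
  shows "(\<Sum>\<gamma>\<in>F. (cmod (fourier_coeff f \<gamma>))\<^sup>2) \<le> energy f"
proof -
  define c where "c \<gamma> = fourier_coeff f \<gamma>" for \<gamma>
  define g where "g = (\<lambda>x. \<Sum>\<gamma>\<in>F. c \<gamma> * \<gamma> x)"
  have g_cont: "continuous_fun g"
    unfolding g_def using F(2) by (intro continuous_intros dual_group_continuous) auto
  obtain L where L: "\<And>x. cmod (g x) \<le> L"
    using continuous_bounded_on_compact[OF compact_group g_cont] by metis
  have [measurable]: "g \<in> borel_measurable borel" "f \<in> borel_measurable borel"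
    using g_cont f(1) by (auto intro: borel_measurable_continuous_onI)
  have K: "K \<ge> 0" "L \<ge> 0" using order_trans[OF norm_ge_zero f(2)] order_trans[OF norm_ge_zero L] .
  have int: "complex_integrable haar (\<lambda>x. u x * cnj (v x))"
    if uv: "u \<in> {f, g}" "v \<in> {f, g}" for u v
  proof (rule integrable_bounded_borel)
    show "(\<lambda>x. u x * cnj (v x)) \<in> borel_measurable borel" using uv by auto
    have bd: "cmod (w x) \<le> max K L" if "w \<in> {f, g}" for w x
      using that f(2)[of x] L[of x] by auto
    fix x
    show "cmod (u x * cnj (v x)) \<le> max K L * max K L"
      unfolding norm_mult complex_mod_cnj using uv K by (intro mult_mono bd) auto
  qed (simp_all add: finite_measure_axioms)
  have char_g: "(LINT x|haar. \<gamma> x * cnj (g x)) = cnj (c \<gamma>)" if "\<gamma> \<in> F" for \<gamma>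
  proof -
    have "(LINT x|haar. \<gamma> x * cnj (g x)) = (LINT x|haar. (\<Sum>\<gamma>'\<in>F. cnj (c \<gamma>') * (\<gamma> x * cnj (\<gamma>' x))))"
      by (simp add: g_def sum_distrib_left mult.left_commute)
    also have "\<dots> = (\<Sum>\<gamma>'\<in>F. LINT x|haar. cnj (c \<gamma>') * (\<gamma> x * cnj (\<gamma>' x)))"
      using F(2) that
      by (intro Bochner_Integration.integral_sum integrable_continuous continuous_intros dual_group_continuous) auto
    also have "\<dots> = (\<Sum>\<gamma>'\<in>F. cnj (c \<gamma>') * fourier_coeff \<gamma> \<gamma>')"
      by (simp add: fourier_coeff_def)
    also have "\<dots> = (\<Sum>\<gamma>'\<in>F. if \<gamma> = \<gamma>' then cnj (c \<gamma>') else 0)"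
      using F(2) that by (intro sum.cong refl) (auto simp: fourier_coeff_character subset_iff)
    finally show ?thesis using F(1) that by simp
  qed
  let ?S = "\<Sum>\<gamma>\<in>F. (cmod (c \<gamma>))\<^sup>2"
  have gg: "(LINT x|haar. g x * cnj (g x)) = of_real ?S"
  proof -
    have "(LINT x|haar. g x * cnj (g x)) = (LINT x|haar. (\<Sum>\<gamma>\<in>F. c \<gamma> * (\<gamma> x * cnj (g x))))"
      by (simp add: g_def[of] sum_distrib_right mult.assoc)
    also have "\<dots> = (\<Sum>\<gamma>\<in>F. LINT x|haar. c \<gamma> * (\<gamma> x * cnj (g x)))"
      using F(2)
      by (intro Bochner_Integration.integral_sum integrable_continuous continuous_on_mult continuous_on_const
          continuous_on_cnj g_cont dual_group_continuous) auto
    also have "\<dots> = (\<Sum>\<gamma>\<in>F. c \<gamma> * cnj (c \<gamma>))" by (simp add: char_g)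
    also have "\<dots> = of_real ?S" by (simp only: of_real_sum complex_norm_square)
    finally show ?thesis .
  qed
  have fg: "(LINT x|haar. f x * cnj (g x)) = of_real ?S"
  proof -
    have "(LINT x|haar. f x * cnj (g x)) = (LINT x|haar. (\<Sum>\<gamma>\<in>F. cnj (c \<gamma>) * (f x * cnj (\<gamma> x))))"
      by (simp add: g_def sum_distrib_left mult.left_commute)
    also have "\<dots> = (\<Sum>\<gamma>\<in>F. LINT x|haar. cnj (c \<gamma>) * (f x * cnj (\<gamma> x)))"
    proof (intro Bochner_Integration.integral_sum integrable_mult_right integrable_bounded_borel)
      fix \<gamma> x assume "\<gamma> \<in> F"
      then have \<gamma>: "\<gamma> \<in> dual_group" using F(2) by blast
      have [measurable]: "\<gamma> \<in> borel_measurable borel"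
        using dual_group_continuous[OF \<gamma>] by (rule borel_measurable_continuous_onI)
      show "(\<lambda>x. f x * cnj (\<gamma> x)) \<in> borel_measurable borel" by measurable
      show "cmod (f x * cnj (\<gamma> x)) \<le> K" using f(2)[of x] by (simp add: norm_mult dual_group_norm[OF \<gamma>])
    qed (simp_all add: finite_measure_axioms)
    also have "\<dots> = (\<Sum>\<gamma>\<in>F. c \<gamma> * cnj (c \<gamma>))"
      by (simp add: c_def fourier_coeff_def[symmetric] mult.commute)
    also have "\<dots> = of_real ?S" by (simp only: of_real_sum complex_norm_square)
    finally show ?thesis .
  qed
  have "(LINT x|haar. g x * cnj (f x)) = cnj (LINT x|haar. f x * cnj (g x))"
    by (simp only: Bochner_Integration.integral_cnj[symmetric] complex_cnj_mult complex_cnj_cnj mult.commute)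
  then have gf: "(LINT x|haar. g x * cnj (f x)) = of_real ?S" by (simp add: fg)
  have "complex_of_real (LINT x|haar. (cmod (f x - g x))\<^sup>2)
      = (LINT x|haar. f x * cnj (f x) - f x * cnj (g x) - g x * cnj (f x) + g x * cnj (g x))"
    unfolding integral_complex_of_real[symmetric] complex_norm_square
    by (simp add: algebra_simps)
  also have "\<dots> = (LINT x|haar. f x * cnj (f x)) - of_real ?S"
    using int by (simp add: fg gf gg)
  also have "(LINT x|haar. f x * cnj (f x)) = of_real (energy f)"
    unfolding energy_def integral_complex_of_real[symmetric] complex_norm_square ..
  also have "of_real (energy f) - of_real ?S = complex_of_real (energy f - ?S)" by simp
  finally have "(LINT x|haar. (cmod (f x - g x))\<^sup>2) = energy f - ?S" by (simp only: of_real_eq_iff)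
  moreover have "0 \<le> (LINT x|haar. (cmod (f x - g x))\<^sup>2)" by simp
  ultimately have "?S \<le> energy f" by linarith
  then show ?thesis by (simp add: c_def)
qed

lemma fourier_coeff_square_summable:
  assumes f: "f \<in> borel_measurable borel" "\<And>x. cmod (f x) \<le> K"
  shows "(\<lambda>\<gamma>. (cmod (fourier_coeff f \<gamma>))\<^sup>2) summable_on dual_group"
  using bessel_inequality[OF f] by (intro nonneg_bdd_above_summable_on bdd_aboveI2[of _ _ "energy f"]) auto

text \<open>
  Linear functionals on the continuous functions that are continuous for the supremum norm.  Integration
  against a density, Fourier coefficients and integration against a signed measure are the instances
  for which series of characters are integrated term by term.
\<close>

definition bounded_functional :: "(('a \<Rightarrow> complex) \<Rightarrow> complex) \<Rightarrow> bool" where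
  "bounded_functional \<Lambda> \<longleftrightarrow>
     (\<forall>f g. continuous_fun f \<longrightarrow> continuous_fun g \<longrightarrow> \<Lambda> (\<lambda>x. f x + g x) = \<Lambda> f + \<Lambda> g) \<and>
     (\<forall>a f. continuous_fun f \<longrightarrow> \<Lambda> (\<lambda>x. a * f x) = a * \<Lambda> f) \<and>
     (\<exists>C. \<forall>f B. continuous_fun f \<longrightarrow> (\<forall>x. cmod (f x) \<le> B) \<longrightarrow> cmod (\<Lambda> f) \<le> C * B)"

lemma bounded_functional_sum:
  assumes \<Lambda>: "bounded_functional \<Lambda>" and F: "finite F" "F \<subseteq> dual_group"
  shows "\<Lambda> (\<lambda>x. \<Sum>\<gamma>\<in>F. c \<gamma> * \<gamma> x) = (\<Sum>\<gamma>\<in>F. c \<gamma> * \<Lambda> \<gamma>)"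
  using F
proof (induction F rule: finite_induct)
  case empty
  have "\<Lambda> (\<lambda>x. 0 * trivial_character x) = 0 * \<Lambda> trivial_character"
    using \<Lambda> continuous_on_const[of UNIV 1] unfolding bounded_functional_def by blast
  then show ?case by simp
next
  case (insert \<gamma> F)
  have cont: "continuous_fun \<gamma>'" if "\<gamma>' \<in> insert \<gamma> F" for \<gamma>'
    using insert.prems that by (intro dual_group_continuous) blast
  then have \<gamma>: "continuous_fun \<gamma>" by blast
  have "continuous_fun (\<lambda>x. c \<gamma> * \<gamma> x)" "continuous_fun (\<lambda>x. \<Sum>\<gamma>\<in>F. c \<gamma> * \<gamma> x)"
    by (intro continuous_intros cont; blast)+
  then have "\<Lambda> (\<lambda>x. c \<gamma> * \<gamma> x + (\<Sum>\<gamma>\<in>F. c \<gamma> * \<gamma> x)) = \<Lambda> (\<lambda>x. c \<gamma> * \<gamma> x) + \<Lambda> (\<lambda>x. \<Sum>\<gamma>\<in>F. c \<gamma> * \<gamma> x)"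
    using \<Lambda> unfolding bounded_functional_def by blast
  also have "\<Lambda> (\<lambda>x. c \<gamma> * \<gamma> x) = c \<gamma> * \<Lambda> \<gamma>"
    using \<Lambda> \<gamma> unfolding bounded_functional_def by blast
  finally show ?case using insert by simp
qed

context
  fixes X :: "('a \<Rightarrow> complex) set" and c :: "('a \<Rightarrow> complex) \<Rightarrow> complex" and \<psi> :: "'a \<Rightarrow> complex"
  assumes X: "X \<subseteq> dual_group" and c: "(\<lambda>\<gamma>. cmod (c \<gamma>)) summable_on X"
    and \<psi>: "\<And>x. \<psi> x = (\<Sum>\<^sub>\<infinity>\<gamma>\<in>X. c \<gamma> * \<gamma> x)"
begin

lemma character_series_has_sum: "((\<lambda>\<gamma>. c \<gamma> * \<gamma> x) has_sum \<psi> x) X"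
proof -
  have "(\<lambda>\<gamma>. cmod (c \<gamma> * \<gamma> x)) summable_on X \<longleftrightarrow> (\<lambda>\<gamma>. cmod (c \<gamma>)) summable_on X"
    using X by (intro summable_on_cong) (auto simp: norm_mult dual_group_norm)
  from has_sum_infsum[OF abs_summable_summable[OF iffD2[OF this c]]] show ?thesis
    by (simp only: \<psi>)
qed

lemma character_series_uniform:
  assumes "\<epsilon> > 0"
  shows "\<forall>\<^sub>F F in finite_subsets_at_top X. \<forall>x. cmod (\<psi> x - (\<Sum>\<gamma>\<in>F. c \<gamma> * \<gamma> x)) \<le> \<epsilon>"
proof -
  have "\<forall>\<^sub>F F in finite_subsets_at_top X. dist (\<Sum>\<gamma>\<in>F. cmod (c \<gamma>)) (\<Sum>\<^sub>\<infinity>\<gamma>\<in>X. cmod (c \<gamma>)) < \<epsilon>"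
    using infsum_tendsto[OF c] assms by (rule tendstoD)
  moreover have "\<forall>\<^sub>F F in finite_subsets_at_top X. finite F \<and> F \<subseteq> X"
    by (rule eventually_finite_subsets_at_top_weakI) simp
  ultimately show ?thesis
  proof eventually_elim
    case (elim F)
    show ?case
    proof
      fix x
      have "((\<lambda>\<gamma>. c \<gamma> * \<gamma> x) has_sum (\<psi> x - (\<Sum>\<gamma>\<in>F. c \<gamma> * \<gamma> x))) (X - F)"
        using elim by (intro has_sum_Diff character_series_has_sum has_sum_finite) auto
      moreover have "((\<lambda>\<gamma>. cmod (c \<gamma>)) has_sum ((\<Sum>\<^sub>\<infinity>\<gamma>\<in>X. cmod (c \<gamma>)) - (\<Sum>\<gamma>\<in>F. cmod (c \<gamma>)))) (X - F)"
        using elim by (intro has_sum_Diff has_sum_infsum c has_sum_finite) auto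
      ultimately have "cmod (\<psi> x - (\<Sum>\<gamma>\<in>F. c \<gamma> * \<gamma> x)) \<le> (\<Sum>\<^sub>\<infinity>\<gamma>\<in>X. cmod (c \<gamma>)) - (\<Sum>\<gamma>\<in>F. cmod (c \<gamma>))"
        by (rule norm_infsum_le) (use X in \<open>auto simp: norm_mult dual_group_norm\<close>)
      also have "\<dots> \<le> \<epsilon>" using elim by (simp add: dist_real_def)
      finally show "cmod (\<psi> x - (\<Sum>\<gamma>\<in>F. c \<gamma> * \<gamma> x)) \<le> \<epsilon>" .
    qed
  qed
qed

lemma character_series_continuous: "continuous_fun \<psi>"
proof (rule uniform_limit_theorem)
  show "uniform_limit UNIV (\<lambda>F x. \<Sum>\<gamma>\<in>F. c \<gamma> * \<gamma> x) \<psi> (finite_subsets_at_top X)"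
  proof (rule uniform_limitI)
    fix e :: real assume "e > 0"
    with character_series_uniform[of "e / 2"]
    have "\<forall>\<^sub>F F in finite_subsets_at_top X. \<forall>x. cmod (\<psi> x - (\<Sum>\<gamma>\<in>F. c \<gamma> * \<gamma> x)) \<le> e / 2" by simp
    then show "\<forall>\<^sub>F F in finite_subsets_at_top X. \<forall>x\<in>UNIV. dist (\<Sum>\<gamma>\<in>F. c \<gamma> * \<gamma> x) (\<psi> x) < e"
    proof (rule eventually_mono, intro ballI)
      fix F x assume "\<forall>x. cmod (\<psi> x - (\<Sum>\<gamma>\<in>F. c \<gamma> * \<gamma> x)) \<le> e / 2"
      then have "cmod (\<psi> x - (\<Sum>\<gamma>\<in>F. c \<gamma> * \<gamma> x)) \<le> e / 2" by blast
      then show "dist (\<Sum>\<gamma>\<in>F. c \<gamma> * \<gamma> x) (\<psi> x) < e"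
        using \<open>e > 0\<close> by (simp add: dist_norm norm_minus_commute)
    qed
  qed
  show "\<forall>\<^sub>F F in finite_subsets_at_top X. continuous_fun (\<lambda>x. \<Sum>\<gamma>\<in>F. c \<gamma> * \<gamma> x)"
    using X by (intro eventually_finite_subsets_at_top_weakI continuous_intros dual_group_continuous) auto
qed simp

lemma character_series_functional:
  assumes \<Lambda>: "bounded_functional \<Lambda>"
  shows "((\<lambda>\<gamma>. c \<gamma> * \<Lambda> \<gamma>) has_sum \<Lambda> \<psi>) X"
proof -
  have lin: "\<And>f g. continuous_fun f \<Longrightarrow> continuous_fun g \<Longrightarrow> \<Lambda> (\<lambda>x. f x + g x) = \<Lambda> f + \<Lambda> g"
    "\<And>a f. continuous_fun f \<Longrightarrow> \<Lambda> (\<lambda>x. a * f x) = a * \<Lambda> f"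
    using \<Lambda> unfolding bounded_functional_def by blast+
  obtain C where "\<And>f B. continuous_fun f \<Longrightarrow> \<forall>x. cmod (f x) \<le> B \<Longrightarrow> cmod (\<Lambda> f) \<le> C * B"
    using \<Lambda> unfolding bounded_functional_def by blast
  then have C: "cmod (\<Lambda> f) \<le> (\<bar>C\<bar> + 1) * B" if "continuous_fun f" "\<forall>x. cmod (f x) \<le> B" for f B
  proof -
    have "0 \<le> B" using that(2) order_trans[OF norm_ge_zero] by blast
    then have "C * B \<le> (\<bar>C\<bar> + 1) * B" by (intro mult_right_mono) auto
    then show ?thesis using \<open>\<And>f B. _ \<Longrightarrow> _ \<Longrightarrow> cmod (\<Lambda> f) \<le> C * B\<close>[OF that] by linarith
  qed
  show ?thesis
    unfolding has_sum_def
  proof (rule tendstoI)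
    fix e :: real assume e: "e > 0"
    define \<delta> where "\<delta> = e / (2 * (\<bar>C\<bar> + 1))"
    have \<delta>: "\<delta> > 0" using e by (simp add: \<delta>_def add_nonneg_pos)
    have "\<forall>\<^sub>F F in finite_subsets_at_top X. finite F \<and> F \<subseteq> X"
      by (rule eventually_finite_subsets_at_top_weakI) simp
    with character_series_uniform[OF \<delta>]
    show "\<forall>\<^sub>F F in finite_subsets_at_top X. dist (\<Sum>\<gamma>\<in>F. c \<gamma> * \<Lambda> \<gamma>) (\<Lambda> \<psi>) < e"
    proof eventually_elim
      case (elim F)
      have F: "finite F" "F \<subseteq> dual_group" using elim X by auto
      let ?s = "\<lambda>x. \<Sum>\<gamma>\<in>F. c \<gamma> * \<gamma> x"
      have "continuous_fun \<gamma>" if "\<gamma> \<in> F" for \<gamma> using F that by (intro dual_group_continuous) blast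
      then have s: "continuous_fun ?s" by (intro continuous_intros)
      have "\<Lambda> (\<lambda>x. \<psi> x + (- 1) * ?s x) = \<Lambda> \<psi> + \<Lambda> (\<lambda>x. (- 1) * ?s x)"
        by (rule lin(1)[OF character_series_continuous continuous_on_mult[OF continuous_on_const s]])
      also have "\<Lambda> (\<lambda>x. (- 1) * ?s x) = (- 1) * \<Lambda> ?s" by (rule lin(2)[OF s])
      also have "\<Lambda> ?s = (\<Sum>\<gamma>\<in>F. c \<gamma> * \<Lambda> \<gamma>)" by (rule bounded_functional_sum[OF \<Lambda> F])
      finally have "\<Lambda> \<psi> - (\<Sum>\<gamma>\<in>F. c \<gamma> * \<Lambda> \<gamma>) = \<Lambda> (\<lambda>x. \<psi> x - ?s x)" by simp
      moreover have "cmod (\<Lambda> (\<lambda>x. \<psi> x - ?s x)) \<le> (\<bar>C\<bar> + 1) * \<delta>"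
        by (intro C continuous_on_diff character_series_continuous s) (use elim in auto)
      moreover have "(\<bar>C\<bar> + 1) * \<delta> = e / 2"
      proof -
        have "\<bar>C\<bar> + 1 \<noteq> 0" by (simp add: add_nonneg_pos less_imp_neq[symmetric])
        then show ?thesis by (simp add: \<delta>_def field_simps)
      qed
      ultimately have "cmod (\<Lambda> \<psi> - (\<Sum>\<gamma>\<in>F. c \<gamma> * \<Lambda> \<gamma>)) \<le> e / 2" by simp
      then show ?case using e by (simp add: dist_norm norm_minus_commute)
    qed
  qed
qed

end

lemma bounded_functionalI:
  assumes "\<And>f g. continuous_fun f \<Longrightarrow> continuous_fun g \<Longrightarrow> \<Lambda> (\<lambda>x. f x + g x) = \<Lambda> f + \<Lambda> g"
    and "\<And>a f. continuous_fun f \<Longrightarrow> \<Lambda> (\<lambda>x. a * f x) = a * \<Lambda> f"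
    and "\<And>f B. continuous_fun f \<Longrightarrow> (\<And>x. cmod (f x) \<le> B) \<Longrightarrow> cmod (\<Lambda> f) \<le> C * B"
  shows "bounded_functional \<Lambda>"
  unfolding bounded_functional_def using assms by blast

lemma bounded_functional_integral:
  assumes p: "p \<in> borel_measurable borel" "\<And>x. cmod (p x) \<le> K"
  shows "bounded_functional (\<lambda>f. LINT x|haar. f x * p x)"
proof (rule bounded_functionalI[where C = K])
  have int: "complex_integrable haar (\<lambda>x. f x * p x)" if f: "continuous_fun f" for f
  proof -
    obtain L where L: "\<And>x. cmod (f x) \<le> L"
      using continuous_bounded_on_compact[OF compact_group f] by metis
    have [measurable]: "f \<in> borel_measurable borel" by (rule borel_measurable_continuous_onI[OF f])
    show ?thesis
    proof (rule integrable_bounded_borel)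
      show "(\<lambda>x. f x * p x) \<in> borel_measurable borel" using p(1) by measurable
      show "cmod (f x * p x) \<le> L * K" for x
        unfolding norm_mult using L p(2) order_trans[OF norm_ge_zero L] by (intro mult_mono) auto
    qed (simp_all add: finite_measure_axioms)
  qed
  fix f g :: "'a \<Rightarrow> complex" and a B
  assume f: "continuous_fun f"
  show "(LINT x|haar. a * f x * p x) = a * (LINT x|haar. f x * p x)"
    by (simp add: mult.assoc)
  {
    assume "continuous_fun g"
    then show "(LINT x|haar. (f x + g x) * p x) = (LINT x|haar. f x * p x) + (LINT x|haar. g x * p x)"
      using int[OF f] int[of g] by (simp add: distrib_right)
  }
  {
    assume B: "\<And>x. cmod (f x) \<le> B"
    have "cmod (LINT x|haar. f x * p x) \<le> (LINT x|haar. cmod (f x * p x))" by (rule integral_norm_bound)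
    also have "\<dots> \<le> (LINT x|haar. K * B)"
    proof (rule integral_mono)
      show "cmod (f x * p x) \<le> K * B" for x
        unfolding norm_mult mult.commute[of K] using B p(2) order_trans[OF norm_ge_zero B] by (intro mult_mono) auto
    qed (use int[OF f] in \<open>auto intro: integrable_norm\<close>)
    finally show "cmod (LINT x|haar. f x * p x) \<le> K * B" by simp
  }
qed

lemma bounded_functional_fourier_coeff:
  assumes "\<gamma> \<in> dual_group" shows "bounded_functional (\<lambda>f. fourier_coeff f \<gamma>)"
  unfolding fourier_coeff_def
proof (rule bounded_functional_integral[where K = 1])
  have [measurable]: "\<gamma> \<in> borel_measurable borel"
    by (rule borel_measurable_continuous_onI[OF dual_group_continuous[OF assms]])
  show "(\<lambda>x. cnj (\<gamma> x)) \<in> borel_measurable borel" by measurable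
qed (simp add: dual_group_norm[OF assms])

lemma fourier_coeff_character_series:
  assumes X: "X \<subseteq> dual_group" and c: "(\<lambda>\<gamma>. cmod (c \<gamma>)) summable_on X"
    and \<psi>: "\<And>x. \<psi> x = (\<Sum>\<^sub>\<infinity>\<gamma>\<in>X. c \<gamma> * \<gamma> x)" and \<gamma>: "\<gamma> \<in> dual_group"
  shows "fourier_coeff \<psi> \<gamma> = (if \<gamma> \<in> X then c \<gamma> else 0)"
proof -
  have "((\<lambda>\<gamma>'. c \<gamma>' * fourier_coeff \<gamma>' \<gamma>) has_sum fourier_coeff \<psi> \<gamma>) X"
    using character_series_functional[OF X c \<psi> bounded_functional_fourier_coeff[OF \<gamma>]] .
  moreover have "((\<lambda>\<gamma>'. c \<gamma>' * fourier_coeff \<gamma>' \<gamma>) has_sum (if \<gamma> \<in> X then c \<gamma> else 0)) X"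
  proof -
    have "((\<lambda>\<gamma>'. if \<gamma>' = \<gamma> then c \<gamma>' else 0) has_sum (if \<gamma> \<in> X then c \<gamma> else 0)) X"
      by (rule has_sum_finite_neutralI[of "X \<inter> {\<gamma>}"]) auto
    moreover have "((\<lambda>\<gamma>'. if \<gamma>' = \<gamma> then c \<gamma>' else 0) has_sum s) X \<longleftrightarrow> ((\<lambda>\<gamma>'. c \<gamma>' * fourier_coeff \<gamma>' \<gamma>) has_sum s) X" for s
      using X by (intro has_sum_cong) (auto simp: fourier_coeff_character[OF _ \<gamma>] subset_iff)
    ultimately show ?thesis by simp
  qed
  ultimately show ?thesis by (rule has_sum_unique)
qed

text \<open>
  The series converges uniformly and has the Fourier coefficients of \<open>f\<close>, so uniqueness applies.
\<close>

theorem fourier_inversion: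
  assumes f: "continuous_fun f" and sum: "(\<lambda>\<gamma>. cmod (fourier_coeff f \<gamma>)) summable_on dual_group"
  shows "f x = (\<Sum>\<^sub>\<infinity>\<gamma>\<in>dual_group. fourier_coeff f \<gamma> * \<gamma> x)"
proof -
  define \<psi> where "\<psi> x = (\<Sum>\<^sub>\<infinity>\<gamma>\<in>dual_group. fourier_coeff f \<gamma> * \<gamma> x)" for x
  have \<psi>: "continuous_fun \<psi>" by (rule character_series_continuous[OF order_refl sum \<psi>_def])
  have "f x - \<psi> x = 0"
  proof (rule fourier_uniqueness[of "\<lambda>x. f x - \<psi> x"])
    show "continuous_fun (\<lambda>x. f x - \<psi> x)" using f \<psi> by (intro continuous_intros)
    fix \<gamma> :: "'a \<Rightarrow> complex" assume \<gamma>: "\<gamma> \<in> dual_group"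
    have "complex_integrable haar (\<lambda>x. f x * cnj (\<gamma> x))" "complex_integrable haar (\<lambda>x. \<psi> x * cnj (\<gamma> x))"
      using f \<psi> dual_group_continuous[OF \<gamma>] by (intro integrable_continuous continuous_intros; simp)+
    then have "fourier_coeff (\<lambda>x. f x - \<psi> x) \<gamma> = fourier_coeff f \<gamma> - fourier_coeff \<psi> \<gamma>"
      by (simp add: fourier_coeff_def left_diff_distrib)
    then show "fourier_coeff (\<lambda>x. f x - \<psi> x) \<gamma> = 0"
      using fourier_coeff_character_series[OF order_refl sum \<psi>_def \<gamma>] \<gamma> by simp
  qed
  then show ?thesis by (simp add: \<psi>_def)
qed

lemma fourier_coeff_conv:
  assumes u: "continuous_fun u" and w: "continuous_fun w" and \<gamma>: "\<gamma> \<in> dual_group"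
  shows "fourier_coeff (u \<star> w) \<gamma> = fourier_coeff u \<gamma> * fourier_coeff w \<gamma>"
proof -
  note c\<gamma> = dual_group_continuous[OF \<gamma>]
  have "fourier_coeff (u \<star> w) \<gamma> * \<gamma> 0 = (u \<star> w \<star> \<gamma>) 0" by (simp add: conv_character[OF \<gamma>])
  also have "u \<star> w \<star> \<gamma> = w \<star> (u \<star> \<gamma>)"
    unfolding conv_commute[OF u w] by (rule conv_assoc[OF w u c\<gamma>])
  also have "\<dots> = (u \<star> \<gamma>) \<star> w" by (rule conv_commute[OF w conv_continuous[OF u c\<gamma>]])
  also have "\<dots> = (\<lambda>x. fourier_coeff u \<gamma> * (\<gamma> \<star> w) x)" unfolding conv_character[OF \<gamma>] by (rule conv_scale)
  also have "\<gamma> \<star> w = w \<star> \<gamma>" by (rule conv_commute[OF c\<gamma> w])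
  finally show ?thesis by (simp add: conv_character[OF \<gamma>] dual_group_at_0[OF \<gamma>])
qed

lemma fourier_coeff_adjoint:
  assumes u: "continuous_fun u" and \<gamma>: "\<gamma> \<in> dual_group"
  shows "fourier_coeff (adjoint_fun u) \<gamma> = cnj (fourier_coeff u \<gamma>)"
proof -
  have "fourier_coeff (adjoint_fun u) \<gamma> = (LINT x|haar. cnj (u (- x) * cnj (\<gamma> (- x))))"
    by (simp add: fourier_coeff_def adjoint_fun_def dual_group_minus[OF \<gamma>])
  also have "\<dots> = (LINT x|haar. cnj (u x * cnj (\<gamma> x)))"
    using u dual_group_continuous[OF \<gamma>]
    by (intro integral_reflect_continuous[of "\<lambda>x. cnj (u x * cnj (\<gamma> x))"] continuous_intros)
  also have "\<dots> = cnj (fourier_coeff u \<gamma>)" unfolding fourier_coeff_def by (rule Bochner_Integration.integral_cnj)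
  finally show ?thesis .
qed

lemma fourier_coeff_conv_adjoint:
  assumes "continuous_fun u" "\<gamma> \<in> dual_group"
  shows "fourier_coeff (u \<star> adjoint_fun u) \<gamma> = of_real ((cmod (fourier_coeff u \<gamma>))\<^sup>2)"
  using assms
  by (simp add: fourier_coeff_conv adjoint_continuous fourier_coeff_adjoint complex_norm_square[symmetric] del: of_real_power)

lemma fourier_coeff_square_summable_continuous:
  assumes "continuous_fun u"
  shows "(\<lambda>\<gamma>. (cmod (fourier_coeff u \<gamma>))\<^sup>2) summable_on dual_group"
proof -
  obtain K where "\<And>x. cmod (u x) \<le> K"
    using continuous_bounded_on_compact[OF compact_group assms] by metis
  then show ?thesis
    using assms by (intro fourier_coeff_square_summable borel_measurable_continuous_onI)
qed

text \<open>
  So every character is itself of the form \<open>u \<star> u\<^sup>*\<close>, and the values of a measure on characters are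
  instances of the definition of positive definiteness.
\<close>

lemma character_conv_adjoint: "\<gamma> \<in> dual_group \<Longrightarrow> \<gamma> \<star> adjoint_fun \<gamma> = \<gamma>"
  by (simp add: adjoint_fun_def dual_group_minus conv_character fourier_coeff_character)

lemma conv_sup_bound:
  assumes u: "continuous_fun u" "\<And>x. cmod (u x) \<le> M" and w: "continuous_fun w"
  shows "cmod ((u \<star> w) g) \<le> M * (LINT h|haar. cmod (w h))"
proof -
  have "cmod ((u \<star> w) g) \<le> (LINT h|haar. cmod (u h * w (g - h)))"
    unfolding convolution_def by (rule integral_norm_bound)
  also have "\<dots> \<le> (LINT h|haar. M * cmod (w (g - h)))"
    unfolding norm_mult using u w
    by (intro integral_mono integrable_continuous continuous_intros continuous_comp_diff mult_right_mono) auto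
  also have "\<dots> = M * (LINT h|haar. cmod (w h))"
  proof -
    have "(\<lambda>h. cmod (w h)) \<in> borel_measurable borel"
      using w by (intro borel_measurable_continuous_onI continuous_intros)
    from integral_reverse[OF this, of g] show ?thesis by simp
  qed
  finally show ?thesis .
qed

lemma bump_function:
  assumes "open V" "0 \<in> V"
  obtains w :: "'a \<Rightarrow> real" where "continuous_on UNIV w" "\<And>x. w x \<ge> 0" "\<And>x. x \<notin> V \<Longrightarrow> w x = 0"
    "(LINT x|haar. w x) = 1" "w 0 > 0"
proof -
  have "closed (- V)" "closed {0 :: 'a}" "- V \<inter> {0} = {}" using assms by auto
  then obtain f :: "'a \<Rightarrow> real" where f: "continuous_on UNIV f" "\<And>x. 0 \<le> f x" "\<And>x. f x \<le> 1"
    "\<And>x. x \<in> - V \<Longrightarrow> f x = 0" "\<And>x. x \<in> {0} \<Longrightarrow> f x = 1"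
    using urysohn_compact_hausdorff[OF compact_group] by metis
  define m where "m = (LINT x|haar. f x)"
  have m: "m > 0" unfolding m_def using f(1,2,5) by (intro integral_pos[of f 0]) auto
  show thesis
    using f m by (intro that[of "\<lambda>x. f x / m"]) (auto intro!: continuous_intros simp: m_def)
qed

text \<open>
  Let \<open>w \<ge> 0\<close> have integral one and small support around \<open>0\<close>.  The function \<open>h = f \<star> w \<star> w\<^sup>*\<close> has the
  coefficients \<open>f^ \<bar>w^\<bar>\<^sup>2\<close>.  They are summable by Bessel's inequality for \<open>w\<close>, so their sum is
  \<open>h(0) \<le> sup \<bar>f\<bar>\<close>.  On a given finite set of characters \<open>\<bar>w^\<bar> \<ge> 1/2\<close> for small support, which bounds the
  partial sums of \<open>f^\<close> independently of the set.
\<close>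

theorem nonneg_fourier_coeffs_summable:
  assumes f: "continuous_fun f" and nonneg: "\<And>\<gamma>. \<gamma> \<in> dual_group \<Longrightarrow> fourier_coeff f \<gamma> \<in> \<real>\<^sub>\<ge>\<^sub>0"
  shows "(\<lambda>\<gamma>. cmod (fourier_coeff f \<gamma>)) summable_on dual_group"
proof -
  obtain M where M: "M > 0" "\<And>x. cmod (f x) \<le> M"
    using continuous_bounded_on_compact[OF compact_group f] by metis
  let ?f = "fourier_coeff f"
  have f_eq: "?f \<gamma> = of_real (cmod (?f \<gamma>))" if "\<gamma> \<in> dual_group" for \<gamma>
    using nonneg[OF that] by (auto simp: complex_nonneg_Reals_iff cmod_eq_Re complex_eq_iff)
  have f_le: "cmod (?f \<gamma>) \<le> M" if \<gamma>: "\<gamma> \<in> dual_group" for \<gamma>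
  proof -
    have "cmod (?f \<gamma>) = cmod ((f \<star> \<gamma>) 0)" by (simp add: conv_character[OF \<gamma>] dual_group_at_0[OF \<gamma>])
    also have "\<dots> \<le> M * (LINT h|haar. cmod (\<gamma> h))" by (rule conv_sup_bound[OF f M(2) dual_group_continuous[OF \<gamma>]])
    finally show ?thesis by (simp add: dual_group_norm[OF \<gamma>])
  qed
  have "(\<Sum>\<gamma>\<in>F. cmod (?f \<gamma>)) \<le> 4 * M" if F: "finite F" "F \<subseteq> dual_group" for F
  proof -
    define V where "V = (\<Inter>\<gamma>\<in>F. {x. cmod (\<gamma> x - 1) < 1 / 2})"
    have F_cont: "continuous_fun \<gamma>" if "\<gamma> \<in> F" for \<gamma> using that F(2) by (intro dual_group_continuous) blast
    have "open V" unfolding V_def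
      using F(1) F_cont by (intro open_INT ballI open_Collect_less continuous_intros) auto
    moreover have "0 \<in> V" unfolding V_def using F(2) by (auto simp: dual_group_at_0)
    ultimately obtain k :: "'a \<Rightarrow> real" where k: "continuous_on UNIV k" "\<And>x. k x \<ge> 0"
      "\<And>x. x \<notin> V \<Longrightarrow> k x = 0" "(LINT x|haar. k x) = 1"
      using bump_function by metis
    define w where "w = (\<lambda>x. complex_of_real (k x))"
    have w: "continuous_fun w" "continuous_fun (adjoint_fun w)"
      unfolding w_def adjoint_fun_def using k(1)
      by (auto intro!: continuous_intros continuous_on_compose2[OF k(1)])
    have int_w: "(LINT x|haar. cmod (w x)) = 1" "(LINT x|haar. cmod (adjoint_fun w x)) = 1"
      using k(2,4) integral_reflect_continuous[OF k(1)] by (simp_all add: w_def adjoint_fun_def)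
    let ?w = "fourier_coeff w"
    have w_ge: "cmod (?w \<gamma>) \<ge> 1 / 2" if \<gamma>F: "\<gamma> \<in> F" for \<gamma>
    proof -
      have \<gamma>: "continuous_fun \<gamma>" by (rule F_cont[OF \<gamma>F])
      have int: "complex_integrable haar (\<lambda>x. w x * cnj (\<gamma> x))" "complex_integrable haar w"
        using w(1) \<gamma> by (auto intro!: integrable_continuous continuous_intros)
      have "?w \<gamma> - 1 = (LINT x|haar. w x * cnj (\<gamma> x)) - (LINT x|haar. w x)"
        using k(4) by (simp add: fourier_coeff_def w_def)
      also have "\<dots> = (LINT x|haar. w x * cnj (\<gamma> x) - w x)" using int by simp
      finally have "cmod (?w \<gamma> - 1) \<le> (LINT x|haar. cmod (w x * cnj (\<gamma> x) - w x))"
        by (simp only: integral_norm_bound)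
      also have "\<dots> \<le> (LINT x|haar. k x * (1 / 2))"
      proof (rule integral_mono)
        fix x
        have "w x * cnj (\<gamma> x) - w x = w x * cnj (\<gamma> x - 1)" by (simp add: algebra_simps)
        then have "cmod (w x * cnj (\<gamma> x) - w x) = k x * cmod (\<gamma> x - 1)"
          using k(2)[of x] by (simp only: norm_mult complex_mod_cnj) (simp add: w_def)
        also have "\<dots> \<le> k x * (1 / 2)"
        proof (cases "x \<in> V")
          case True
          then have "cmod (\<gamma> x - 1) \<le> 1 / 2" using \<gamma>F unfolding V_def by fastforce
          then show ?thesis using k(2)[of x] by (rule mult_left_mono)
        qed (simp add: k(3))
        finally show "cmod (w x * cnj (\<gamma> x) - w x) \<le> k x * (1 / 2)" .
      qed (use int k(1) in \<open>auto intro!: integrable_norm Bochner_Integration.integrable_diff integrable_continuous continuous_intros\<close>)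
      also have "\<dots> = 1 / 2" using k(4) by simp
      finally have "cmod (?w \<gamma> - 1) \<le> 1 / 2" .
      then show ?thesis using norm_triangle_ineq2[of 1 "?w \<gamma>"] by (simp add: norm_minus_commute)
    qed
    define h where "h = f \<star> w \<star> adjoint_fun w"
    have h: "continuous_fun h" unfolding h_def by (intro conv_continuous f w)
    have h_coeff: "fourier_coeff h \<gamma> = of_real (cmod (?f \<gamma>) * (cmod (?w \<gamma>))\<^sup>2)" if \<gamma>: "\<gamma> \<in> dual_group" for \<gamma>
    proof -
      have "fourier_coeff h \<gamma> = ?f \<gamma> * (?w \<gamma> * cnj (?w \<gamma>))"
        by (simp add: h_def fourier_coeff_conv conv_continuous f w \<gamma> fourier_coeff_adjoint)
      then show ?thesis by (simp only: complex_norm_square of_real_mult f_eq[OF \<gamma>, symmetric])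
    qed
    have h_sum: "(\<lambda>\<gamma>. cmod (fourier_coeff h \<gamma>)) summable_on dual_group"
    proof (rule Infinite_Sum.abs_summable_on_comparison_test')
      show "(\<lambda>\<gamma>. M * (cmod (?w \<gamma>))\<^sup>2) summable_on dual_group"
        by (intro summable_on_cmult_right fourier_coeff_square_summable_continuous w)
      show "cmod (fourier_coeff h \<gamma>) \<le> M * (cmod (?w \<gamma>))\<^sup>2" if "\<gamma> \<in> dual_group" for \<gamma>
        using f_le[OF that] by (simp add: h_coeff[OF that] norm_mult norm_power mult_right_mono)
    qed
    have "(\<Sum>\<^sub>\<infinity>\<gamma>\<in>dual_group. fourier_coeff h \<gamma> * \<gamma> 0) = (\<Sum>\<^sub>\<infinity>\<gamma>\<in>dual_group. of_real (cmod (fourier_coeff h \<gamma>)))"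
      by (rule infsum_cong) (simp add: h_coeff dual_group_at_0 norm_mult norm_power)
    then have h0: "h 0 = of_real (\<Sum>\<^sub>\<infinity>\<gamma>\<in>dual_group. cmod (fourier_coeff h \<gamma>))"
      unfolding fourier_inversion[OF h h_sum, of 0]
      by (simp only: infsumI[OF has_sum_of_real[OF has_sum_infsum[OF h_sum]]])
    have "cmod (h 0) \<le> M"
    proof -
      have "cmod ((f \<star> w) x) \<le> M" for x using conv_sup_bound[OF f M(2) w(1)] by (simp add: int_w)
      from conv_sup_bound[OF conv_continuous[OF f w(1)] this w(2)] show ?thesis by (simp add: int_w h_def)
    qed
    then have "(\<Sum>\<^sub>\<infinity>\<gamma>\<in>dual_group. cmod (fourier_coeff h \<gamma>)) \<le> M" unfolding h0 by simp
    moreover have "(\<Sum>\<gamma>\<in>F. cmod (fourier_coeff h \<gamma>)) \<le> (\<Sum>\<^sub>\<infinity>\<gamma>\<in>dual_group. cmod (fourier_coeff h \<gamma>))"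
      using h_sum F by (intro finite_sum_le_infsum) auto
    moreover have "(\<Sum>\<gamma>\<in>F. cmod (?f \<gamma>)) \<le> (\<Sum>\<gamma>\<in>F. 4 * cmod (fourier_coeff h \<gamma>))"
    proof (rule sum_mono)
      fix \<gamma> assume \<gamma>: "\<gamma> \<in> F"
      have "(1 / 2)\<^sup>2 \<le> (cmod (?w \<gamma>))\<^sup>2" using w_ge[OF \<gamma>] by (intro power_mono) auto
      then have "cmod (?f \<gamma>) * (1 / 2)\<^sup>2 \<le> cmod (?f \<gamma>) * (cmod (?w \<gamma>))\<^sup>2" by (intro mult_left_mono) auto
      moreover have "\<gamma> \<in> dual_group" using \<gamma> F(2) by blast
      ultimately show "cmod (?f \<gamma>) \<le> 4 * cmod (fourier_coeff h \<gamma>)"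
        by (simp add: h_coeff norm_mult norm_power power2_eq_square)
    qed
    ultimately show ?thesis by (simp add: sum_distrib_left[symmetric])
  qed
  then show ?thesis
    by (intro nonneg_bdd_above_summable_on bdd_aboveI2[of _ _ "4 * M"]) auto
qed

end

section \<open>Positive definite and regular measures on the group\<close>

context compact_ab_group
begin

lemma bounded_functional_signed_integral:
  assumes \<mu>: "signed_borel_measure \<mu>"
  shows "bounded_functional (signed_integral \<mu> :: ('a \<Rightarrow> complex) \<Rightarrow> complex)"
proof -
  let ?U = "upper_variation \<mu>" and ?L = "lower_variation \<mu>"
  interpret U: finite_measure ?U by (rule finite_measure_upper_variation[OF \<mu>])
  interpret L: finite_measure ?L by (rule finite_measure_lower_variation[OF \<mu>])
  have int: "integrable ?U f" "integrable ?L f" if "continuous_fun f" for f :: "'a \<Rightarrow> complex"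
    using that by (auto intro!: integrable_continuous_compact[OF compact_group] U.finite_measure_axioms L.finite_measure_axioms)
  show ?thesis
  proof (rule bounded_functionalI[where C = "measure ?U UNIV + measure ?L UNIV"])
    fix f g :: "'a \<Rightarrow> complex" assume "continuous_fun f" "continuous_fun g"
    then show "signed_integral \<mu> (\<lambda>x. f x + g x) = signed_integral \<mu> f + signed_integral \<mu> g"
      using int by (simp add: signed_integral_def)
  next
    fix f :: "'a \<Rightarrow> complex" and a
    show "signed_integral \<mu> (\<lambda>x. a * f x) = a * signed_integral \<mu> f"
      by (simp add: signed_integral_def right_diff_distrib)
  next
    fix f :: "'a \<Rightarrow> complex" and B
    assume f: "continuous_fun f" and B: "\<And>x. cmod (f x) \<le> B"
    have le: "cmod (integral\<^sup>L M f) \<le> measure M UNIV * B"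
      if M: "finite_measure M" "sets M = sets borel" "integrable M f" for M
    proof -
      interpret finite_measure M by (rule M)
      have "cmod (integral\<^sup>L M f) \<le> (LINT x|M. cmod (f x))" by (rule integral_norm_bound)
      also have "\<dots> \<le> (LINT x|M. B)" using M(3) B by (intro integral_mono) auto
      finally show ?thesis using M(2) by (simp add: space_eq_UNIV_if_sets_borel)
    qed
    have "cmod (signed_integral \<mu> f) \<le> cmod (integral\<^sup>L ?U f) + cmod (integral\<^sup>L ?L f)"
      unfolding signed_integral_def by (rule norm_triangle_ineq4)
    also have "\<dots> \<le> measure ?U UNIV * B + measure ?L UNIV * B"
      by (intro add_mono le int f U.finite_measure_axioms L.finite_measure_axioms) simp_all
    finally show "cmod (signed_integral \<mu> f) \<le> (measure ?U UNIV + measure ?L UNIV) * B"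
      by (simp add: distrib_right)
  qed
qed

text \<open>
  Characters are of the form \<open>u \<star> u\<^sup>*\<close>, and conversely \<open>u \<star> u\<^sup>* = \<Sum> \<bar>u^(\<gamma>)\<bar>\<^sup>2 \<gamma>\<close> with a summable series that
  may be integrated term by term.
\<close>

lemma positive_definite_measure_iff:
  assumes \<tau>: "signed_borel_measure \<tau>"
  shows "positive_definite_measure haar \<tau> \<longleftrightarrow> (\<forall>\<gamma>\<in>dual_group. signed_integral \<tau> \<gamma> \<in> \<real>\<^sub>\<ge>\<^sub>0)"
proof
  assume pd: "positive_definite_measure haar \<tau>"
  show "\<forall>\<gamma>\<in>dual_group. signed_integral \<tau> \<gamma> \<in> \<real>\<^sub>\<ge>\<^sub>0"
  proof
    fix \<gamma> :: "'a \<Rightarrow> complex" assume \<gamma>: "\<gamma> \<in> dual_group"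
    have "signed_integral \<tau> (\<gamma> \<star> adjoint_fun \<gamma>) \<in> \<real>\<^sub>\<ge>\<^sub>0"
      using pd dual_group_continuous[OF \<gamma>] unfolding positive_definite_measure_def adjoint_fun_def by blast
    then show "signed_integral \<tau> \<gamma> \<in> \<real>\<^sub>\<ge>\<^sub>0" by (simp add: character_conv_adjoint[OF \<gamma>])
  qed
next
  assume nonneg: "\<forall>\<gamma>\<in>dual_group. signed_integral \<tau> \<gamma> \<in> \<real>\<^sub>\<ge>\<^sub>0"
  show "positive_definite_measure haar \<tau>"
    unfolding positive_definite_measure_def adjoint_fun_def[symmetric]
  proof (intro allI impI)
    fix u :: "'a \<Rightarrow> complex" assume u: "continuous_fun u"
    let ?h = "u \<star> adjoint_fun u"
    have coeff: "fourier_coeff ?h \<gamma> = of_real ((cmod (fourier_coeff u \<gamma>))\<^sup>2)" if "\<gamma> \<in> dual_group" for \<gamma>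
      by (rule fourier_coeff_conv_adjoint[OF u that])
    have sum: "(\<lambda>\<gamma>. cmod (fourier_coeff ?h \<gamma>)) summable_on dual_group"
      by (rule Infinite_Sum.abs_summable_on_comparison_test'[OF fourier_coeff_square_summable_continuous[OF u]])
         (simp add: coeff norm_power)
    have "((\<lambda>\<gamma>. fourier_coeff ?h \<gamma> * signed_integral \<tau> \<gamma>) has_sum signed_integral \<tau> ?h) dual_group"
      by (rule character_series_functional[OF order_refl sum _ bounded_functional_signed_integral[OF \<tau>]])
         (rule fourier_inversion[OF conv_continuous[OF u adjoint_continuous[OF u]] sum])
    then show "signed_integral \<tau> ?h \<in> \<real>\<^sub>\<ge>\<^sub>0"
    proof (rule has_sum_nonneg_Reals)
      fix \<gamma> :: "'a \<Rightarrow> complex" assume \<gamma>: "\<gamma> \<in> dual_group"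
      show "fourier_coeff ?h \<gamma> * signed_integral \<tau> \<gamma> \<in> \<real>\<^sub>\<ge>\<^sub>0"
        unfolding coeff[OF \<gamma>] using nonneg \<gamma> by (intro nonneg_Reals_mult_I) auto
    qed
  qed
qed

lemma haar_regular_approx:
  assumes A: "A \<in> sets borel" and "\<epsilon> > 0"
  obtains K U where "compact K" "open U" "K \<subseteq> A" "A \<subseteq> U" "measure haar (U - K) \<le> \<epsilon>"
proof -
  have "(INF U\<in>{U. open U \<and> A \<subseteq> U}. emeasure haar U) < emeasure haar A + ennreal (\<epsilon> / 2)"
    using \<open>\<epsilon> > 0\<close> unfolding haar_outer[OF A, symmetric] by (simp add: emeasure_eq_measure ennreal_less_iff flip: ennreal_plus)
  then obtain U where U: "open U" "A \<subseteq> U" "emeasure haar U < emeasure haar A + ennreal (\<epsilon> / 2)"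
    unfolding INF_less_iff by auto
  have U': "measure haar U \<le> measure haar A + \<epsilon> / 2"
    using U(3) \<open>\<epsilon> > 0\<close> by (simp add: emeasure_eq_measure ennreal_less_iff flip: ennreal_plus)
  show thesis
  proof (cases "measure haar A - \<epsilon> / 2 > 0")
    case False
    have "measure haar (U - {}) \<le> \<epsilon>" using U' False by simp
    then show ?thesis using U by (intro that[of "{}" U]) auto
  next
    case True
    then have "ennreal (measure haar A - \<epsilon> / 2) < (SUP K\<in>{K. compact K \<and> K \<subseteq> A}. emeasure haar K)"
      using \<open>\<epsilon> > 0\<close> unfolding haar_inner[OF A, symmetric] by (simp add: emeasure_eq_measure ennreal_less_iff)
    then obtain K where K: "compact K" "K \<subseteq> A" "ennreal (measure haar A - \<epsilon> / 2) < emeasure haar K"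
      unfolding less_SUP_iff by auto
    have "K \<in> sets borel" "U \<in> sets borel" using K(1) U(1) by (auto intro: borel_closed compact_imp_closed)
    then have "measure haar (U - K) = measure haar U - measure haar K"
      using K(2) U(2) by (intro finite_measure_Diff) auto
    also have "\<dots> \<le> \<epsilon>" using K(3) U' True by (simp add: emeasure_eq_measure ennreal_less_iff)
    finally show ?thesis using K U by (intro that[of K U]) auto
  qed
qed

text \<open>
  Approximating sets for \<open>\<lambda>\<close> are made exact at \<open>0\<close> by adding \<open>0\<close> to the compact set or removing it from
  the open set, so the point mass of \<open>\<delta>\<^sub>0\<close> contributes nothing to their difference.
\<close>

lemma regular_signed_measure_dominated:
  assumes \<mu>: "signed_borel_measure \<mu>"
    and dom: "\<And>A. A \<in> sets borel \<Longrightarrow> \<bar>\<mu> A\<bar> \<le> C * (dirac 0 A + measure haar A)"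
  shows "\<mu> \<in> regular_signed_measures"
proof -
  have C: "C \<ge> 0"
    using order_trans[OF abs_ge_zero dom[of UNIV]] by (simp add: dirac_def zero_le_mult_iff)
  have "regular_borel (total_variation \<mu>)"
  proof (rule regular_borelI)
    show "finite_measure (total_variation \<mu>)" by (rule finite_measure_total_variation[OF \<mu>])
    fix A :: "'a set" and \<epsilon> :: real
    assume A: "A \<in> sets borel" and "\<epsilon> > 0"
    then obtain K U where KU: "compact K" "open U" "K \<subseteq> A" "A \<subseteq> U"
      "measure haar (U - K) \<le> \<epsilon> / (2 * (C + 1))"
      using haar_regular_approx[OF A, of "\<epsilon> / (2 * (C + 1))"] C by auto
    define K' where "K' = (if 0 \<in> A then insert 0 K else K)"
    define U' where "U' = (if 0 \<in> A then U else U - {0})"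
    have K'U': "compact K'" "open U'" "K' \<subseteq> A" "A \<subseteq> U'" "U' - K' \<subseteq> U - K" "0 \<notin> U' - K'"
      using KU by (auto simp: K'_def U'_def compact_insert intro: open_delete)
    have borel: "K' \<in> sets borel" "U' \<in> sets borel" "K \<in> sets borel" "U \<in> sets borel"
      using K'U' KU by (auto intro: borel_closed compact_imp_closed)
    have "measure (total_variation \<mu>) (U' - K') \<le> 2 * (C * measure haar (U - K))"
    proof (rule measure_total_variation_le[OF \<mu>])
      fix B :: "'a set" assume B: "B \<in> sets borel" "B \<subseteq> U' - K'"
      have "\<bar>\<mu> B\<bar> \<le> C * (dirac 0 B + measure haar B)" by (rule dom[OF B(1)])
      also have "dirac 0 B = 0"
      proof -
        have "0 \<notin> B" using B(2) K'U'(6) by blast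
        then show ?thesis by (simp add: dirac_def)
      qed
      also have "measure haar B \<le> measure haar (U - K)"
        using B K'U'(5) borel by (intro finite_measure_mono) auto
      finally show "\<bar>\<mu> B\<bar> \<le> C * measure haar (U - K)" using C by (simp add: mult_left_mono)
    qed (use borel in auto)
    also have "\<dots> \<le> 2 * ((C + 1) * (\<epsilon> / (2 * (C + 1))))"
      using KU(5) C by (intro mult_left_mono mult_mono) auto
    also have "\<dots> = \<epsilon>" using C by (simp add: field_simps)
    finally show "\<exists>K U. compact K \<and> open U \<and> K \<in> sets borel \<and> K \<subseteq> A \<and> A \<subseteq> U \<and> measure (total_variation \<mu>) (U - K) \<le> \<epsilon>"
      using K'U' borel by blast
  qed simp
  with \<mu> show ?thesis by (simp add: regular_signed_measures_def)
qed

end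

section \<open>The primal problem as a linear programme, and weak duality\<close>

text \<open>
  The correspondence \<open>c = 1 / (1 + s)\<close> between the positive values of one problem and the values of the
  other turns the supremum of the one into the infimum of the other.
\<close>

lemma SUP_eq_inverse_INF:
  fixes c :: "'b \<Rightarrow> real" and s :: "'c \<Rightarrow> real"
  assumes ex: "\<exists>\<phi>\<in>I. c \<phi> > 0"
    and forth: "\<And>\<phi>. \<phi> \<in> I \<Longrightarrow> c \<phi> > 0 \<Longrightarrow> \<exists>f\<in>J. s f = 1 / c \<phi> - 1"
    and converse: "\<And>f. f \<in> J \<Longrightarrow> s f \<ge> 0 \<and> (\<exists>\<phi>\<in>I. c \<phi> = 1 / (1 + s f))"
  obtains u where "u \<ge> 0" "(INF f\<in>J. ereal (s f)) = ereal u" "\<And>f. f \<in> J \<Longrightarrow> u \<le> s f"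
    "(SUP \<phi>\<in>I. ereal (c \<phi>)) = ereal (1 / (1 + u))"
proof -
  have ne: "s ` J \<noteq> {}" using ex forth by blast
  have bdd: "bdd_below (s ` J)" using converse by (intro bdd_belowI2[of _ 0]) auto
  define u where "u = Inf (s ` J)"
  have u_le: "u \<le> s f" if "f \<in> J" for f unfolding u_def using that bdd by (intro cInf_lower) auto
  have u0: "u \<ge> 0" unfolding u_def using ne converse by (intro cInf_greatest) auto
  have "(INF f\<in>J. ereal (s f)) = ereal u"
    unfolding u_def using ne bdd by (simp add: ereal_Inf' image_image)
  moreover have "(SUP \<phi>\<in>I. ereal (c \<phi>)) = ereal (1 / (1 + u))"
  proof (rule SUP_eqI)
    fix \<phi> assume \<phi>: "\<phi> \<in> I"
    show "ereal (c \<phi>) \<le> ereal (1 / (1 + u))"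
    proof (cases "c \<phi> > 0")
      case True
      then obtain f where "f \<in> J" "s f = 1 / c \<phi> - 1" using forth[OF \<phi>] by blast
      then have "1 + u \<le> 1 / c \<phi>" using u_le by force
      then have "c \<phi> * (1 + u) \<le> 1" using True by (simp add: field_simps)
      then show ?thesis using u0 by (simp add: field_simps)
    next
      case False
      moreover have "0 \<le> 1 / (1 + u)" using u0 by simp
      ultimately show ?thesis by (simp only: ereal_less_eq)
    qed
  next
    fix y assume y: "\<And>\<phi>. \<phi> \<in> I \<Longrightarrow> ereal (c \<phi>) \<le> y"
    show "ereal (1 / (1 + u)) \<le> y"
    proof (cases y)
      case (real p)
      have le: "c \<phi> \<le> p" if "\<phi> \<in> I" for \<phi> using y[OF that] real by simp
      have p: "p > 0" using ex le by force
      have "1 / p - 1 \<le> s f" if f: "f \<in> J" for f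
      proof -
        have "1 / (1 + s f) \<le> p" using converse[OF f] le by metis
        then show ?thesis using p converse[OF f] by (simp add: field_simps)
      qed
      then have "1 / p - 1 \<le> u" unfolding u_def using ne by (intro cInf_greatest) auto
      then show ?thesis using p u0 real by (simp add: field_simps)
    next
      case MInf
      then show ?thesis using ex y by force
    qed simp
  qed
  ultimately show thesis using that u0 u_le by blast
qed

context compact_ab_group
begin

lemma bounded_functional_add:
  "bounded_functional \<Lambda> \<Longrightarrow> continuous_fun f \<Longrightarrow> continuous_fun g \<Longrightarrow> \<Lambda> (\<lambda>x. f x + g x) = \<Lambda> f + \<Lambda> g"
  unfolding bounded_functional_def by blast

lemma fourier_eq_fourier_coeff: "fourier haar \<phi> \<gamma> = fourier_coeff (\<lambda>x. of_real (\<phi> x)) \<gamma>"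
  by (simp add: fourier_def fourier_coeff_def)

lemma continuous_of_real: "continuous_on UNIV \<phi> \<Longrightarrow> continuous_fun (\<lambda>x. of_real (\<phi> x :: real))"
  by (intro continuous_intros)

lemma fourier_coeff_trivial: "fourier_coeff (\<lambda>x. of_real (\<phi> x)) trivial_character = of_real (LINT x|haar. \<phi> x)"
  by (simp add: fourier_coeff_def)

lemma difference_neighbourhood:
  assumes "0 \<in> interior \<Omega>"
  obtains V where "open V" "(0::'a) \<in> V" "\<And>x y. x \<in> V \<Longrightarrow> y \<in> V \<Longrightarrow> x - y \<in> \<Omega>"
proof -
  have "open ((\<lambda>p. fst p - snd p) -` interior \<Omega> :: ('a \<times> 'a) set)"
    by (intro open_vimage continuous_intros) simp
  moreover have "(0, 0) \<in> (\<lambda>p. fst p - snd p) -` interior \<Omega>" using assms by simp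
  ultimately obtain A B where "open A" "open B" "(0, 0) \<in> A \<times> B" "A \<times> B \<subseteq> (\<lambda>p. fst p - snd p) -` interior \<Omega>"
    by (rule open_prod_elim)
  then show thesis using interior_subset[of \<Omega>] by (intro that[of "A \<inter> B"]) (auto simp: subset_iff)
qed

text \<open>
  The function is \<open>w \<star> w\<^sup>*\<close>, normalised at \<open>0\<close>, where \<open>w \<ge> 0\<close> is carried by a neighbourhood \<open>V\<close> with
  \<open>V - V \<subseteq> \<Omega>\<^sub>+\<close>.  It is non-negative everywhere and vanishes off \<open>\<Omega>\<^sub>+\<close>, so it satisfies both sign
  conditions whatever \<open>\<Omega>\<^sub>-\<close> is.
\<close>

lemma function_class_positive_integral:
  assumes "0 \<in> interior \<Omega>p"
  shows "\<exists>\<phi>\<in>function_class haar \<Omega>p \<Omega>m. (LINT x|haar. \<phi> x) > 0"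
proof -
  obtain V where V: "open V" "(0::'a) \<in> V" "\<And>x y. x \<in> V \<Longrightarrow> y \<in> V \<Longrightarrow> x - y \<in> \<Omega>p"
    using difference_neighbourhood[OF assms] by metis
  obtain k :: "'a \<Rightarrow> real" where k: "continuous_on UNIV k" "\<And>x. k x \<ge> 0"
    "\<And>x. x \<notin> V \<Longrightarrow> k x = 0" "(LINT x|haar. k x) = 1" "k 0 > 0"
    using bump_function[OF V(1,2)] by metis
  define w where "w = (\<lambda>x. complex_of_real (k x))"
  have w: "continuous_fun w" unfolding w_def by (rule continuous_of_real[OF k(1)])
  define \<rho> where "\<rho> g = (LINT h|haar. k h * k (h - g))" for g
  have \<rho>: "complex_of_real (\<rho> g) = (w \<star> adjoint_fun w) g" for g
    by (simp add: \<rho>_def convolution_def adjoint_fun_def w_def flip: integral_complex_of_real)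
  have cont: "continuous_on UNIV \<rho>"
    using continuous_on_Re[OF conv_continuous[OF w adjoint_continuous[OF w]]] by (simp flip: \<rho>)
  have \<rho>0: "\<rho> 0 = energy w" using conv_adjoint_at_0[of w] by (simp flip: \<rho>)
  have pos: "energy w > 0" using k(5) by (intro energy_pos[OF w, of 0]) (simp add: w_def)
  have \<rho>_nonneg: "\<rho> g \<ge> 0" for g unfolding \<rho>_def using k(2) by (intro integral_nonneg_AE) auto
  have \<rho>_zero: "\<rho> g = 0" if "g \<notin> \<Omega>p" for g
  proof -
    have "(\<lambda>h. k h * k (h - g)) = (\<lambda>_. 0)"
    proof
      fix h show "k h * k (h - g) = 0"
        using V(3)[of h "h - g"] k(3)[of h] k(3)[of "h - g"] that by auto
    qed
    then show ?thesis by (simp only: \<rho>_def) simp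
  qed
  have coeff: "fourier_coeff (\<lambda>x. of_real (\<rho> x)) \<gamma> = of_real ((cmod (fourier_coeff w \<gamma>))\<^sup>2)"
    if "\<gamma> \<in> dual_group" for \<gamma>
    unfolding \<rho> by (rule fourier_coeff_conv_adjoint[OF w that])
  have "complex_of_real (LINT x|haar. \<rho> x) = of_real ((cmod (fourier_coeff w trivial_character))\<^sup>2)"
    using coeff[OF trivial_in_dual_group] by (simp only: fourier_coeff_trivial)
  moreover have "fourier_coeff w trivial_character = 1"
    unfolding w_def fourier_coeff_trivial using k(4) by simp
  ultimately have int: "(LINT x|haar. \<rho> x) = 1" by (metis norm_one of_real_eq_iff one_power2)
  define \<phi> where "\<phi> x = \<rho> x / energy w" for x
  have "fourier haar \<phi> \<gamma> \<in> \<real>\<^sub>\<ge>\<^sub>0" if \<gamma>: "\<gamma> \<in> dual_group" for \<gamma>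
  proof -
    have "fourier haar \<phi> \<gamma> = fourier_coeff (\<lambda>x. of_real (\<rho> x)) \<gamma> / of_real (energy w)"
      by (simp add: fourier_def fourier_coeff_def \<phi>_def)
    also have "\<dots> = of_real ((cmod (fourier_coeff w \<gamma>))\<^sup>2 / energy w)" by (simp add: coeff[OF \<gamma>])
    finally show ?thesis using pos by (simp only: nonneg_Reals_of_real_iff) simp
  qed
  moreover have "continuous_on UNIV \<phi>" unfolding \<phi>_def using cont pos by (intro continuous_intros) auto
  ultimately have "\<phi> \<in> function_class haar \<Omega>p \<Omega>m"
    using \<rho>_nonneg \<rho>_zero \<rho>0 pos by (simp add: function_class_def \<phi>_def)
  moreover have "(LINT x|haar. \<phi> x) > 0" using pos int by (simp add: \<phi>_def)
  ultimately show ?thesis by blast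
qed

definition nontrivial_characters :: "('a \<Rightarrow> complex) set" where
  "nontrivial_characters = dual_group - {trivial_character}"

lemma nontrivial_subset: "nontrivial_characters \<subseteq> dual_group"
  by (auto simp: nontrivial_characters_def)

lemma function_class_imp_lp_feasible:
  assumes \<phi>: "\<phi> \<in> function_class haar \<Omega>p \<Omega>m" and c: "(LINT x|haar. \<phi> x) > 0"
  shows "\<exists>f\<in>lp_primal_feasible \<Omega>p \<Omega>m.
    (\<Sum>\<^sub>\<infinity>\<gamma>\<in>nontrivial_characters. f \<gamma>) = 1 / (LINT x|haar. \<phi> x) - 1"
proof -
  define c where "c = (LINT x|haar. \<phi> x)"
  have c_pos: "c > 0" using c by (simp add: c_def)
  define g where "g = (\<lambda>x. complex_of_real (\<phi> x))"
  have \<phi>': "continuous_on UNIV \<phi>" "\<phi> 0 = 1" "\<And>\<gamma>. \<gamma> \<in> dual_group \<Longrightarrow> fourier_coeff g \<gamma> \<in> \<real>\<^sub>\<ge>\<^sub>0"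
    "\<And>x. x \<notin> \<Omega>p \<Longrightarrow> \<phi> x \<le> 0" "\<And>x. x \<notin> \<Omega>m \<Longrightarrow> \<phi> x \<ge> 0"
    using \<phi> by (auto simp: function_class_def fourier_eq_fourier_coeff g_def)
  have g: "continuous_fun g" unfolding g_def by (rule continuous_of_real[OF \<phi>'(1)])
  have sum: "(\<lambda>\<gamma>. cmod (fourier_coeff g \<gamma>)) summable_on dual_group"
    by (rule nonneg_fourier_coeffs_summable[OF g \<phi>'(3)])
  have trivial: "fourier_coeff g trivial_character = of_real c"
    unfolding g_def c_def by (rule fourier_coeff_trivial)
  define f where "f \<gamma> = cmod (fourier_coeff g \<gamma>) / c" for \<gamma>
  have f_eq: "complex_of_real (f \<gamma>) = fourier_coeff g \<gamma> / of_real c" if "\<gamma> \<in> dual_group" for \<gamma>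
    using \<phi>'(3)[OF that] c_pos by (auto simp: f_def complex_nonneg_Reals_iff cmod_eq_Re complex_eq_iff)
  have f_sum: "f summable_on dual_group"
    unfolding f_def divide_inverse by (rule summable_on_cmult_left[OF sum])
  have series: "((\<lambda>\<gamma>. complex_of_real (f \<gamma>) * \<gamma> x) has_sum (of_real (\<phi> x / c) - 1)) nontrivial_characters" for x
  proof -
    have "((\<lambda>\<gamma>. fourier_coeff g \<gamma> * \<gamma> x) has_sum g x) dual_group"
      using character_series_has_sum[OF order_refl sum fourier_inversion[OF g sum]] .
    from has_sum_Diff[OF this has_sum_finite[of "{trivial_character}"]]
    have "((\<lambda>\<gamma>. fourier_coeff g \<gamma> * \<gamma> x) has_sum (g x - of_real c)) nontrivial_characters"
      using trivial_in_dual_group by (simp add: nontrivial_characters_def trivial)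
    from has_sum_cmult_right[OF this, of "1 / of_real c"]
    have "((\<lambda>\<gamma>. 1 / of_real c * (fourier_coeff g \<gamma> * \<gamma> x)) has_sum (1 / of_real c * (g x - of_real c))) nontrivial_characters" .
    also have "1 / of_real c * (g x - of_real c) = of_real (\<phi> x / c) - 1"
      using c_pos by (simp add: g_def field_simps)
    also have "((\<lambda>\<gamma>. 1 / of_real c * (fourier_coeff g \<gamma> * \<gamma> x)) has_sum (of_real (\<phi> x / c) - 1)) nontrivial_characters
       \<longleftrightarrow> ((\<lambda>\<gamma>. complex_of_real (f \<gamma>) * \<gamma> x) has_sum (of_real (\<phi> x / c) - 1)) nontrivial_characters"
      using nontrivial_subset by (intro has_sum_cong) (auto simp: f_eq)
    finally show ?thesis .
  qed
  have "f \<in> lp_primal_feasible \<Omega>p \<Omega>m"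
    unfolding lp_primal_feasible_def
  proof (intro CollectI conjI f_sum ballI bexI[of _ "\<lambda>x. \<phi> x / c"] allI)
    show "0 \<le> f \<gamma>" for \<gamma> using c_pos by (simp add: f_def)
    show "complex_of_real (\<phi> x / c) = trivial_character x + (\<Sum>\<^sub>\<infinity>\<gamma>\<in>dual_group - {trivial_character}. complex_of_real (f \<gamma>) * \<gamma> x)" for x
      using infsumI[OF series[of x]] by (simp add: nontrivial_characters_def)
    show "(\<lambda>x. \<phi> x / c) \<in> sign_cone \<Omega>p \<Omega>m"
      using \<phi>' c_pos by (auto simp: sign_cone_def divide_nonpos_pos intro!: continuous_intros)
  qed
  moreover have "(f has_sum (1 / c - 1)) nontrivial_characters"
  proof -
    have "((\<lambda>\<gamma>. complex_of_real (f \<gamma>) * \<gamma> 0) has_sum (of_real (\<phi> 0 / c) - 1)) nontrivial_characters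
       \<longleftrightarrow> ((\<lambda>\<gamma>. complex_of_real (f \<gamma>)) has_sum (of_real (\<phi> 0 / c) - 1)) nontrivial_characters"
      using nontrivial_subset by (intro has_sum_cong) (auto simp: dual_group_at_0)
    moreover have "complex_of_real (\<phi> 0 / c) - 1 = of_real (1 / c - 1)" by (simp add: \<phi>'(2))
    ultimately show ?thesis using series[of 0] by (simp only: has_sum_of_real_iff)
  qed
  ultimately show ?thesis by (metis c_def infsumI)
qed

lemma lp_primal_feasibleD:
  assumes "f \<in> lp_primal_feasible \<Omega>p \<Omega>m"
  obtains \<phi> where "\<phi> \<in> sign_cone \<Omega>p \<Omega>m" "f summable_on nontrivial_characters"
    "\<And>\<gamma>. \<gamma> \<in> nontrivial_characters \<Longrightarrow> f \<gamma> \<ge> 0"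
    "(\<lambda>\<gamma>. cmod (of_real (f \<gamma>))) summable_on nontrivial_characters"
    "\<And>x. complex_of_real (\<phi> x) = 1 + (\<Sum>\<^sub>\<infinity>\<gamma>\<in>nontrivial_characters. of_real (f \<gamma>) * \<gamma> x)"
proof -
  have f: "f summable_on dual_group" "\<And>\<gamma>. \<gamma> \<in> dual_group \<Longrightarrow> f \<gamma> \<ge> 0"
    using assms by (auto simp: lp_primal_feasible_def)
  have fX: "f summable_on nontrivial_characters"
    by (rule summable_on_subset[OF f(1) nontrivial_subset])
  have "(\<lambda>\<gamma>. cmod (of_real (f \<gamma>))) summable_on nontrivial_characters \<longleftrightarrow> f summable_on nontrivial_characters"
    using f(2) nontrivial_subset by (intro summable_on_cong) auto
  moreover obtain \<phi> where "\<phi> \<in> sign_cone \<Omega>p \<Omega>m"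
    "\<And>x. complex_of_real (\<phi> x) = 1 + (\<Sum>\<^sub>\<infinity>\<gamma>\<in>nontrivial_characters. of_real (f \<gamma>) * \<gamma> x)"
    using assms unfolding lp_primal_feasible_def nontrivial_characters_def by auto
  ultimately show thesis using that fX f(2) nontrivial_subset by blast
qed

lemma lp_feasible_imp_function_class:
  assumes f: "f \<in> lp_primal_feasible \<Omega>p \<Omega>m"
  shows "(\<Sum>\<^sub>\<infinity>\<gamma>\<in>nontrivial_characters. f \<gamma>) \<ge> 0 \<and>
    (\<exists>\<phi>\<in>function_class haar \<Omega>p \<Omega>m. (LINT x|haar. \<phi> x) = 1 / (1 + (\<Sum>\<^sub>\<infinity>\<gamma>\<in>nontrivial_characters. f \<gamma>)))"
proof -
  obtain \<phi> where \<phi>: "\<phi> \<in> sign_cone \<Omega>p \<Omega>m" and sum: "f summable_on nontrivial_characters"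
    and nonneg: "\<And>\<gamma>. \<gamma> \<in> nontrivial_characters \<Longrightarrow> f \<gamma> \<ge> 0"
    and abs_sum: "(\<lambda>\<gamma>. cmod (of_real (f \<gamma>))) summable_on nontrivial_characters"
    and \<phi>_eq: "\<And>x. complex_of_real (\<phi> x) = 1 + (\<Sum>\<^sub>\<infinity>\<gamma>\<in>nontrivial_characters. of_real (f \<gamma>) * \<gamma> x)"
    using lp_primal_feasibleD[OF f] by blast
  define S where "S = (\<Sum>\<^sub>\<infinity>\<gamma>\<in>nontrivial_characters. f \<gamma>)"
  have S: "S \<ge> 0" unfolding S_def using nonneg by (rule infsum_nonneg)
  define \<psi> where "\<psi> x = (\<Sum>\<^sub>\<infinity>\<gamma>\<in>nontrivial_characters. complex_of_real (f \<gamma>) * \<gamma> x)" for x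
  have \<psi>: "continuous_fun \<psi>" by (rule character_series_continuous[OF nontrivial_subset abs_sum \<psi>_def])
  have coeff: "fourier_coeff (\<lambda>x. of_real (\<phi> x)) \<gamma> = (if \<gamma> = trivial_character then 1 else of_real (f \<gamma>))"
    if \<gamma>: "\<gamma> \<in> dual_group" for \<gamma>
  proof -
    have "fourier_coeff (\<lambda>x. 1 + \<psi> x) \<gamma> = fourier_coeff trivial_character \<gamma> + fourier_coeff \<psi> \<gamma>"
      by (rule bounded_functional_add[OF bounded_functional_fourier_coeff[OF \<gamma>] continuous_on_const \<psi>])
    then show ?thesis
      using fourier_coeff_character[OF trivial_in_dual_group \<gamma>] \<gamma>
        fourier_coeff_character_series[OF nontrivial_subset abs_sum \<psi>_def \<gamma>]
      by (auto simp: \<phi>_eq \<psi>_def[abs_def] nontrivial_characters_def)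
  qed
  have "\<phi> 0 = 1 + S"
  proof -
    have "\<psi> 0 = (\<Sum>\<^sub>\<infinity>\<gamma>\<in>nontrivial_characters. complex_of_real (f \<gamma>))"
      unfolding \<psi>_def using nontrivial_subset by (intro infsum_cong) (auto simp: dual_group_at_0)
    also have "\<dots> = of_real S"
      unfolding S_def by (rule infsumI[OF has_sum_of_real[OF has_sum_infsum[OF sum]]])
    finally have "complex_of_real (\<phi> 0) = of_real (1 + S)" by (simp add: \<phi>_eq \<psi>_def)
    then show ?thesis by (simp only: of_real_eq_iff)
  qed
  moreover have int: "(LINT x|haar. \<phi> x) = 1"
    using coeff[OF trivial_in_dual_group] by (simp add: fourier_coeff_trivial)
  define \<phi>' where "\<phi>' x = \<phi> x / (1 + S)" for x
  have "fourier haar \<phi>' \<gamma> \<in> \<real>\<^sub>\<ge>\<^sub>0" if \<gamma>: "\<gamma> \<in> dual_group" for \<gamma>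
  proof -
    have "fourier haar \<phi>' \<gamma> = fourier_coeff (\<lambda>x. of_real (\<phi> x)) \<gamma> / of_real (1 + S)"
      by (simp add: fourier_def fourier_coeff_def \<phi>'_def del: of_real_add)
    also have "\<dots> = of_real ((if \<gamma> = trivial_character then 1 else f \<gamma>) / (1 + S))"
      by (simp add: coeff[OF \<gamma>])
    finally show ?thesis
      using S nonneg \<gamma> by (simp only: nonneg_Reals_of_real_iff) (simp add: nontrivial_characters_def)
  qed
  ultimately have "\<phi>' \<in> function_class haar \<Omega>p \<Omega>m"
    using \<phi> S by (auto simp: function_class_def sign_cone_def \<phi>'_def divide_nonpos_pos intro!: continuous_intros)
  moreover have "(LINT x|haar. \<phi>' x) = 1 / (1 + S)" by (simp add: \<phi>'_def int)
  ultimately show ?thesis using S by (auto simp: S_def)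
qed

lemma signed_integral_one:
  "signed_borel_measure \<mu> \<Longrightarrow> signed_integral \<mu> (\<lambda>_::'a. 1 :: complex) = of_real (\<mu> UNIV)"
  using jordan_decomposition[of \<mu> UNIV] by (simp add: signed_integral_def scaleR_conv_of_real)

lemma lp_weak_duality:
  assumes f: "f \<in> lp_primal_feasible \<Omega>p \<Omega>m" and \<mu>: "\<mu> \<in> lp_dual_feasible \<Omega>p \<Omega>m"
  shows "- \<mu> UNIV \<le> (\<Sum>\<^sub>\<infinity>\<gamma>\<in>nontrivial_characters. f \<gamma>)"
proof -
  obtain \<phi> where \<phi>: "\<phi> \<in> sign_cone \<Omega>p \<Omega>m" and sum: "f summable_on nontrivial_characters"
    and nonneg: "\<And>\<gamma>. \<gamma> \<in> nontrivial_characters \<Longrightarrow> f \<gamma> \<ge> 0"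
    and abs_sum: "(\<lambda>\<gamma>. cmod (of_real (f \<gamma>))) summable_on nontrivial_characters"
    and \<phi>_eq: "\<And>x. complex_of_real (\<phi> x) = 1 + (\<Sum>\<^sub>\<infinity>\<gamma>\<in>nontrivial_characters. of_real (f \<gamma>) * \<gamma> x)"
    using lp_primal_feasibleD[OF f] by blast
  have sb: "signed_borel_measure \<mu>" and ge: "signed_integral \<mu> \<phi> \<ge> 0"
    and le: "\<And>\<gamma>. \<gamma> \<in> nontrivial_characters \<Longrightarrow> 1 - signed_integral \<mu> \<gamma> \<in> \<real>\<^sub>\<ge>\<^sub>0"
    using \<mu> \<phi> by (auto simp: lp_dual_feasible_def sign_cone_dual_def regular_signed_measures_def nontrivial_characters_def)
  note bf = bounded_functional_signed_integral[OF sb]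
  define \<psi> where "\<psi> x = (\<Sum>\<^sub>\<infinity>\<gamma>\<in>nontrivial_characters. complex_of_real (f \<gamma>) * \<gamma> x)" for x
  have \<psi>: "continuous_fun \<psi>" by (rule character_series_continuous[OF nontrivial_subset abs_sum \<psi>_def])
  have "((\<lambda>\<gamma>. of_real (f \<gamma>) * signed_integral \<mu> \<gamma>) has_sum signed_integral \<mu> \<psi>) nontrivial_characters"
    by (rule character_series_functional[OF nontrivial_subset abs_sum \<psi>_def bf])
  from has_sum_Re[OF this] has_sum_infsum[OF sum]
  have "Re (signed_integral \<mu> \<psi>) \<le> (\<Sum>\<^sub>\<infinity>\<gamma>\<in>nontrivial_characters. f \<gamma>)"
  proof (rule has_sum_mono)
    fix \<gamma> :: "'a \<Rightarrow> complex" assume \<gamma>: "\<gamma> \<in> nontrivial_characters"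
    have "Re (signed_integral \<mu> \<gamma>) \<le> 1" using le[OF \<gamma>] by (simp add: complex_nonneg_Reals_iff)
    then show "Re (of_real (f \<gamma>) * signed_integral \<mu> \<gamma>) \<le> f \<gamma>"
      using mult_left_mono[of _ 1 "f \<gamma>"] nonneg[OF \<gamma>] by simp
  qed
  moreover have "complex_of_real (signed_integral \<mu> \<phi>) = of_real (\<mu> UNIV) + signed_integral \<mu> \<psi>"
  proof -
    have "complex_of_real (signed_integral \<mu> \<phi>) = signed_integral \<mu> (\<lambda>x. 1 + \<psi> x)"
      unfolding signed_integral_of_real[symmetric] \<phi>_eq \<psi>_def ..
    also have "\<dots> = signed_integral \<mu> (\<lambda>_. 1) + signed_integral \<mu> \<psi>"
      by (rule bounded_functional_add[OF bf continuous_on_const \<psi>])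
    finally show ?thesis by (simp add: signed_integral_one[OF sb])
  qed
  then have "signed_integral \<mu> \<phi> = \<mu> UNIV + Re (signed_integral \<mu> \<psi>)"
    by (metis Re_complex_of_real plus_complex.sel(1))
  ultimately show ?thesis using ge by linarith
qed

lemma function_class_dual_bound:
  assumes \<phi>: "\<phi> \<in> function_class haar \<Omega>p \<Omega>m"
    and \<alpha>: "(\<lambda>A. \<alpha> * dirac 0 A - measure haar A)
        \<in> minkowski_sum (minkowski_diff (M_star \<Omega>m) (M_star \<Omega>p)) (T_zero haar)"
  shows "(LINT x|haar. \<phi> x) \<le> \<alpha>"
proof -
  obtain \<mu> \<nu> \<tau> where \<mu>: "\<mu> \<in> M_star \<Omega>m" and \<nu>: "\<nu> \<in> M_star \<Omega>p" and \<tau>: "\<tau> \<in> T_zero haar"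
    and eq: "(\<lambda>A. \<alpha> * dirac 0 A - measure haar A) = (\<lambda>A. (\<mu> A - \<nu> A) + \<tau> A)"
    using \<alpha> unfolding minkowski_sum_def minkowski_diff_def by auto
  have sb: "signed_borel_measure \<mu>" "signed_borel_measure \<nu>" "signed_borel_measure \<tau>"
    using \<mu> \<nu> \<tau> by (auto simp: M_star_def T_zero_def regular_signed_measures_def)
  have haar_sb: "signed_borel_measure (measure haar)"
    by (rule signed_borel_measure_measure) (simp_all add: finite_measure_axioms)
  define g where "g = (\<lambda>x. complex_of_real (\<phi> x))"
  have \<phi>': "continuous_on UNIV \<phi>" "\<phi> 0 = 1" "\<And>\<gamma>. \<gamma> \<in> dual_group \<Longrightarrow> fourier_coeff g \<gamma> \<in> \<real>\<^sub>\<ge>\<^sub>0"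
    "\<And>x. x \<notin> \<Omega>p \<Longrightarrow> \<phi> x \<le> 0" "\<And>x. x \<notin> \<Omega>m \<Longrightarrow> \<phi> x \<ge> 0"
    using \<phi> by (auto simp: function_class_def fourier_eq_fourier_coeff g_def)
  have g: "continuous_fun g" unfolding g_def by (rule continuous_of_real[OF \<phi>'(1)])
  have "signed_integral \<mu> \<phi> \<ge> 0"
    by (rule M_star_integral_nonneg[OF compact_group \<mu> \<phi>'(1,5)])
  moreover have "signed_integral \<nu> \<phi> \<le> 0"
    using M_star_integral_nonneg[OF compact_group \<nu>, of "\<lambda>x. - \<phi> x"] \<phi>'(1,4)
    by (simp add: continuous_on_minus signed_integral_def)
  moreover have "signed_integral \<tau> \<phi> \<ge> 0"
  proof -
    have sum: "(\<lambda>\<gamma>. cmod (fourier_coeff g \<gamma>)) summable_on dual_group"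
      by (rule nonneg_fourier_coeffs_summable[OF g \<phi>'(3)])
    have "((\<lambda>\<gamma>. fourier_coeff g \<gamma> * signed_integral \<tau> \<gamma>) has_sum signed_integral \<tau> g) dual_group"
      by (rule character_series_functional[OF order_refl sum fourier_inversion[OF g sum] bounded_functional_signed_integral[OF sb(3)]])
    then have "signed_integral \<tau> g \<in> \<real>\<^sub>\<ge>\<^sub>0"
    proof (rule has_sum_nonneg_Reals)
      fix \<gamma> :: "'a \<Rightarrow> complex" assume \<gamma>: "\<gamma> \<in> dual_group"
      have "signed_integral \<tau> \<gamma> \<in> \<real>\<^sub>\<ge>\<^sub>0"
        using \<tau> \<gamma> positive_definite_measure_iff[OF sb(3)] by (auto simp: T_zero_def)
      then show "fourier_coeff g \<gamma> * signed_integral \<tau> \<gamma> \<in> \<real>\<^sub>\<ge>\<^sub>0"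
        by (intro nonneg_Reals_mult_I \<phi>'(3)[OF \<gamma>])
    qed
    then show ?thesis by (simp add: g_def signed_integral_of_real)
  qed
  moreover have "\<alpha> - (LINT x|haar. \<phi> x) = signed_integral \<mu> \<phi> - signed_integral \<nu> \<phi> + signed_integral \<tau> \<phi>"
  proof -
    note lin = signed_integral_linear_measure[OF compact_group \<phi>'(1)]
    have "\<alpha> - (LINT x|haar. \<phi> x) = signed_integral (\<lambda>A. \<alpha> * dirac 0 A + (- 1) * measure haar A) \<phi>"
      unfolding lin[OF signed_borel_measure_dirac haar_sb] signed_integral_dirac[OF compact_group \<phi>'(1)]
      by (subst signed_integral_measure[OF compact_group \<phi>'(1)]) (simp_all add: finite_measure_axioms \<phi>'(2))
    also have "(\<lambda>A. \<alpha> * dirac 0 A + (- 1) * measure haar A) = (\<lambda>A. 1 * (1 * \<mu> A + (- 1) * \<nu> A) + 1 * \<tau> A)"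
      using eq by simp
    also have "signed_integral \<dots> \<phi> = signed_integral \<mu> \<phi> - signed_integral \<nu> \<phi> + signed_integral \<tau> \<phi>"
      unfolding lin[OF signed_borel_measure_linear[OF sb(1,2)] sb(3)] lin[OF sb(1,2)] by simp
    finally show ?thesis .
  qed
  ultimately show ?thesis by linarith
qed

end

section \<open>A minimax theorem and the compact set of coefficient families\<close>

text \<open>
  Induction on the finite set.  On the part of \<open>K\<close> where the new function \<open>g\<close> is non-negative, the induction
  hypothesis supplies \<open>h < 0\<close>.  So the image of \<open>K\<close> under \<open>(h, g)\<close> is a compact convex subset of the
  plane that misses the closed positive quadrant, and a separating line gives a conic combination of
  \<open>h\<close> and \<open>g\<close> that is negative on all of \<open>K\<close>.  Convexity is used only through the values of
  the functions, so \<open>K\<close> can lie in any topological space.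
\<close>

lemma convexlike_minimax_finite:
  fixes G :: "('k::topological_space \<Rightarrow> real) set"
  assumes ne: "G \<noteq> {}"
    and cone: "\<And>g h a b. g \<in> G \<Longrightarrow> h \<in> G \<Longrightarrow> a \<ge> 0 \<Longrightarrow> b \<ge> 0 \<Longrightarrow> (\<lambda>x. a * g x + b * h x) \<in> G"
    and S: "finite S" "S \<subseteq> G"
    and K: "compact K" "\<And>g. g \<in> G \<Longrightarrow> continuous_on K g"
    and convexlike: "\<And>x y t. x \<in> K \<Longrightarrow> y \<in> K \<Longrightarrow> 0 \<le> t \<Longrightarrow> t \<le> 1 \<Longrightarrow>
        \<exists>z\<in>K. \<forall>g\<in>G. g z = (1 - t) * g x + t * g y"
    and neg: "\<And>x. x \<in> K \<Longrightarrow> \<exists>g\<in>S. g x < 0"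
  shows "\<exists>g\<in>G. \<forall>x\<in>K. g x < 0"
  using S K convexlike neg
proof (induction S arbitrary: K rule: finite_induct)
  case empty
  then show ?case using ne by blast
next
  case (insert g S)
  have g: "g \<in> G" and SG: "S \<subseteq> G" using insert.prems(1) by auto
  define K' where "K' = K \<inter> g -` {0..}"
  have "closedin (top_of_set K) K'"
    unfolding K'_def by (intro continuous_closedin_preimage insert.prems(3) g) simp
  then have cpt: "compact K'" using insert.prems(2) by (rule closedin_compact[rotated])
  have "\<exists>h\<in>G. \<forall>x\<in>K'. h x < 0"
  proof (rule insert.IH[OF SG cpt])
    show "continuous_on K' h" if "h \<in> G" for h
      using insert.prems(3)[OF that] by (rule continuous_on_subset) (simp add: K'_def)
    fix x assume x: "x \<in> K'"
    then show "\<exists>h\<in>S. h x < 0" using insert.prems(5)[of x] by (auto simp: K'_def)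
    fix y and t :: real assume y: "y \<in> K'" and t: "0 \<le> t" "t \<le> 1"
    obtain z where z: "z \<in> K" "\<forall>h\<in>G. h z = (1 - t) * h x + t * h y"
      using insert.prems(4)[of x y t] x y t by (auto simp: K'_def)
    have "0 \<le> (1 - t) * g x + t * g y" using x y t by (simp add: K'_def)
    then show "\<exists>z\<in>K'. \<forall>h\<in>G. h z = (1 - t) * h x + t * h y"
      using z g by (intro bexI[of _ z]) (auto simp: K'_def)
  qed
  then obtain h where h: "h \<in> G" "\<And>x. x \<in> K' \<Longrightarrow> h x < 0" by blast
  show ?case
  proof (cases "K = {}")
    case True
    then show ?thesis using ne by blast
  next
    case False
    define I where "I = (\<lambda>x. (h x, g x)) ` K"
    define Q where "Q = {p :: real \<times> real. 0 \<le> fst p \<and> 0 \<le> snd p}"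
    have "compact I"
      unfolding I_def by (intro compact_continuous_image continuous_on_Pair insert.prems h(1) g)
    moreover have "convex I"
      unfolding convex_alt
    proof (intro ballI allI impI)
      fix p q and t :: real assume "p \<in> I" "q \<in> I" "0 \<le> t \<and> t \<le> 1"
      then obtain x y where xy: "x \<in> K" "y \<in> K" "p = (h x, g x)" "q = (h y, g y)" by (auto simp: I_def)
      obtain z where "z \<in> K" "\<forall>g\<in>G. g z = (1 - t) * g x + t * g y"
        using insert.prems(4)[OF xy(1,2)] \<open>0 \<le> t \<and> t \<le> 1\<close> by blast
      then show "(1 - t) *\<^sub>R p + t *\<^sub>R q \<in> I"
        using h(1) g by (auto simp: I_def xy intro!: image_eqI[of _ _ z])
    qed
    moreover have "I \<noteq> {}" using False by (simp add: I_def)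
    moreover have "convex Q"
      by (auto simp: Q_def convex_alt)
    moreover have "closed Q"
      unfolding Q_def by (intro closed_Collect_conj closed_Collect_le continuous_intros)
    moreover have "I \<inter> Q = {}"
    proof -
      have "\<not> (0 \<le> h x \<and> 0 \<le> g x)" if "x \<in> K" for x
        using h(2)[of x] that by (auto simp: K'_def)
      then show ?thesis by (auto simp: I_def Q_def)
    qed
    ultimately have "\<exists>a b. (\<forall>x\<in>I. inner a x < b) \<and> (\<forall>x\<in>Q. inner a x > b)"
      by (intro separating_hyperplane_compact_closed)
    then obtain a b where ab: "\<forall>p\<in>I. inner a p < b" "\<forall>p\<in>Q. b < inner a p" by blast
    obtain a1 a2 where a: "a = (a1, a2)" by (cases a)
    have I: "a1 * h x + a2 * g x < b" if "x \<in> K" for x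
      using ab(1) that by (auto simp: I_def a)
    have Q: "b < a1 * s + a2 * t" if "0 \<le> s" "0 \<le> t" for s t
      using ab(2)[rule_format, of "(s, t)"] that by (simp add: Q_def a)
    have b: "b < 0" using Q[of 0 0] by simp
    have "a1 \<ge> 0"
    proof (rule ccontr)
      assume "\<not> a1 \<ge> 0"
      then show False using Q[of "b / a1" 0] b by (simp add: divide_nonpos_neg)
    qed
    moreover have "a2 \<ge> 0"
    proof (rule ccontr)
      assume "\<not> a2 \<ge> 0"
      then show False using Q[of 0 "b / a2"] b by (simp add: divide_nonpos_neg)
    qed
    ultimately have "(\<lambda>x. a1 * h x + a2 * g x) \<in> G" by (intro cone h(1) g)
    moreover have "a1 * h x + a2 * g x < 0" if "x \<in> K" for x using I[OF that] b by linarith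
    ultimately show ?thesis by (intro bexI[of _ "\<lambda>x. a1 * h x + a2 * g x"]) auto
  qed
qed

lemma convexlike_minimax:
  fixes G :: "('k::topological_space \<Rightarrow> real) set"
  assumes ne: "G \<noteq> {}"
    and cone: "\<And>g h a b. g \<in> G \<Longrightarrow> h \<in> G \<Longrightarrow> a \<ge> 0 \<Longrightarrow> b \<ge> 0 \<Longrightarrow> (\<lambda>x. a * g x + b * h x) \<in> G"
    and K: "compact K" "\<And>g. g \<in> G \<Longrightarrow> continuous_on K g"
    and convexlike: "\<And>x y t. x \<in> K \<Longrightarrow> y \<in> K \<Longrightarrow> 0 \<le> t \<Longrightarrow> t \<le> 1 \<Longrightarrow>
        \<exists>z\<in>K. \<forall>g\<in>G. g z = (1 - t) * g x + t * g y"
    and neg: "\<And>x. x \<in> K \<Longrightarrow> \<exists>g\<in>G. g x < 0"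
  shows "\<exists>g\<in>G. \<forall>x\<in>K. g x < 0"
proof -
  define C where "C = (\<lambda>g. K \<inter> g -` {..<0}) ` G"
  have "\<forall>c\<in>C. openin (top_of_set K) c"
    unfolding C_def by (auto intro!: continuous_openin_preimage_gen K(2))
  moreover have "K \<subseteq> \<Union>C" using neg by (auto simp: C_def)
  ultimately obtain D where D: "D \<subseteq> C" "finite D" "K \<subseteq> \<Union>D"
    using K(1) unfolding compact_eq_openin_cover by meson
  obtain S where S: "S \<subseteq> G" "finite S" "D = (\<lambda>g. K \<inter> g -` {..<0}) ` S"
    using finite_subset_image[OF D(2) D(1)[unfolded C_def]] by blast
  have "\<exists>g\<in>S. g x < 0" if "x \<in> K" for x using D(3) S(3) that by auto
  then show ?thesis
    by (intro convexlike_minimax_finite[OF ne cone S(2,1) K convexlike])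
qed

context compact_ab_group
begin

text \<open>
  Invariance under conjugation makes the associated series real-valued and even.  Mass may escape in a
  pointwise limit, therefore the total mass is bounded by \<open>r\<close> rather than equal to it.
\<close>

definition coefficient_set :: "real \<Rightarrow> (('a \<Rightarrow> complex) \<Rightarrow> real) set" where
  "coefficient_set r = {f. (\<forall>\<gamma>. 0 \<le> f \<gamma>) \<and> (\<forall>\<gamma>. \<gamma> \<notin> nontrivial_characters \<longrightarrow> f \<gamma> = 0) \<and>
     (\<forall>\<gamma>. f (\<lambda>x. cnj (\<gamma> x)) = f \<gamma>) \<and>
     (\<forall>F. finite F \<longrightarrow> F \<subseteq> nontrivial_characters \<longrightarrow> sum f F \<le> r)}"

lemma compact_coefficient_set:
  assumes "r \<ge> 0" shows "compact (coefficient_set r)"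
proof -
  have "compact (PiE UNIV (\<lambda>_. {0..r}) :: (('a \<Rightarrow> complex) \<Rightarrow> real) set)"
    using compactin_PiE[of "\<lambda>_. euclideanreal" "UNIV :: ('a \<Rightarrow> complex) set" "\<lambda>_. {0..r}"]
    by (simp add: euclidean_product_topology)
  moreover have "closed (coefficient_set r)"
  proof -
    have coord: "continuous_on UNIV (\<lambda>f :: ('a \<Rightarrow> complex) \<Rightarrow> real. f \<gamma>)" for \<gamma> by simp
    show ?thesis
      unfolding coefficient_set_def
      by (intro closed_Collect_conj closed_Collect_all closed_Collect_imp closed_Collect_le
          closed_Collect_eq continuous_on_sum coord continuous_on_const open_Collect_const)
  qed
  moreover have "coefficient_set r \<subseteq> PiE UNIV (\<lambda>_. {0..r})"
  proof
    fix f assume f: "f \<in> coefficient_set r"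
    have "f \<gamma> \<le> r" for \<gamma>
    proof (cases "\<gamma> \<in> nontrivial_characters")
      case True
      have "\<forall>F. finite F \<longrightarrow> F \<subseteq> nontrivial_characters \<longrightarrow> sum f F \<le> r" using f by (simp add: coefficient_set_def)
      from this[rule_format, of "{\<gamma>}"] show ?thesis using True by simp
    qed (use f assms in \<open>auto simp: coefficient_set_def\<close>)
    then show "f \<in> PiE UNIV (\<lambda>_. {0..r})" using f by (auto simp: coefficient_set_def)
  qed
  ultimately show ?thesis by (metis compact_Int_closed inf.absorb_iff2)
qed

lemma coefficient_setD:
  assumes "f \<in> coefficient_set r"
  shows "f \<gamma> \<ge> 0" "f summable_on nontrivial_characters" "(\<Sum>\<^sub>\<infinity>\<gamma>\<in>nontrivial_characters. f \<gamma>) \<le> r"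
    "(\<lambda>\<gamma>. cmod (of_real (f \<gamma>))) summable_on nontrivial_characters"
proof -
  have f: "\<And>\<gamma>. f \<gamma> \<ge> 0" "\<And>F. finite F \<Longrightarrow> F \<subseteq> nontrivial_characters \<Longrightarrow> sum f F \<le> r"
    using assms by (auto simp: coefficient_set_def)
  then show "f \<gamma> \<ge> 0" by blast
  show sum: "f summable_on nontrivial_characters"
    using f by (intro nonneg_bdd_above_summable_on bdd_aboveI2[of _ _ r]) auto
  show "(\<Sum>\<^sub>\<infinity>\<gamma>\<in>nontrivial_characters. f \<gamma>) \<le> r" by (rule infsum_le_finite_sums[OF sum f(2)])
  show "(\<lambda>\<gamma>. cmod (of_real (f \<gamma>))) summable_on nontrivial_characters" using sum f(1) by simp
qed

definition series_fun :: "(('a \<Rightarrow> complex) \<Rightarrow> real) \<Rightarrow> 'a \<Rightarrow> complex" where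
  "series_fun f x = (\<Sum>\<^sub>\<infinity>\<gamma>\<in>nontrivial_characters. of_real (f \<gamma>) * \<gamma> x)"

lemma nontrivial_cnj: "\<gamma> \<in> nontrivial_characters \<Longrightarrow> (\<lambda>x. cnj (\<gamma> x)) \<in> nontrivial_characters"
  by (auto simp: nontrivial_characters_def intro: dual_group_cnj) (metis complex_cnj_cnj complex_cnj_one)

context
  fixes f r assumes f: "f \<in> coefficient_set r"
begin

lemma series_fun_continuous: "continuous_fun (series_fun f)"
  by (rule character_series_continuous[OF nontrivial_subset coefficient_setD(4)[OF f] series_fun_def])

lemma series_fun_cnj: "cnj (series_fun f x) = series_fun f x"
proof -
  have "cnj (series_fun f x) = (\<Sum>\<^sub>\<infinity>\<gamma>\<in>nontrivial_characters. of_real (f \<gamma>) * cnj (\<gamma> x))"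
    unfolding series_fun_def by (simp flip: infsum_cnj)
  also have "\<dots> = series_fun f x"
    unfolding series_fun_def
    by (rule infsum_reindex_bij_witness[of _ "\<lambda>\<gamma> x. cnj (\<gamma> x)" "\<lambda>\<gamma> x. cnj (\<gamma> x)"])
       (use f in \<open>auto simp: nontrivial_cnj coefficient_set_def\<close>)
  finally show ?thesis .
qed

lemma series_fun_minus: "series_fun f (- x) = series_fun f x"
proof -
  have "series_fun f (- x) = (\<Sum>\<^sub>\<infinity>\<gamma>\<in>nontrivial_characters. cnj (of_real (f \<gamma>) * \<gamma> x))"
    unfolding series_fun_def using nontrivial_subset by (intro infsum_cong) (auto simp: dual_group_minus)
  also have "\<dots> = cnj (series_fun f x)" unfolding series_fun_def by (rule infsum_cnj)
  finally show ?thesis by (simp add: series_fun_cnj)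
qed

lemma series_fun_real: "complex_of_real (Re (series_fun f x)) = series_fun f x"
  using series_fun_cnj[of x] by (simp add: complex_eq_iff)

end

text \<open>
  The integral of the real function \<open>\<one> + \<Sum> f(\<gamma>) \<gamma>\<close> against the density \<open>p\<close>; feasibility of \<open>f\<close> will be
  tested through these numbers.
\<close>

definition pairing :: "('a \<Rightarrow> real) \<Rightarrow> (('a \<Rightarrow> complex) \<Rightarrow> real) \<Rightarrow> real" where
  "pairing p f = (LINT x|haar. (1 + Re (series_fun f x)) * p x)"

definition bounded_borel :: "('a \<Rightarrow> real) \<Rightarrow> bool" where
  "bounded_borel p \<longleftrightarrow> p \<in> borel_measurable borel \<and> (\<exists>B. \<forall>x. \<bar>p x\<bar> \<le> B)"

lemma bounded_borel_integrable:
  fixes h :: "'a \<Rightarrow> 'b::{banach, second_countable_topology}"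
  assumes p: "bounded_borel p" and h: "continuous_on UNIV h"
  shows "integrable haar (\<lambda>x. p x *\<^sub>R h x)"
proof -
  obtain B where p': "p \<in> borel_measurable borel" "\<And>x. \<bar>p x\<bar> \<le> B" using p by (auto simp: bounded_borel_def)
  obtain L where L: "\<And>x. norm (h x) \<le> L"
    using continuous_bounded_on_compact[OF compact_group h] by metis
  have [measurable]: "h \<in> borel_measurable borel" by (rule borel_measurable_continuous_onI[OF h])
  show ?thesis
  proof (rule integrable_bounded_borel)
    show "(\<lambda>x. p x *\<^sub>R h x) \<in> borel_measurable borel" using p'(1) by measurable
    show "norm (p x *\<^sub>R h x) \<le> B * L" for x
      using p'(2) L order_trans[OF abs_ge_zero p'(2)] by (auto intro!: mult_mono)
  qed (simp_all add: finite_measure_axioms)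
qed

lemma pairing_expansion:
  assumes p: "bounded_borel p" and f: "f \<in> coefficient_set r"
  shows "((\<lambda>\<gamma>. f \<gamma> * Re (LINT x|haar. \<gamma> x * of_real (p x))) has_sum (pairing p f - (LINT x|haar. p x))) nontrivial_characters"
proof -
  obtain B where p': "p \<in> borel_measurable borel" "\<And>x. \<bar>p x\<bar> \<le> B" using p by (auto simp: bounded_borel_def)
  note cont = series_fun_continuous[OF f]
  have "bounded_functional (\<lambda>h. LINT x|haar. h x * complex_of_real (p x))"
    by (rule bounded_functional_integral[where K = B]) (use p' in auto)
  from has_sum_Re[OF character_series_functional[OF nontrivial_subset coefficient_setD(4)[OF f] series_fun_def this]]
  have "((\<lambda>\<gamma>. f \<gamma> * Re (LINT x|haar. \<gamma> x * of_real (p x))) has_sum Re (LINT x|haar. series_fun f x * of_real (p x))) nontrivial_characters"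
    by simp
  moreover have "Re (LINT x|haar. series_fun f x * of_real (p x)) = pairing p f - (LINT x|haar. p x)"
  proof -
    have "(LINT x|haar. series_fun f x * of_real (p x)) = (LINT x|haar. complex_of_real (Re (series_fun f x) * p x))"
      by (simp add: series_fun_real[OF f])
    also have "\<dots> = of_real (LINT x|haar. Re (series_fun f x) * p x)" by (rule integral_complex_of_real)
    finally have "Re (LINT x|haar. series_fun f x * of_real (p x)) = (LINT x|haar. Re (series_fun f x) * p x)" by simp
    moreover have "integrable haar p" using bounded_borel_integrable[OF p, of "\<lambda>_. 1 :: real"] by simp
    moreover have "integrable haar (\<lambda>x. Re (series_fun f x) * p x)"
      using bounded_borel_integrable[OF p, of "\<lambda>x. Re (series_fun f x)"] cont by (simp add: mult.commute continuous_on_Re)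
    ultimately show ?thesis by (simp add: pairing_def distrib_right)
  qed
  ultimately show ?thesis by simp
qed

text \<open>
  By Bessel's inequality only finitely many Fourier coefficients of \<open>p\<close> exceed \<open>\<delta>\<close>; the other terms of the
  expansion contribute at most \<open>\<delta> r\<close>.  So the pairing is a uniform limit of functions of finitely many
  coordinates.  On infinite groups measures with atoms lack this property, which is why the
  sign conditions are tested on densities and not on points.
\<close>

lemma continuous_on_pairing:
  assumes p: "bounded_borel p" and r: "r \<ge> 0"
  shows "continuous_on (coefficient_set r) (pairing p)"
proof (rule continuous_on_uniform_approximation)
  fix \<epsilon> :: real assume \<epsilon>: "\<epsilon> > 0"
  obtain B where p': "p \<in> borel_measurable borel" "\<And>x. \<bar>p x\<bar> \<le> B" using p by (auto simp: bounded_borel_def)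
  define q where "q \<gamma> = Re (LINT x|haar. \<gamma> x * of_real (p x))" for \<gamma> :: "'a \<Rightarrow> complex"
  \<comment> \<open>\<open>r + 1\<close> instead of \<open>r\<close>, which may be zero.\<close>
  define \<delta> where "\<delta> = \<epsilon> / (r + 1)"
  have \<delta>: "\<delta> > 0" using \<epsilon> r by (simp add: \<delta>_def)
  define F where "F = {\<gamma> \<in> nontrivial_characters. \<bar>q \<gamma>\<bar> > \<delta>}"
  have q_le: "\<bar>q \<gamma>\<bar> \<le> cmod (fourier_coeff (\<lambda>x. of_real (p x)) \<gamma>)" for \<gamma>
  proof -
    have "(LINT x|haar. \<gamma> x * of_real (p x)) = (LINT x|haar. cnj (of_real (p x) * cnj (\<gamma> x)))" by (simp add: mult.commute)
    also have "\<dots> = cnj (fourier_coeff (\<lambda>x. of_real (p x)) \<gamma>)" unfolding fourier_coeff_def by (rule Bochner_Integration.integral_cnj)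
    finally show ?thesis unfolding q_def using abs_Re_le_cmod by (metis complex_mod_cnj)
  qed
  have "finite F"
  proof (rule ccontr)
    assume "infinite F"
    define E where "E = energy (\<lambda>x. complex_of_real (p x))"
    obtain n :: nat where n: "real n > E / \<delta>\<^sup>2" using reals_Archimedean2 by blast
    obtain F' where F': "F' \<subseteq> F" "finite F'" "card F' = n" using infinite_arbitrarily_large[OF \<open>infinite F\<close>] by metis
    have "real n * \<delta>\<^sup>2 = (\<Sum>\<gamma>\<in>F'. \<delta>\<^sup>2)" by (simp add: F'(3))
    also have "\<dots> \<le> (\<Sum>\<gamma>\<in>F'. (cmod (fourier_coeff (\<lambda>x. of_real (p x)) \<gamma>))\<^sup>2)"
    proof (intro sum_mono power_mono)
      fix \<gamma> assume "\<gamma> \<in> F'"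
      then have "\<bar>q \<gamma>\<bar> > \<delta>" using F'(1) by (auto simp: F_def)
      then show "\<delta> \<le> cmod (fourier_coeff (\<lambda>x. of_real (p x)) \<gamma>)" using q_le[of \<gamma>] by linarith
    qed (use \<delta> in simp)
    also have "\<dots> \<le> E"
      unfolding E_def
    proof (rule bessel_inequality[OF _ _ F'(2)])
      show "(\<lambda>x. complex_of_real (p x)) \<in> borel_measurable borel" using p'(1) by measurable
      show "cmod (complex_of_real (p x)) \<le> B" for x using p'(2) by simp
      show "F' \<subseteq> dual_group" using F'(1) nontrivial_subset by (auto simp: F_def)
    qed
    finally show False using n \<delta> by (simp add: field_simps)
  qed
  show "\<exists>h. continuous_on (coefficient_set r) h \<and> (\<forall>f\<in>coefficient_set r. dist (pairing p f) (h f) \<le> \<epsilon>)"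
  proof (intro exI conjI ballI)
    show "continuous_on (coefficient_set r) (\<lambda>f. (LINT x|haar. p x) + (\<Sum>\<gamma>\<in>F. f \<gamma> * q \<gamma>))"
      by (intro continuous_intros continuous_on_subset[OF continuous_on_product_coordinates]) simp
    fix f assume f: "f \<in> coefficient_set r"
    have FX: "F \<subseteq> nontrivial_characters" by (auto simp: F_def)
    have "((\<lambda>\<gamma>. f \<gamma> * q \<gamma>) has_sum (pairing p f - (LINT x|haar. p x) - (\<Sum>\<gamma>\<in>F. f \<gamma> * q \<gamma>))) (nontrivial_characters - F)"
      using \<open>finite F\<close> FX unfolding q_def by (intro has_sum_Diff pairing_expansion[OF p f] has_sum_finite) auto
    moreover have "((\<lambda>\<gamma>. \<delta> * f \<gamma>) has_sum (\<delta> * ((\<Sum>\<^sub>\<infinity>\<gamma>\<in>nontrivial_characters. f \<gamma>) - sum f F))) (nontrivial_characters - F)"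
      using \<open>finite F\<close> FX by (intro has_sum_cmult_right has_sum_Diff has_sum_infsum coefficient_setD(2)[OF f] has_sum_finite) auto
    ultimately have "norm (pairing p f - (LINT x|haar. p x) - (\<Sum>\<gamma>\<in>F. f \<gamma> * q \<gamma>))
        \<le> \<delta> * ((\<Sum>\<^sub>\<infinity>\<gamma>\<in>nontrivial_characters. f \<gamma>) - sum f F)"
    proof (rule norm_infsum_le)
      fix \<gamma> assume "\<gamma> \<in> nontrivial_characters - F"
      then have "\<bar>q \<gamma>\<bar> \<le> \<delta>" by (auto simp: F_def)
      then show "norm (f \<gamma> * q \<gamma>) \<le> \<delta> * f \<gamma>"
        using coefficient_setD(1)[OF f, of \<gamma>] by (simp add: abs_mult mult.commute[of \<delta>] mult_left_mono)
    qed
    also have "\<dots> \<le> \<delta> * (r + 1)"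
      using coefficient_setD(3)[OF f] \<delta> sum_nonneg[of F f] coefficient_setD(1)[OF f] by (intro mult_left_mono) auto
    also have "\<dots> = \<epsilon>" using r by (simp add: \<delta>_def)
    finally show "dist (pairing p f) ((LINT x|haar. p x) + (\<Sum>\<gamma>\<in>F. f \<gamma> * q \<gamma>)) \<le> \<epsilon>"
      by (simp add: dist_norm algebra_simps)
  qed
qed

lemma coefficient_set_convex:
  assumes f: "f \<in> coefficient_set r" and g: "g \<in> coefficient_set r" and t: "0 \<le> t" "t \<le> 1"
  shows "(\<lambda>\<gamma>. (1 - t) * f \<gamma> + t * g \<gamma>) \<in> coefficient_set r"
proof -
  have "(\<Sum>\<gamma>\<in>F. (1 - t) * f \<gamma> + t * g \<gamma>) \<le> r" if F: "finite F" "F \<subseteq> nontrivial_characters" for F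
  proof -
    have "(\<Sum>\<gamma>\<in>F. (1 - t) * f \<gamma> + t * g \<gamma>) = (1 - t) * sum f F + t * sum g F"
      by (simp add: sum.distrib sum_distrib_left)
    also have "\<dots> \<le> (1 - t) * r + t * r"
      using f g t F by (intro add_mono mult_left_mono) (auto simp: coefficient_set_def)
    finally show ?thesis by (simp add: algebra_simps)
  qed
  then show ?thesis using f g t by (auto simp: coefficient_set_def)
qed

lemma pairing_affine:
  assumes p: "bounded_borel p" and f: "f \<in> coefficient_set r" and g: "g \<in> coefficient_set r"
    and t: "0 \<le> t" "t \<le> 1"
  shows "pairing p (\<lambda>\<gamma>. (1 - t) * f \<gamma> + t * g \<gamma>) = (1 - t) * pairing p f + t * pairing p g"
proof -
  let ?q = "\<lambda>\<gamma> :: 'a \<Rightarrow> complex. Re (LINT x|haar. \<gamma> x * of_real (p x))"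
  let ?m = "LINT x|haar. p x"
  have "((\<lambda>\<gamma>. (1 - t) * (f \<gamma> * ?q \<gamma>) + t * (g \<gamma> * ?q \<gamma>)) has_sum ((1 - t) * (pairing p f - ?m) + t * (pairing p g - ?m))) nontrivial_characters"
    by (intro has_sum_add has_sum_cmult_right pairing_expansion[OF p f] pairing_expansion[OF p g])
  then have "((\<lambda>\<gamma>. ((1 - t) * f \<gamma> + t * g \<gamma>) * ?q \<gamma>) has_sum ((1 - t) * (pairing p f - ?m) + t * (pairing p g - ?m))) nontrivial_characters"
    by (simp add: distrib_right mult.assoc)
  from has_sum_unique[OF pairing_expansion[OF p coefficient_set_convex[OF f g t]] this]
  show ?thesis by (simp add: algebra_simps)
qed

end

section \<open>Strong duality\<close>

context compact_ab_group
begin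

text \<open>
  For \<open>\<Omega> = \<Omega>\<^sub>-\<close> and \<open>\<Omega> = \<Omega>\<^sub>+\<close> these are the densities \<open>a\<close> and \<open>b\<close> of the two cones of measures.  Evenness
  makes their Fourier coefficients real.
\<close>

definition even_density :: "'a set \<Rightarrow> ('a \<Rightarrow> real) \<Rightarrow> bool" where
  "even_density \<Omega> a \<longleftrightarrow> bounded_borel a \<and> (\<forall>x. 0 \<le> a x) \<and> (\<forall>x. a (- x) = a x) \<and> (\<forall>x\<in>\<Omega>. a x = 0)"

lemma bounded_borel_linear:
  assumes "bounded_borel p" "bounded_borel q"
  shows "bounded_borel (\<lambda>x. s * p x + t * q x)"
proof -
  obtain A B where A: "\<And>x. \<bar>p x\<bar> \<le> A" and B: "\<And>x. \<bar>q x\<bar> \<le> B"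
    using assms by (auto simp: bounded_borel_def)
  have "\<bar>s * p x + t * q x\<bar> \<le> \<bar>s\<bar> * A + \<bar>t\<bar> * B" for x
    using A[of x] B[of x]
    by (intro order_trans[OF abs_triangle_ineq] add_mono) (auto simp: abs_mult intro!: mult_left_mono)
  moreover have "(\<lambda>x. s * p x + t * q x) \<in> borel_measurable borel"
    using assms by (auto simp: bounded_borel_def)
  ultimately show ?thesis unfolding bounded_borel_def by blast
qed

lemma even_density_linear:
  assumes "even_density \<Omega> a" "even_density \<Omega> b" "s \<ge> 0" "t \<ge> 0"
  shows "even_density \<Omega> (\<lambda>x. s * a x + t * b x)"
  using assms bounded_borel_linear[of a b s t] by (auto simp: even_density_def)

lemma even_density_zero: "even_density \<Omega> (\<lambda>_. 0)"
  by (auto simp: even_density_def bounded_borel_def)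

lemma even_density_indicator:
  assumes "A \<in> sets borel" "uminus ` A = A" "A \<subseteq> - \<Omega>"
  shows "even_density \<Omega> (indicator A)"
proof -
  have "- x \<in> A \<longleftrightarrow> x \<in> A" for x using assms(2) by (metis imageI minus_minus)
  then show ?thesis
    using assms(1,3) by (auto simp: even_density_def bounded_borel_def indicator_def intro!: exI[of _ 1])
qed

lemma pairing_linear:
  assumes p: "bounded_borel p" and q: "bounded_borel q" and f: "f \<in> coefficient_set r"
  shows "pairing (\<lambda>x. s * p x + t * q x) f = s * pairing p f + t * pairing q f"
proof -
  have "continuous_on UNIV (\<lambda>x. 1 + Re (series_fun f x))"
    by (intro continuous_intros series_fun_continuous[OF f])
  then have "integrable haar (\<lambda>x. (1 + Re (series_fun f x)) * p x)" "integrable haar (\<lambda>x. (1 + Re (series_fun f x)) * q x)"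
    using bounded_borel_integrable[OF p] bounded_borel_integrable[OF q] by (force simp: mult.commute)+
  moreover have "(1 + Re (series_fun f x)) * (s * p x + t * q x)
      = s * ((1 + Re (series_fun f x)) * p x) + t * ((1 + Re (series_fun f x)) * q x)" for x
    by (simp add: algebra_simps)
  ultimately show ?thesis by (simp add: pairing_def)
qed

lemma integral_positive_on_indicator:
  fixes \<phi> :: "'a \<Rightarrow> real"
  assumes \<phi>: "continuous_on UNIV \<phi>" and A: "A \<in> sets borel" "emeasure haar A > 0" "\<And>x. x \<in> A \<Longrightarrow> \<phi> x > 0"
  shows "(LINT x|haar. \<phi> x * indicator A x) > 0"
proof -
  have int: "integrable haar (\<lambda>x. \<phi> x * indicator A x)"
    using integrable_mult_indicator[of A haar \<phi>] A(1) integrable_continuous[OF \<phi>] by (simp add: mult.commute)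
  have nonneg: "AE x in haar. 0 \<le> \<phi> x * indicator A x"
    using A(3) by (intro AE_I2) (auto simp: indicator_def less_imp_le)
  have "(LINT x|haar. \<phi> x * indicator A x) \<noteq> 0"
  proof
    assume "(LINT x|haar. \<phi> x * indicator A x) = 0"
    then have "AE x in haar. \<phi> x * indicator A x = 0"
      using integral_nonneg_eq_0_iff_AE[OF int nonneg] by simp
    then have "AE x in haar. x \<notin> A"
    proof eventually_elim
      case (elim x)
      then show ?case using A(3)[of x] by (auto simp: indicator_def)
    qed
    then have "emeasure haar A = 0"
      using A(1) by (subst (asm) AE_iff_measurable[of A]) auto
    then show False using A(2) by simp
  qed
  moreover have "(LINT x|haar. \<phi> x * indicator A x) \<ge> 0" using nonneg by (rule integral_nonneg_AE)
  ultimately show ?thesis by linarith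
qed

text \<open>
  This is where Assumption O enters: if \<open>\<phi> > 0\<close> at a point off \<open>\<Omega>\<close>, then \<open>{\<phi> > 0} - \<Omega>\<close> has positive
  measure.  It is symmetric as well, so its indicator is an admissible density that detects the violation.
\<close>

lemma nonpos_off_if_integrals_nonpos:
  fixes \<phi> :: "'a \<Rightarrow> real"
  assumes \<phi>: "continuous_on UNIV \<phi>" "\<And>x. \<phi> (- x) = \<phi> x"
    and \<Omega>: "\<Omega> \<in> sets borel" "uminus ` \<Omega> = \<Omega>" "assumption_O haar (- \<Omega>)"
    and le: "\<And>a. even_density \<Omega> a \<Longrightarrow> (LINT x|haar. \<phi> x * a x) \<le> 0"
    and x: "x \<notin> \<Omega>"
  shows "\<phi> x \<le> 0"
proof (rule ccontr)
  assume pos: "\<not> \<phi> x \<le> 0"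
  define V where "V = {x. 0 < \<phi> x}"
  have V: "open V" unfolding V_def by (intro open_Collect_less \<phi>(1) continuous_intros)
  define A where "A = V \<inter> - \<Omega>"
  have A: "A \<in> sets borel" unfolding A_def using V \<Omega>(1) by auto
  have "emeasure haar A > 0"
    using \<Omega>(3) V pos x unfolding assumption_O_def A_def by (auto simp: V_def)
  then have "(LINT x|haar. \<phi> x * indicator A x) > 0"
    by (rule integral_positive_on_indicator[OF \<phi>(1) A]) (auto simp: A_def V_def)
  moreover have "even_density \<Omega> (indicator A)"
  proof (rule even_density_indicator[OF A])
    have "- y \<in> A" if "y \<in> A" for y
    proof -
      have "- y \<notin> \<Omega>" using that \<Omega>(2) unfolding A_def by (metis ComplD IntD2 imageI minus_minus)
      then show ?thesis using that \<phi>(2) by (simp add: A_def V_def)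
    qed
    then show "uminus ` A = A" by (force simp: image_iff intro!: bexI[of _ "- _"])
  qed (auto simp: A_def)
  ultimately show False using le by force
qed

text \<open>
  Every member of the compact set of coefficient families is infeasible, hence some density
  \<open>a - b\<close> pairs negatively with it; the minimax theorem makes the density independent of the family.
\<close>

lemma separating_density:
  assumes \<Omega>p: "\<Omega>p \<in> sets borel" "uminus ` \<Omega>p = \<Omega>p" "assumption_O haar (- \<Omega>p)"
    and \<Omega>m: "\<Omega>m \<in> sets borel" "uminus ` \<Omega>m = \<Omega>m" "assumption_O haar (- \<Omega>m)"
    and r: "r \<ge> 0"
    and infeasible: "\<And>f. f \<in> lp_primal_feasible \<Omega>p \<Omega>m \<Longrightarrow> r < (\<Sum>\<^sub>\<infinity>\<gamma>\<in>nontrivial_characters. f \<gamma>)"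
  shows "\<exists>a b. even_density \<Omega>m a \<and> even_density \<Omega>p b \<and>
    (\<forall>f\<in>coefficient_set r. pairing (\<lambda>x. a x - b x) f < 0)"
proof -
  let ?K = "coefficient_set r"
  \<comment> \<open>Off \<open>?K\<close> the series need not converge, and the value \<open>0\<close> keeps the pairing linear in the density.\<close>
  define g where "g a b f = (if f \<in> ?K then pairing (\<lambda>x. a x - b x) f else 0)" for a b f
  define G where "G = {g a b |a b. even_density \<Omega>m a \<and> even_density \<Omega>p b}"
  have bb: "bounded_borel (\<lambda>x. a x - b x)" if "even_density \<Omega>m a" "even_density \<Omega>p b" for a b
    using bounded_borel_linear[of a b 1 "-1"] that by (simp add: even_density_def)
  have "\<exists>h\<in>G. \<forall>f\<in>?K. h f < 0"
  proof (rule convexlike_minimax)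
    show "G \<noteq> {}" using even_density_zero by (auto simp: G_def)
    show "compact ?K" by (rule compact_coefficient_set[OF r])
    show "continuous_on ?K h" if "h \<in> G" for h
    proof -
      obtain a b where ab: "even_density \<Omega>m a" "even_density \<Omega>p b" "h = g a b" using \<open>h \<in> G\<close> by (auto simp: G_def)
      have "continuous_on ?K (g a b) \<longleftrightarrow> continuous_on ?K (pairing (\<lambda>x. a x - b x))"
        by (intro continuous_on_cong refl) (simp add: g_def)
      then show ?thesis using continuous_on_pairing[OF bb[OF ab(1,2)] r] by (simp add: ab(3))
    qed
    show "(\<lambda>f. s * h f + t * k f) \<in> G" if "h \<in> G" "k \<in> G" "s \<ge> 0" "t \<ge> 0" for h k s t
    proof -
      obtain a b c d where ab: "even_density \<Omega>m a" "even_density \<Omega>p b" "h = g a b"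
        and cd: "even_density \<Omega>m c" "even_density \<Omega>p d" "k = g c d"
        using \<open>h \<in> G\<close> \<open>k \<in> G\<close> by (auto simp: G_def)
      have eq: "(\<lambda>x. (s * a x + t * c x) - (s * b x + t * d x)) = (\<lambda>x. s * (a x - b x) + t * (c x - d x))"
        by (auto simp: algebra_simps)
      have "(\<lambda>f. s * h f + t * k f) = g (\<lambda>x. s * a x + t * c x) (\<lambda>x. s * b x + t * d x)"
        by (rule ext) (simp add: g_def ab(3) cd(3) eq pairing_linear[OF bb[OF ab(1,2)] bb[OF cd(1,2)]])
      then show ?thesis
        using even_density_linear[OF ab(1) cd(1) that(3,4)] even_density_linear[OF ab(2) cd(2) that(3,4)]
        unfolding G_def by blast
    qed
    show "\<exists>z\<in>?K. \<forall>h\<in>G. h z = (1 - t) * h x + t * h y"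
      if xy: "x \<in> ?K" "y \<in> ?K" and t: "0 \<le> t" "t \<le> 1" for x y t
    proof (intro bexI ballI)
      show z: "(\<lambda>\<gamma>. (1 - t) * x \<gamma> + t * y \<gamma>) \<in> ?K" by (rule coefficient_set_convex[OF xy t])
      fix h assume "h \<in> G"
      then obtain a b where "even_density \<Omega>m a" "even_density \<Omega>p b" "h = g a b" by (auto simp: G_def)
      then show "h (\<lambda>\<gamma>. (1 - t) * x \<gamma> + t * y \<gamma>) = (1 - t) * h x + t * h y"
        using z xy pairing_affine[OF bb xy t] by (simp add: g_def)
    qed
    show "\<exists>h\<in>G. h f < 0" if f: "f \<in> ?K" for f
    proof (rule ccontr)
      assume "\<not> (\<exists>h\<in>G. h f < 0)"
      then have nonneg: "0 \<le> pairing (\<lambda>x. a x - b x) f" if "even_density \<Omega>m a" "even_density \<Omega>p b" for a b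
        using that f unfolding G_def g_def by (force simp: not_less)
      define \<phi> where "\<phi> x = 1 + Re (series_fun f x)" for x
      have \<phi>: "continuous_on UNIV \<phi>" "\<And>x. \<phi> (- x) = \<phi> x"
        unfolding \<phi>_def by (intro continuous_intros series_fun_continuous[OF f]) (simp add: series_fun_minus[OF f])
      have "\<phi> x \<le> 0" if "x \<notin> \<Omega>p" for x
      proof (rule nonpos_off_if_integrals_nonpos[OF \<phi> \<Omega>p _ that])
        show "(LINT x|haar. \<phi> x * b x) \<le> 0" if "even_density \<Omega>p b" for b
          using nonneg[OF even_density_zero that] by (simp add: pairing_def \<phi>_def)
      qed
      moreover have "- \<phi> x \<le> 0" if "x \<notin> \<Omega>m" for x
      proof (rule nonpos_off_if_integrals_nonpos[OF _ _ \<Omega>m _ that])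
        show "(LINT x|haar. - \<phi> x * a x) \<le> 0" if "even_density \<Omega>m a" for a
          using nonneg[OF that even_density_zero]
          by (simp only: pairing_def \<phi>_def[symmetric] diff_0_right mult_minus_left
              Bochner_Integration.integral_minus neg_le_0_iff_le)
      qed (use \<phi> in \<open>auto intro: continuous_on_minus\<close>)
      ultimately have cone: "\<phi> \<in> sign_cone \<Omega>p \<Omega>m" using \<phi>(1) by (simp add: sign_cone_def)
      have "f \<in> lp_primal_feasible \<Omega>p \<Omega>m"
        unfolding lp_primal_feasible_def
      proof (intro CollectI conjI ballI bexI[OF _ cone] allI)
        have "f summable_on insert trivial_character nontrivial_characters"
          using coefficient_setD(2)[OF f] by (simp add: summable_on_insert_iff)
        then show "f summable_on dual_group"
          using trivial_in_dual_group by (simp add: nontrivial_characters_def insert_absorb)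
        show "0 \<le> f \<gamma>" for \<gamma> by (rule coefficient_setD(1)[OF f])
        show "complex_of_real (\<phi> x) = trivial_character x + (\<Sum>\<^sub>\<infinity>\<gamma>\<in>dual_group - {trivial_character}. complex_of_real (f \<gamma>) * \<gamma> x)" for x
          using series_fun_real[OF f, of x] by (simp add: \<phi>_def series_fun_def nontrivial_characters_def)
      qed
      then show False using infeasible coefficient_setD(3)[OF f] by force
    qed
  qed
  then obtain a b where ab: "even_density \<Omega>m a" "even_density \<Omega>p b" "\<forall>f\<in>?K. g a b f < 0"
    by (auto simp: G_def)
  then have "\<forall>f\<in>?K. pairing (\<lambda>x. a x - b x) f < 0" by (simp add: g_def)
  with ab show ?thesis by blast
qed

text \<open>
  Pairing with the zero family gives \<open>\<integral> p < 0\<close>.  Pairing with the family that puts mass \<open>r/2\<close> on each of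
  \<open>\<gamma>\<close> and \<open>\<gamma>\<^sup>-\<^sup>1\<close> gives \<open>\<integral> p + r Re p^(\<gamma>) < 0\<close>.  Scaling \<open>p\<close> so that \<open>\<integral> p = -r\<close> turns this into \<open>Re p^(\<gamma>) \<le> 1\<close>.
\<close>

lemma normalised_dual_density:
  assumes \<Omega>p: "\<Omega>p \<in> sets borel" "uminus ` \<Omega>p = \<Omega>p" "assumption_O haar (- \<Omega>p)"
    and \<Omega>m: "\<Omega>m \<in> sets borel" "uminus ` \<Omega>m = \<Omega>m" "assumption_O haar (- \<Omega>m)"
    and r: "r > 0"
    and infeasible: "\<And>f. f \<in> lp_primal_feasible \<Omega>p \<Omega>m \<Longrightarrow> r < (\<Sum>\<^sub>\<infinity>\<gamma>\<in>nontrivial_characters. f \<gamma>)"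
  shows "\<exists>a b. even_density \<Omega>m a \<and> even_density \<Omega>p b \<and> (LINT x|haar. a x - b x) = - r \<and>
    (\<forall>\<gamma>\<in>nontrivial_characters. Re (LINT x|haar. \<gamma> x * of_real (a x - b x)) \<le> 1)"
proof -
  obtain a b where a: "even_density \<Omega>m a" and b: "even_density \<Omega>p b"
    and neg: "\<And>f. f \<in> coefficient_set r \<Longrightarrow> pairing (\<lambda>x. a x - b x) f < 0"
    using separating_density[OF \<Omega>p \<Omega>m less_imp_le[OF r] infeasible] by blast
  define p where "p x = a x - b x" for x
  have p: "bounded_borel p"
    using bounded_borel_linear[of a b 1 "-1"] a b by (simp add: even_density_def p_def[abs_def])
  define m where "m = - (LINT x|haar. p x)"
  define q where "q \<gamma> = Re (LINT x|haar. \<gamma> x * of_real (p x))" for \<gamma> :: "'a \<Rightarrow> complex"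
  have expand: "((\<lambda>\<gamma>. f \<gamma> * q \<gamma>) has_sum (pairing p f + m)) nontrivial_characters" if "f \<in> coefficient_set r" for f
    using pairing_expansion[OF p that] by (simp add: q_def m_def)
  have m: "m > 0"
  proof -
    have z: "(\<lambda>_. 0) \<in> coefficient_set r" using r by (simp add: coefficient_set_def)
    have "((\<lambda>\<gamma>. 0) has_sum (pairing p (\<lambda>_. 0) + m)) nontrivial_characters" using expand[OF z] by simp
    then have "pairing p (\<lambda>_. 0) + m = 0" using has_sum_0_simp has_sum_unique by blast
    then show ?thesis using neg[OF z] by (simp add: p_def[abs_def])
  qed
  have q_le: "r * q \<gamma> < m" if \<gamma>: "\<gamma> \<in> nontrivial_characters" for \<gamma>
  proof -
    define \<gamma>' where "\<gamma>' = (\<lambda>x. cnj (\<gamma> x))"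
    have \<gamma>': "\<gamma>' \<in> nontrivial_characters" unfolding \<gamma>'_def by (rule nontrivial_cnj[OF \<gamma>])
    \<comment> \<open>If \<open>\<gamma>\<close> is real-valued, then \<open>\<gamma>'\<close> equals \<open>\<gamma>\<close> and the two halves add up to mass \<open>r\<close>.\<close>
    define f where "f \<delta> = (r / 2) * (of_bool (\<delta> = \<gamma>) + of_bool (\<delta> = \<gamma>'))" for \<delta>
    have sum_f: "(\<Sum>\<delta>\<in>F. f \<delta> * k \<delta>) = (r / 2) * (of_bool (\<gamma> \<in> F) * k \<gamma> + of_bool (\<gamma>' \<in> F) * k \<gamma>')"
      if "finite F" for F and k :: "('a \<Rightarrow> complex) \<Rightarrow> real"
    proof -
      have single: "(\<Sum>\<delta>\<in>F. of_bool (\<delta> = \<eta>) * k \<delta>) = of_bool (\<eta> \<in> F) * k \<eta>" for \<eta>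
        using that by (simp add: of_bool_def if_distrib[of "\<lambda>x. x * _"] cong: if_cong)
      have "(\<Sum>\<delta>\<in>F. f \<delta> * k \<delta>) = (r / 2) * ((\<Sum>\<delta>\<in>F. of_bool (\<delta> = \<gamma>) * k \<delta>) + (\<Sum>\<delta>\<in>F. of_bool (\<delta> = \<gamma>') * k \<delta>))"
        unfolding f_def sum.distrib[symmetric] sum_distrib_left by (intro sum.cong refl) (simp add: algebra_simps)
      then show ?thesis by (simp only: single)
    qed
    have "f \<in> coefficient_set r"
      unfolding coefficient_set_def
    proof (intro CollectI conjI allI impI)
      show "0 \<le> f \<delta>" for \<delta> using r by (simp add: f_def)
      show "f \<delta> = 0" if "\<delta> \<notin> nontrivial_characters" for \<delta> using that \<gamma> \<gamma>' by (auto simp: f_def)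
      have "(\<lambda>x. cnj (\<delta> x)) = \<gamma> \<longleftrightarrow> \<delta> = \<gamma>'" "(\<lambda>x. cnj (\<delta> x)) = \<gamma>' \<longleftrightarrow> \<delta> = \<gamma>" for \<delta>
        by (auto simp: \<gamma>'_def fun_eq_iff) (metis complex_cnj_cnj)
      then show "f (\<lambda>x. cnj (\<delta> x)) = f \<delta>" for \<delta> by (simp add: f_def)
      show "sum f F \<le> r" if "finite F" for F
      proof -
        have "sum f F = (r / 2) * (of_bool (\<gamma> \<in> F) + of_bool (\<gamma>' \<in> F))"
          using sum_f[OF that, of "\<lambda>_. 1"] by simp
        also have "\<dots> \<le> (r / 2) * 2" using r by (intro mult_left_mono) (auto simp: of_bool_def)
        finally show ?thesis by simp
      qed
    qed
    note f = this
    have "((\<lambda>\<delta>. f \<delta> * q \<delta>) has_sum (\<Sum>\<delta>\<in>{\<gamma>, \<gamma>'}. f \<delta> * q \<delta>)) nontrivial_characters"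
      by (rule has_sum_finite_neutralI[of "{\<gamma>, \<gamma>'}"]) (use \<gamma> \<gamma>' in \<open>auto simp: f_def\<close>)
    also have "(\<Sum>\<delta>\<in>{\<gamma>, \<gamma>'}. f \<delta> * q \<delta>) = (r / 2) * (q \<gamma> + q \<gamma>')"
      using sum_f[of "{\<gamma>, \<gamma>'}" q] by simp
    also have "q \<gamma>' = q \<gamma>"
    proof -
      have "(LINT x|haar. \<gamma>' x * of_real (p x)) = (LINT x|haar. cnj (\<gamma> x * of_real (p x)))" by (simp add: \<gamma>'_def)
      also have "\<dots> = cnj (LINT x|haar. \<gamma> x * of_real (p x))" by (rule Bochner_Integration.integral_cnj)
      finally show ?thesis by (simp add: q_def)
    qed
    finally have "r * q \<gamma> = pairing p f + m" using expand[OF f] has_sum_unique by fastforce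
    then show ?thesis using neg[OF f] by (simp add: p_def[abs_def])
  qed
  define s where "s = r / m"
  have s: "s \<ge> 0" using r m by (simp add: s_def)
  show ?thesis
  proof (intro exI conjI ballI)
    show "even_density \<Omega>m (\<lambda>x. s * a x)" using even_density_linear[OF a a s order_refl] by simp
    show "even_density \<Omega>p (\<lambda>x. s * b x)" using even_density_linear[OF b b s order_refl] by simp
    show "(LINT x|haar. s * a x - s * b x) = - r"
    proof -
      have "(LINT x|haar. s * a x - s * b x) = s * (LINT x|haar. p x)" by (simp add: p_def right_diff_distrib[symmetric])
      then show ?thesis using m by (simp add: s_def m_def field_simps)
    qed
    fix \<gamma> :: "'a \<Rightarrow> complex" assume \<gamma>: "\<gamma> \<in> nontrivial_characters"
    have "(LINT x|haar. \<gamma> x * of_real (s * a x - s * b x)) = (LINT x|haar. of_real s * (\<gamma> x * of_real (p x)))"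
      by (simp add: p_def algebra_simps)
    then have "Re (LINT x|haar. \<gamma> x * of_real (s * a x - s * b x)) = s * q \<gamma>" by (simp add: q_def)
    also have "\<dots> \<le> 1" using q_le[OF \<gamma>] m by (simp add: s_def field_simps)
    finally show "Re (LINT x|haar. \<gamma> x * of_real (s * a x - s * b x)) \<le> 1" .
  qed
qed

definition density_measure :: "('a \<Rightarrow> real) \<Rightarrow> 'a measure" where
  "density_measure a = density haar (\<lambda>x. ennreal (a x))"

context
  fixes \<Omega> :: "'a set" and a assumes a: "even_density \<Omega> a"
begin

lemma density_measurable: "a \<in> borel_measurable borel" and density_nonneg: "0 \<le> a x"
  and density_even: "a (- x) = a x" and density_zero: "x \<in> \<Omega> \<Longrightarrow> a x = 0" and density_bounded: "bounded_borel a"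
  using a unfolding even_density_def bounded_borel_def by blast+

lemma sets_density_measure: "sets (density_measure a) = sets borel"
  by (simp add: density_measure_def)

lemma density_measure_le:
  obtains B where "B \<ge> 0" "finite_measure (density_measure a)"
    "\<And>A. A \<in> sets borel \<Longrightarrow> measure (density_measure a) A \<le> B * measure haar A"
proof -
  obtain B where B: "\<And>x. \<bar>a x\<bar> \<le> B" using density_bounded by (auto simp: bounded_borel_def)
  have B0: "B \<ge> 0" using order_trans[OF abs_ge_zero B] .
  have [measurable]: "a \<in> borel_measurable haar" using density_measurable measurable_cong_sets[OF sets_haar refl] by blast
  have le: "emeasure (density_measure a) A \<le> ennreal (B * measure haar A)" if A: "A \<in> sets borel" for A
  proof -
    have "emeasure (density_measure a) A = (\<integral>\<^sup>+x. ennreal (a x) * indicator A x \<partial>haar)"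
      unfolding density_measure_def using A by (intro emeasure_density) auto
    also have "\<dots> \<le> (\<integral>\<^sup>+x. ennreal B * indicator A x \<partial>haar)"
      using B by (intro nn_integral_mono mult_right_mono ennreal_leI) (auto intro: order_trans[OF abs_ge_self])
    also have "\<dots> = ennreal (B * measure haar A)"
      using A B0 by (simp add: nn_integral_cmult_indicator emeasure_eq_measure ennreal_mult)
    finally show ?thesis .
  qed
  have fin: "finite_measure (density_measure a)"
  proof
    show "emeasure (density_measure a) (space (density_measure a)) \<noteq> \<infinity>"
      using le[of UNIV] by (auto simp: space_eq_UNIV_if_sets_borel[OF sets_density_measure] top_unique)
  qed
  have "measure (density_measure a) A \<le> B * measure haar A" if "A \<in> sets borel" for A
    using le[OF that] B0 by (simp add: finite_measure.emeasure_eq_measure[OF fin])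
  then show thesis using that B0 fin by blast
qed

lemma finite_density_measure: "finite_measure (density_measure a)"
  using density_measure_le by blast

lemma signed_borel_density_measure: "signed_borel_measure (measure (density_measure a))"
  by (rule signed_borel_measure_measure[OF finite_density_measure sets_density_measure])

lemma signed_integral_density_measure:
  fixes f :: "'a \<Rightarrow> 'b::{banach, second_countable_topology}"
  assumes f: "continuous_on UNIV f"
  shows "signed_integral (measure (density_measure a)) f = (LINT x|haar. a x *\<^sub>R f x)"
proof -
  have [measurable]: "a \<in> borel_measurable haar" "f \<in> borel_measurable haar"
    using density_measurable borel_measurable_continuous_onI[OF f] measurable_cong_sets[OF sets_haar refl] by blast+
  have "signed_integral (measure (density_measure a)) f = integral\<^sup>L (density_measure a) f"
    by (rule signed_integral_measure[OF compact_group f finite_density_measure sets_density_measure])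
  also have "\<dots> = (LINT x|haar. a x *\<^sub>R f x)"
    unfolding density_measure_def by (rule integral_density) (auto simp: density_nonneg)
  finally show ?thesis .
qed

lemma density_measure_in_M_star: "measure (density_measure a) \<in> M_star \<Omega>"
proof -
  let ?\<mu> = "measure (density_measure a)"
  obtain B where B: "B \<ge> 0" "\<And>A. A \<in> sets borel \<Longrightarrow> ?\<mu> A \<le> B * measure haar A"
    using density_measure_le by metis
  have "?\<mu> \<in> regular_signed_measures"
  proof (rule regular_signed_measure_dominated[OF signed_borel_density_measure])
    fix A :: "'a set" assume "A \<in> sets borel"
    moreover have "0 \<le> B * dirac 0 A" using B(1) by (simp add: dirac_def)
    ultimately show "\<bar>?\<mu> A\<bar> \<le> B * (dirac 0 A + measure haar A)" using B(2)[of A] by (simp add: distrib_left)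
  qed
  moreover have "measure_support ?\<mu> \<subseteq> closure (- \<Omega>)"
  proof (rule ccontr)
    assume "\<not> measure_support ?\<mu> \<subseteq> closure (- \<Omega>)"
    then obtain x where x: "x \<in> measure_support ?\<mu>" "x \<notin> closure (- \<Omega>)" by blast
    define V where "V = - closure (- \<Omega>)"
    have V: "open V" "x \<in> V" "V \<subseteq> \<Omega>" using x(2) closure_subset[of "- \<Omega>"] by (auto simp: V_def)
    have [measurable]: "a \<in> borel_measurable haar" using density_measurable measurable_cong_sets[OF sets_haar refl] by blast
    have zero: "?\<mu> A = 0" if A: "A \<in> sets borel" "A \<subseteq> V" for A
    proof -
      have "emeasure (density_measure a) A = (\<integral>\<^sup>+x. ennreal (a x) * indicator A x \<partial>haar)"
        unfolding density_measure_def using A by (intro emeasure_density) auto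
      also have "\<dots> = (\<integral>\<^sup>+x. 0 \<partial>haar)"
        using A(2) V(3) density_zero by (intro nn_integral_cong) (auto simp: indicator_def)
      finally show ?thesis by (simp add: measure_def)
    qed
    have "measure (total_variation ?\<mu>) V \<le> 2 * 0"
      using V(1) zero by (intro measure_total_variation_le[OF signed_borel_density_measure]) auto
    then have "measure (total_variation ?\<mu>) V = 0" using measure_nonneg[of "total_variation ?\<mu>" V] by linarith
    then have "emeasure (total_variation ?\<mu>) V = 0"
      by (simp add: finite_measure.emeasure_eq_measure[OF finite_measure_total_variation[OF signed_borel_density_measure]])
    moreover have "emeasure (total_variation ?\<mu>) V > 0" using x(1) V(1,2) by (simp add: measure_support_def)
    ultimately show False by simp
  qed
  ultimately show ?thesis by (simp add: M_star_def)
qed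

end

text \<open>
  Put \<open>p = a - b\<close> and \<open>s = 1 / (1 + r)\<close>.  The measure \<open>p\<lambda>\<close> is feasible for the linear dual.  The measure
  \<open>\<tau> = s \<delta>\<^sub>0 - \<lambda> - s p\<lambda>\<close> has the transform \<open>s (1 - p^(\<gamma>)) \<ge> 0\<close> at \<open>\<gamma> \<noteq> \<one>\<close> and \<open>s - 1 + s r = 0\<close> at \<open>\<one>\<close>, so it
  is positive definite with total mass zero, and \<open>s\<close> is admissible in the other dual problem.
\<close>

lemma dual_points_of_density:
  assumes a: "even_density \<Omega>m a" and b: "even_density \<Omega>p b" and r: "r \<ge> 0"
    and int: "(LINT x|haar. a x - b x) = - r"
    and le: "\<And>\<gamma>. \<gamma> \<in> nontrivial_characters \<Longrightarrow> Re (LINT x|haar. \<gamma> x * of_real (a x - b x)) \<le> 1"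
  shows "\<exists>\<mu>\<in>lp_dual_feasible \<Omega>p \<Omega>m. - \<mu> UNIV = r"
    and "(\<lambda>A. 1 / (1 + r) * dirac 0 A - measure haar A)
        \<in> minkowski_sum (minkowski_diff (M_star \<Omega>m) (M_star \<Omega>p)) (T_zero haar)"
proof -
  let ?D = "\<lambda>a. measure (density_measure a)"
  define t where "t \<gamma> = (LINT x|haar. \<gamma> x * of_real (a x - b x))" for \<gamma> :: "'a \<Rightarrow> complex"
  note sb = signed_borel_density_measure[OF a] signed_borel_density_measure[OF b]
  note ba = density_bounded[OF a] and bb = density_bounded[OF b]
  note lin = signed_integral_linear_measure[OF compact_group]
  have haar_sb: "signed_borel_measure (measure haar)"
    by (rule signed_borel_measure_measure) (simp_all add: finite_measure_axioms)
  have t_real: "t \<gamma> = of_real (Re (t \<gamma>))" if \<gamma>: "\<gamma> \<in> dual_group" for \<gamma>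
  proof -
    have meas: "(\<lambda>x. \<gamma> x * of_real (a x - b x)) \<in> borel_measurable borel"
    proof -
      have [measurable]: "\<gamma> \<in> borel_measurable borel" "a \<in> borel_measurable borel" "b \<in> borel_measurable borel"
        using dual_group_continuous[OF \<gamma>] density_measurable[OF a] density_measurable[OF b]
        by (simp_all add: borel_measurable_continuous_onI)
      show ?thesis by measurable
    qed
    have "cnj (t \<gamma>) = (LINT x|haar. cnj (\<gamma> x * of_real (a x - b x)))"
      unfolding t_def by (rule Bochner_Integration.integral_cnj[symmetric])
    also have "\<dots> = (LINT x|haar. \<gamma> (- x) * of_real (a (- x) - b (- x)))"
      by (simp add: dual_group_minus[OF \<gamma>] density_even[OF a] density_even[OF b])
    also have "\<dots> = t \<gamma>" unfolding t_def by (rule integral_reflect[OF meas])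
    finally show ?thesis by (simp add: complex_eq_iff)
  qed
  have D_diff: "signed_integral (?D a) \<gamma> - signed_integral (?D b) \<gamma> = t \<gamma>" if \<gamma>: "\<gamma> \<in> dual_group" for \<gamma>
  proof -
    note c\<gamma> = dual_group_continuous[OF \<gamma>]
    have "signed_integral (?D a) \<gamma> - signed_integral (?D b) \<gamma> = (LINT x|haar. a x *\<^sub>R \<gamma> x) - (LINT x|haar. b x *\<^sub>R \<gamma> x)"
      by (simp add: signed_integral_density_measure[OF a c\<gamma>] signed_integral_density_measure[OF b c\<gamma>])
    also have "\<dots> = (LINT x|haar. a x *\<^sub>R \<gamma> x - b x *\<^sub>R \<gamma> x)"
      by (rule Bochner_Integration.integral_diff[OF bounded_borel_integrable[OF ba c\<gamma>] bounded_borel_integrable[OF bb c\<gamma>], symmetric])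
    finally show ?thesis by (simp add: t_def scaleR_conv_of_real algebra_simps)
  qed
  have t_trivial: "t trivial_character = of_real (- r)"
    using int unfolding t_def by (simp only: mult_1 integral_complex_of_real)
  have mass: "?D a UNIV - ?D b UNIV = - r"
  proof -
    have "complex_of_real (?D a UNIV - ?D b UNIV) = of_real (- r)"
      using D_diff[OF trivial_in_dual_group]
      by (simp only: t_trivial signed_integral_one[OF sb(1)] signed_integral_one[OF sb(2)] of_real_diff)
    then show ?thesis by (simp only: of_real_eq_iff)
  qed
  obtain A where A: "A \<ge> 0" "\<And>S. S \<in> sets borel \<Longrightarrow> ?D a S \<le> A * measure haar S"
    using density_measure_le[OF a] by metis
  obtain B where B: "B \<ge> 0" "\<And>S. S \<in> sets borel \<Longrightarrow> ?D b S \<le> B * measure haar S"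
    using density_measure_le[OF b] by metis
  have dirac_nonneg: "0 \<le> dirac 0 S" for S :: "'a set" by (simp add: dirac_def)

  show "\<exists>\<mu>\<in>lp_dual_feasible \<Omega>p \<Omega>m. - \<mu> UNIV = r"
  proof (rule bexI)
    let ?\<mu> = "\<lambda>S. 1 * ?D a S + (- 1) * ?D b S"
    have sb_\<mu>: "signed_borel_measure ?\<mu>" by (rule signed_borel_measure_linear[OF sb])
    have reg: "?\<mu> \<in> regular_signed_measures"
    proof (rule regular_signed_measure_dominated[OF sb_\<mu>])
      fix S :: "'a set" assume S: "S \<in> sets borel"
      have "\<bar>?\<mu> S\<bar> \<le> (A + B) * measure haar S"
        using A(2)[OF S] B(2)[OF S] measure_nonneg[of "density_measure a" S] measure_nonneg[of "density_measure b" S]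
        unfolding distrib_right by linarith
      also have "\<dots> \<le> (A + B) * (dirac 0 S + measure haar S)"
        using A(1) B(1) dirac_nonneg[of S] by (intro mult_left_mono) auto
      finally show "\<bar>?\<mu> S\<bar> \<le> (A + B) * (dirac 0 S + measure haar S)" .
    qed
    have "signed_integral ?\<mu> \<phi> \<ge> 0" if \<phi>: "\<phi> \<in> sign_cone \<Omega>p \<Omega>m" for \<phi>
    proof -
      have \<phi>': "continuous_on UNIV \<phi>" "\<And>x. x \<notin> \<Omega>p \<Longrightarrow> \<phi> x \<le> 0" "\<And>x. x \<notin> \<Omega>m \<Longrightarrow> \<phi> x \<ge> 0"
        using \<phi> by (auto simp: sign_cone_def)
      have "a x * \<phi> x \<ge> 0" for x
        using \<phi>'(3)[of x] density_zero[OF a, of x] density_nonneg[OF a, of x] by (cases "x \<in> \<Omega>m") auto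
      moreover have "b x * \<phi> x \<le> 0" for x
        using \<phi>'(2)[of x] density_zero[OF b, of x] density_nonneg[OF b, of x]
        by (cases "x \<in> \<Omega>p") (auto simp: mult_nonneg_nonpos)
      moreover have "(LINT x|haar. - (b x * \<phi> x)) = - (LINT x|haar. b x * \<phi> x)"
        by (rule Bochner_Integration.integral_minus)
      ultimately have "(LINT x|haar. a x * \<phi> x) \<ge> 0" "(LINT x|haar. b x * \<phi> x) \<le> 0"
        using integral_nonneg_AE[of "\<lambda>x. a x * \<phi> x" haar] integral_nonneg_AE[of "\<lambda>x. - (b x * \<phi> x)" haar] by auto
      then show ?thesis
        unfolding lin[OF \<phi>'(1) sb] signed_integral_density_measure[OF a \<phi>'(1)] signed_integral_density_measure[OF b \<phi>'(1)]
        by simp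
    qed
    moreover have "1 - signed_integral ?\<mu> \<gamma> \<in> \<real>\<^sub>\<ge>\<^sub>0" if \<gamma>: "\<gamma> \<in> nontrivial_characters" for \<gamma>
    proof -
      have \<gamma>': "\<gamma> \<in> dual_group" using \<gamma> nontrivial_subset by blast
      have "signed_integral ?\<mu> \<gamma> = t \<gamma>"
        unfolding lin[OF dual_group_continuous[OF \<gamma>'] sb] using D_diff[OF \<gamma>'] by simp
      then show ?thesis using le[OF \<gamma>] t_real[OF \<gamma>'] by (simp add: complex_nonneg_Reals_iff t_def complex_eq_iff)
    qed
    ultimately show "?\<mu> \<in> lp_dual_feasible \<Omega>p \<Omega>m"
      using reg by (simp add: lp_dual_feasible_def sign_cone_dual_def nontrivial_characters_def)
    show "- ?\<mu> UNIV = r" using mass by simp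
  qed

  show "(\<lambda>A. 1 / (1 + r) * dirac 0 A - measure haar A)
        \<in> minkowski_sum (minkowski_diff (M_star \<Omega>m) (M_star \<Omega>p)) (T_zero haar)"
  proof -
    define s where "s = 1 / (1 + r)"
    have s: "s \<ge> 0" "s * r = 1 - s" using r by (simp_all add: s_def field_simps)
    define a' where "a' x = s * a x" for x
    define b' where "b' x = s * b x" for x
    have a': "even_density \<Omega>m a'" using even_density_linear[OF a a s(1) order_refl] by (simp add: a'_def[abs_def])
    have b': "even_density \<Omega>p b'" using even_density_linear[OF b b s(1) order_refl] by (simp add: b'_def[abs_def])
    note sb' = signed_borel_density_measure[OF a'] signed_borel_density_measure[OF b']
    let ?\<sigma> = "\<lambda>S. s * dirac 0 S + (- 1) * measure haar S"
    let ?\<mu> = "\<lambda>S. 1 * ?D a' S + (- 1) * ?D b' S"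
    let ?\<tau> = "\<lambda>S. 1 * ?\<sigma> S + (- 1) * ?\<mu> S"
    have sb_\<sigma>: "signed_borel_measure ?\<sigma>" by (rule signed_borel_measure_linear[OF signed_borel_measure_dirac haar_sb])
    have sb_\<mu>: "signed_borel_measure ?\<mu>" by (rule signed_borel_measure_linear[OF sb'])
    have sb_\<tau>: "signed_borel_measure ?\<tau>" by (rule signed_borel_measure_linear[OF sb_\<sigma> sb_\<mu>])
    have \<tau>_hat: "signed_integral ?\<tau> \<gamma> = of_real (s - (if \<gamma> = trivial_character then 1 else 0) - s * Re (t \<gamma>))"
      if \<gamma>: "\<gamma> \<in> dual_group" for \<gamma>
    proof -
      note c\<gamma> = dual_group_continuous[OF \<gamma>]
      have scale: "signed_integral (?D a') \<gamma> = of_real s * signed_integral (?D a) \<gamma>"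
        "signed_integral (?D b') \<gamma> = of_real s * signed_integral (?D b) \<gamma>"
        unfolding signed_integral_density_measure[OF a' c\<gamma>] signed_integral_density_measure[OF a c\<gamma>]
          signed_integral_density_measure[OF b' c\<gamma>] signed_integral_density_measure[OF b c\<gamma>]
        by (simp_all add: a'_def b'_def scaleR_conv_of_real mult.assoc)
      have "signed_integral (measure haar) \<gamma> = (LINT x|haar. \<gamma> x)"
        by (rule signed_integral_measure[OF compact_group c\<gamma>]) (simp_all add: finite_measure_axioms)
      then have "signed_integral ?\<tau> \<gamma> = of_real s - (if \<gamma> = trivial_character then 1 else 0)
          - (signed_integral (?D a') \<gamma> - signed_integral (?D b') \<gamma>)"
        unfolding lin[OF c\<gamma> sb_\<sigma> sb_\<mu>] lin[OF c\<gamma> signed_borel_measure_dirac haar_sb] lin[OF c\<gamma> sb']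
        by (simp add: signed_integral_dirac[OF compact_group c\<gamma>] dual_group_at_0[OF \<gamma>]
            integral_character[OF \<gamma>] scaleR_conv_of_real)
      also have "signed_integral (?D a') \<gamma> - signed_integral (?D b') \<gamma> = of_real s * t \<gamma>"
        unfolding scale D_diff[OF \<gamma>, symmetric] by (simp add: right_diff_distrib)
      finally show ?thesis by (subst (asm) t_real[OF \<gamma>]) simp
    qed
    have "positive_definite_measure haar ?\<tau>"
      unfolding positive_definite_measure_iff[OF sb_\<tau>]
    proof
      fix \<gamma> :: "'a \<Rightarrow> complex" assume \<gamma>: "\<gamma> \<in> dual_group"
      have "0 \<le> s - (if \<gamma> = trivial_character then 1 else 0) - s * Re (t \<gamma>)"
      proof (cases "\<gamma> = trivial_character")
        case True
        then show ?thesis using t_trivial s(2) by simp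
      next
        case False
        then have "Re (t \<gamma>) \<le> 1" using le[of \<gamma>] \<gamma> by (simp add: nontrivial_characters_def t_def)
        then have "s * Re (t \<gamma>) \<le> s * 1" using s(1) by (rule mult_left_mono)
        then show ?thesis using False by simp
      qed
      then show "signed_integral ?\<tau> \<gamma> \<in> \<real>\<^sub>\<ge>\<^sub>0" unfolding \<tau>_hat[OF \<gamma>] by (simp only: nonneg_Reals_of_real_iff)
    qed
    moreover have "?\<tau> UNIV = 0"
    proof -
      have "complex_of_real (?\<tau> UNIV) = signed_integral ?\<tau> trivial_character"
        by (rule signed_integral_one[OF sb_\<tau>, symmetric])
      also have "\<dots> = of_real (s - 1 - s * Re (t trivial_character))"
        by (simp only: \<tau>_hat[OF trivial_in_dual_group] if_True simp_thms)
      also have "s - 1 - s * Re (t trivial_character) = 0" using s(2) t_trivial by simp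
      finally show ?thesis by (simp only: of_real_0 of_real_eq_0_iff)
    qed
    moreover have "?\<tau> \<in> regular_signed_measures"
    proof -
      obtain A' where A': "A' \<ge> 0" "\<And>S. S \<in> sets borel \<Longrightarrow> ?D a' S \<le> A' * measure haar S"
        using density_measure_le[OF a'] by metis
      obtain B' where B': "B' \<ge> 0" "\<And>S. S \<in> sets borel \<Longrightarrow> ?D b' S \<le> B' * measure haar S"
        using density_measure_le[OF b'] by metis
      show ?thesis
      proof (rule regular_signed_measure_dominated[OF sb_\<tau>])
        fix S :: "'a set" assume S: "S \<in> sets borel"
        have "\<bar>?\<tau> S\<bar> \<le> s * dirac 0 S + measure haar S + ?D a' S + ?D b' S"
          using s(1) dirac_nonneg[of S] measure_nonneg[of haar S] measure_nonneg[of "density_measure a'" S]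
            measure_nonneg[of "density_measure b'" S] mult_nonneg_nonneg[OF s(1) dirac_nonneg[of S]]
          by (simp add: abs_le_iff)
        also have "\<dots> \<le> s * dirac 0 S + measure haar S + A' * measure haar S + B' * measure haar S"
          using A'(2)[OF S] B'(2)[OF S] by linarith
        also have "\<dots> \<le> (s + 1 + A' + B') * dirac 0 S + (s + 1 + A' + B') * measure haar S"
          using s(1) A'(1) B'(1) dirac_nonneg[of S] measure_nonneg[of haar S]
          by (simp add: distrib_right)
        finally show "\<bar>?\<tau> S\<bar> \<le> (s + 1 + A' + B') * (dirac 0 S + measure haar S)" by (simp add: distrib_left)
      qed
    qed
    ultimately have \<tau>: "?\<tau> \<in> T_zero haar" by (simp add: T_zero_def)
    have \<mu>: "(\<lambda>S. ?D a' S - ?D b' S) \<in> minkowski_diff (M_star \<Omega>m) (M_star \<Omega>p)"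
      using density_measure_in_M_star[OF a'] density_measure_in_M_star[OF b'] unfolding minkowski_diff_def by blast
    have "(\<lambda>S. s * dirac 0 S - measure haar S) = (\<lambda>S. (?D a' S - ?D b' S) + ?\<tau> S)" by auto
    then show ?thesis unfolding s_def[symmetric] by (rule minkowski_sumI[OF \<mu> \<tau>])
  qed
qed

text \<open>
  For \<open>r = 0\<close> the zero density serves; it is needed when the linear programme has value \<open>0\<close>, where no
  \<open>r\<close> lies strictly between \<open>0\<close> and the value.
\<close>

lemma dual_points_exist:
  assumes \<Omega>p: "\<Omega>p \<in> sets borel" "uminus ` \<Omega>p = \<Omega>p" "assumption_O haar (- \<Omega>p)"
    and \<Omega>m: "\<Omega>m \<in> sets borel" "uminus ` \<Omega>m = \<Omega>m" "assumption_O haar (- \<Omega>m)"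
    and r: "r = 0 \<or> 0 < r \<and> (\<forall>f\<in>lp_primal_feasible \<Omega>p \<Omega>m. r < (\<Sum>\<^sub>\<infinity>\<gamma>\<in>nontrivial_characters. f \<gamma>))"
  shows "\<exists>\<mu>\<in>lp_dual_feasible \<Omega>p \<Omega>m. - \<mu> UNIV = r"
    and "(\<lambda>A. 1 / (1 + r) * dirac 0 A - measure haar A)
        \<in> minkowski_sum (minkowski_diff (M_star \<Omega>m) (M_star \<Omega>p)) (T_zero haar)"
proof -
  have "\<exists>a b. even_density \<Omega>m a \<and> even_density \<Omega>p b \<and> (LINT x|haar. a x - b x) = - r \<and>
    (\<forall>\<gamma>\<in>nontrivial_characters. Re (LINT x|haar. \<gamma> x * of_real (a x - b x)) \<le> 1)"
  proof (cases "r = 0")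
    case True
    then show ?thesis using even_density_zero by (intro exI[of _ "\<lambda>_. 0"]) auto
  next
    case False
    then show ?thesis using r by (intro normalised_dual_density[OF \<Omega>p \<Omega>m]) auto
  qed
  then obtain a b where ab: "even_density \<Omega>m a" "even_density \<Omega>p b" "(LINT x|haar. a x - b x) = - r"
    "\<And>\<gamma>. \<gamma> \<in> nontrivial_characters \<Longrightarrow> Re (LINT x|haar. \<gamma> x * of_real (a x - b x)) \<le> 1" by blast
  have "r \<ge> 0" using r by auto
  from dual_points_of_density[OF ab(1,2) this ab(3,4)]
  show "\<exists>\<mu>\<in>lp_dual_feasible \<Omega>p \<Omega>m. - \<mu> UNIV = r"
    and "(\<lambda>A. 1 / (1 + r) * dirac 0 A - measure haar A)
        \<in> minkowski_sum (minkowski_diff (M_star \<Omega>m) (M_star \<Omega>p)) (T_zero haar)" by blast+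
qed

end

theorem theorem1:
  fixes haar :: "'a::{topological_ab_group_add, t2_space} measure"
    and \<Omega>p \<Omega>m :: "'a set"
  assumes "compact (UNIV :: 'a set)"
    and "normalised_haar haar"
    and "\<Omega>p \<in> sets borel" and "\<Omega>m \<in> sets borel"
    and "uminus ` \<Omega>p = \<Omega>p" and "uminus ` \<Omega>m = \<Omega>m"
    and "0 \<in> interior \<Omega>p"
    and "assumption_O haar (- \<Omega>p)" and "assumption_O haar (- \<Omega>m)"
  shows "primal_value haar \<Omega>p \<Omega>m = 1 / (1 + lp_primal_value \<Omega>p \<Omega>m) \<and>
    dual_value haar \<Omega>p \<Omega>m = 1 / (1 + lp_dual_value \<Omega>p \<Omega>m) \<and>
    primal_value haar \<Omega>p \<Omega>m = dual_value haar \<Omega>p \<Omega>m"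
proof -
  interpret compact_ab_group haar using assms(1,2) by unfold_locales
  let ?X = "nontrivial_characters"
  have lp_eq: "lp_primal_value \<Omega>p \<Omega>m = (INF f\<in>lp_primal_feasible \<Omega>p \<Omega>m. ereal (\<Sum>\<^sub>\<infinity>\<gamma>\<in>?X. f \<gamma>))"
    by (simp add: lp_primal_value_def nontrivial_characters_def)
  obtain u where u: "u \<ge> 0" "lp_primal_value \<Omega>p \<Omega>m = ereal u"
    "\<And>f. f \<in> lp_primal_feasible \<Omega>p \<Omega>m \<Longrightarrow> u \<le> (\<Sum>\<^sub>\<infinity>\<gamma>\<in>?X. f \<gamma>)"
    "primal_value haar \<Omega>p \<Omega>m = ereal (1 / (1 + u))"
  proof (rule SUP_eq_inverse_INF[of "function_class haar \<Omega>p \<Omega>m" "\<lambda>\<phi>. LINT x|haar. \<phi> x"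
        "lp_primal_feasible \<Omega>p \<Omega>m" "\<lambda>f. \<Sum>\<^sub>\<infinity>\<gamma>\<in>?X. f \<gamma>"])
    show "\<exists>\<phi>\<in>function_class haar \<Omega>p \<Omega>m. 0 < (LINT x|haar. \<phi> x)"
      by (rule function_class_positive_integral[OF assms(7)])
  qed (simp_all add: function_class_imp_lp_feasible lp_feasible_imp_function_class lp_eq primal_value_def)
  have r_ok: "r = 0 \<or> 0 < r \<and> (\<forall>f\<in>lp_primal_feasible \<Omega>p \<Omega>m. r < (\<Sum>\<^sub>\<infinity>\<gamma>\<in>?X. f \<gamma>))"
    if "r = 0 \<or> 0 < r \<and> r < u" for r using that u(3) by force
  note points = dual_points_exist[OF assms(3,5,8,4,6,9) r_ok]
  have lp_dual: "lp_dual_value \<Omega>p \<Omega>m = ereal u"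
    unfolding lp_dual_value_def
  proof (rule SUP_eqI)
    fix \<mu> assume \<mu>: "\<mu> \<in> lp_dual_feasible \<Omega>p \<Omega>m"
    have "ereal (- \<mu> UNIV) \<le> lp_primal_value \<Omega>p \<Omega>m"
      unfolding lp_eq using lp_weak_duality[OF _ \<mu>] by (intro INF_greatest) simp
    then show "ereal (- \<mu> UNIV) \<le> ereal u" by (simp only: u(2))
  next
    fix y assume y: "\<And>\<mu>. \<mu> \<in> lp_dual_feasible \<Omega>p \<Omega>m \<Longrightarrow> ereal (- \<mu> UNIV) \<le> y"
    have le: "ereal r \<le> y" if "r = 0 \<or> 0 < r \<and> r < u" for r
      using points(1)[OF that] y by blast
    show "ereal u \<le> y"
    proof (cases "u = 0")
      case False
      show ?thesis
      proof (rule ereal_le_real)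
        fix z assume "y \<le> ereal z"
        with le have z: "r \<le> z" if "0 < r \<and> r < u" for r using that order_trans by fastforce
        then show "ereal u \<le> ereal z" using False u(1) by (auto intro: dense_le_bounded[of 0])
      qed
    qed (use le in auto)
  qed
  have dual: "dual_value haar \<Omega>p \<Omega>m = ereal (1 / (1 + u))"
    unfolding dual_value_def
  proof (rule INF_eqI)
    fix \<alpha> assume "\<alpha> \<in> {\<alpha> :: real. (\<lambda>A. \<alpha> * dirac 0 A - measure haar A)
        \<in> minkowski_sum (minkowski_diff (M_star \<Omega>m) (M_star \<Omega>p)) (T_zero haar)}"
    then have "primal_value haar \<Omega>p \<Omega>m \<le> ereal \<alpha>"
      unfolding primal_value_def using function_class_dual_bound by (intro SUP_least) auto
    then show "ereal (1 / (1 + u)) \<le> ereal \<alpha>" by (simp only: u(4))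
  next
    fix y
    assume y: "\<And>\<alpha>. \<alpha> \<in> {\<alpha> :: real. (\<lambda>A. \<alpha> * dirac 0 A - measure haar A)
        \<in> minkowski_sum (minkowski_diff (M_star \<Omega>m) (M_star \<Omega>p)) (T_zero haar)} \<Longrightarrow> y \<le> ereal \<alpha>"
    have le: "y \<le> ereal (1 / (1 + r))" if "r = 0 \<or> 0 < r \<and> r < u" for r
      using points(2)[OF that] y by blast
    show "y \<le> ereal (1 / (1 + u))"
    proof (cases "u = 0")
      case False
      have "((\<lambda>r. ereal (1 / (1 + r))) \<longlongrightarrow> ereal (1 / (1 + u))) (at_left u)"
        using u(1) by (intro tendsto_intros) auto
      moreover have "\<forall>\<^sub>F r in at_left u. y \<le> ereal (1 / (1 + r))"
        using eventually_at_left_real[of 0 u] False u(1) by (auto elim!: eventually_mono intro!: le)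
      ultimately show ?thesis by (rule tendsto_lowerbound) simp
    qed (use le[of 0] in simp)
  qed
  have "1 / (1 + ereal u) = ereal (1 / (1 + u))"
    using u(1) by (simp add: one_ereal_def)
  then show ?thesis by (simp only: u(2,4) lp_dual dual simp_thms)
qed

end
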